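(* Let $\Omega=\mathbb{R}^3\setminus B_1(0)$, $\varepsilon\in(0,1/\sqrt{\pi})$, and let $\varphi\in L^\infty(\Omega)$ and $\varphi_b\in L^\infty(\partial\Omega)$ be radially symmetric. a) There is a unique radially symmetric global-in-time solution $(v_\varepsilon,w_\varepsilon)$ (in the sense of the context) with data $\varphi,\varphi_b$ which satisfies $$\sup_{0<t<T}\Big(\|v_\varepsilon(\cdot,t)\|_{L^\infty(\Omega)}+\sqrt{t/\varepsilon}\,\|\partial_\nu v_\varepsilon(\cdot,t)\|_{L^\infty(\Omega)}+\|w_\varepsilon(\cdot,t)\|_{L^\infty(\Omega)}\Big)<\infty\quad\text{for every }T>0,$$ and $u_\varepsilon:=v_\varepsilon+w_\varepsilon$ is a classical solution of $$\varepsilon\partial_tu_\varepsilon-\Delta u_\varepsilon=0\ \text{in }\Omega\times(0,\infty),\quad \partial_tu_\varepsilon+\partial_\nu u_\varepsilon=0\ \text{on }\partial\Omega\times(0,\infty),\quad u_\varepsilon(\cdot,0)=\varphi\ \text{in }\Omega,\quad u_\varepsilon(\cdot,0)=\varphi_b\ \text{on }\partial\Omega.$$ b) If furthermore $\sup_{\rho\ge1}|\rho\varphi(\rho)|<\infty$ and $0<\tau_1<\tau_2<\infty$, then $$\lim_{\varepsilon\to0}\ \sup_{\tau_1<t<\tau_2}\|u_\varepsilon(\cdot,t)-S_2(t)\varphi_b\|_{L^\infty(\Omega)}=0.$$ Moreover, for every $\varepsilon_0\in(0,1/\sqrt{\pi})$ and every $T>0$ there is $C(T)>0$ such that for every $\varepsilon\in(0,\varepsilon_0)$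 and all radially symmetric $\varphi\in L^\infty(\Omega)$ with $\sup_{\rho\ge1}|\rho\varphi(\rho)|<\infty$ and radially symmetric $\varphi_b\in L^\infty(\partial\Omega)$, $$\sup_{0<t<T}\Big(\|v_\varepsilon(\cdot,t)\|_{L^\infty(\Omega)}+\sqrt{t/\varepsilon}\,\|\partial_\nu v_\varepsilon(\cdot,t)\|_{L^\infty(\Omega)}+\|w_\varepsilon(\cdot,t)\|_{L^\infty(\Omega)}\Big)\le C(T)\Big(\|\varphi\|_{L^\infty(\Omega)}+\|\varphi_b\|_{L^\infty(\partial\Omega)}+\sup_{\rho\ge1}|\rho\varphi(\rho)|\Big).$$
   Context: Setting: $B_1(0)=\{x\in\mathbb{R}^3: |x|<1\}$, $\Omega=\mathbb{R}^3\setminus B_1(0)$. All functions are radially symmetric in $x$ and are written as functions of $r=|x|$; a radially symmetric element of $L^\infty(\partial\Omega)$ is identified with a real number. Suprema of $L^\infty$ functions are essential suprema. $\nu$ is regarded as a vector field on all of $\overline\Omega$ with $\partial_\nu=-\partial_r$ (on $\partial\Omega$ it is the outer unit normal of $\Omega$). Dirichlet heat semigroup: $S_1(t)\phi$ is the bounded solution $\theta(t)$ of $\partial_t\theta=\Delta\theta$ in $\Omega\times(0,\infty)$, $\theta=0$ on $\partial\Omega\times(0,\infty)$, $\theta(\cdot,0)=\phi$; explicitly, for radially symmetric $\phi$, $$[S_1(t)\phi](r)=\frac{1}{r\sqrt{4\pi t}}\int_1^\infty\Big(e^{-\frac{(r-\rho)^2}{4t}}-e^{-\frac{(r+\rho-2)^2}{4t}}\Big)\rho\,\phi(\rho)\,d\rho,\qquad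 r>1,\ t>0.$$ Elliptic problem with dynamical boundary condition: for $\psi\in\mathbb{R}$, $[S_2(t)\psi](r)=\dfrac{\psi}{re^t}$, $r\ge1$, $t\ge0$. Solution: given $\varphi\in L^\infty(\Omega)$, $\varphi_b\in L^\infty(\partial\Omega)$ put $\Phi=\varphi-S_2(0)\varphi_b$. A pair $(v_\varepsilon,w_\varepsilon)$ with $v_\varepsilon,\partial_\nu v_\varepsilon,w_\varepsilon\in C(\overline\Omega\times(0,T))$, $T\in(0,\infty]$, is called a solution in $\Omega\times(0,T)$ if for $x\in\Omega$, $0<t<T$ $$w_\varepsilon(x,t)=[S_2(t)\varphi_b](x)-\int_0^t[S_2(t-s)\,\partial_\nu v_\varepsilon|_{\partial\Omega}(\cdot,s)](x)\,ds,$$ $$v_\varepsilon(x,t)=[S_1(t/\varepsilon)\Phi](x)-\int_0^t[S_1((t-s)/\varepsilon)\,\partial_tw_\varepsilon(\cdot,s)](x)\,ds,$$ where $\partial_tw_\varepsilon=F_1[\varphi_b]+F_2[v_\varepsilon]$ with $F_1[\varphi_b](x,t)=\partial_t[S_2(t)\varphi_b](x)$ and $$F_2[v](x,t)=-[S_2(0)\,\partial_\nu v|_{\partial\Omega}(\cdot,t)](x)-\int_0^t\partial_t[S_2(t-s)\,\partial_\nu v|_{\partial\Omega}(\cdot,s)](x)\,ds.$$ It is global-in-time if $T=\infty$. Then $u_\varepsilon:=v_\varepsilon+w_\varepsilon$ is called the corresponding solution of the parabolic problem. A classical solution satisfies the differential equation and the dynamical boundary condition pointwise for $t>0$; the initial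 data are encoded through the integral equations above. In part b), $u_\varepsilon$, $v_\varepsilon$, $w_\varepsilon$ are those of the solution from part a). *)

theory Defs
  imports "HOL-Analysis.Analysis" "HOL-Probability.Essential_Supremum"
begin

text \<open>
  A radially symmetric function on \<open>Omega\<close> is given by its profile
  \<open>f :: real \<Rightarrow> real\<close>, a function of \<open>r = norm x\<close>; only the values for
  \<open>r \<ge> 1\<close> matter. Functions of space and time take the radius first.
  A radially symmetric function on the unit sphere is a real number.
\<close>

definition Omega :: "(real^3) set" where
  "Omega = - ball 0 1"

definition rad :: "(real \<Rightarrow> real) \<Rightarrow> real^3 \<Rightarrow> real" where
  "rad f x = f (norm x)"

definition Linf_norm :: "(real \<Rightarrow> real) \<Rightarrow> ereal" where
  "Linf_norm f = esssup (lebesgue_on Omega) (\<lambda>x. ereal \<bar>rad f x\<bar>)"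

definition in_Linf :: "(real \<Rightarrow> real) \<Rightarrow> bool" where
  "in_Linf f \<longleftrightarrow> rad f \<in> borel_measurable (lebesgue_on Omega) \<and> Linf_norm f < \<infinity>"

text \<open>The derivative in direction \<open>\<nu> = - x / norm x\<close>; one-sided at \<open>r = 1\<close>.\<close>

definition dnu :: "(real \<Rightarrow> real) \<Rightarrow> real \<Rightarrow> real" where
  "dnu f r = - vector_derivative f (at r within {1..})"

definition S1_integrand :: "real \<Rightarrow> (real \<Rightarrow> real) \<Rightarrow> real \<Rightarrow> real \<Rightarrow> real" where
  "S1_integrand t f r \<rho> =
     (exp (- ((r - \<rho>)\<^sup>2 / (4 * t))) - exp (- ((r + \<rho> - 2)\<^sup>2 / (4 * t)))) * \<rho> * f \<rho>"

text \<open>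
  The Dirichlet heat semigroup for \<open>t > 0\<close>. At \<open>r = 1\<close> the two exponentials cancel,
  so the formula also gives the boundary value 0.
\<close>

definition S1 :: "real \<Rightarrow> (real \<Rightarrow> real) \<Rightarrow> real \<Rightarrow> real" where
  "S1 t f r = 1 / (r * sqrt (4 * pi * t)) * (LINT \<rho>:{1<..}|lebesgue. S1_integrand t f r \<rho>)"

definition S2 :: "real \<Rightarrow> real \<Rightarrow> real \<Rightarrow> real" where
  "S2 t \<psi> r = \<psi> / (r * exp t)"

definition F1 :: "real \<Rightarrow> real \<Rightarrow> real \<Rightarrow> real" where
  "F1 \<phi>b r t = deriv (\<lambda>\<tau>. S2 \<tau> \<phi>b r) t"

definition F2_integrand :: "(real \<Rightarrow> real \<Rightarrow> real) \<Rightarrow> real \<Rightarrow> real \<Rightarrow> real \<Rightarrow> real" where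
  "F2_integrand v r t s = deriv (\<lambda>\<tau>. S2 (\<tau> - s) (dnu (\<lambda>\<rho>. v \<rho> s) 1) r) t"

definition F2 :: "(real \<Rightarrow> real \<Rightarrow> real) \<Rightarrow> real \<Rightarrow> real \<Rightarrow> real" where
  "F2 v r t = - S2 0 (dnu (\<lambda>\<rho>. v \<rho> t) 1) r - (LINT s:{0<..<t}|lebesgue. F2_integrand v r t s)"

text \<open>The expression that stands for \<open>\<partial>\<^sub>t w\<close> in the integral equation for \<open>v\<close>.\<close>

definition dtw :: "real \<Rightarrow> (real \<Rightarrow> real \<Rightarrow> real) \<Rightarrow> real \<Rightarrow> real \<Rightarrow> real" where
  "dtw \<phi>b v r t = F1 \<phi>b r t + F2 v r t"

definition cont_radial :: "ereal \<Rightarrow> (real \<Rightarrow> real \<Rightarrow> real) \<Rightarrow> bool" where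
  "cont_radial T f \<longleftrightarrow>
     continuous_on (closure Omega \<times> {t. 0 < t \<and> ereal t < T}) (\<lambda>(x, t). f (norm x) t)"

text \<open>
  Solutions on \<open>Omega \<times> (0, T)\<close>. Since a Bochner integral is 0 when the integrand is not
  integrable, the existence of the integrals is required explicitly. The initial data
  \<open>\<phi>\<close>, \<open>\<phi>b\<close> enter through the integral equations, via \<open>\<phi> - S2 0 \<phi>b\<close> and \<open>S2 t \<phi>b\<close>.
\<close>

definition is_solution ::
  "real \<Rightarrow> ereal \<Rightarrow> (real \<Rightarrow> real) \<Rightarrow> real \<Rightarrow>
   (real \<Rightarrow> real \<Rightarrow> real) \<Rightarrow> (real \<Rightarrow> real \<Rightarrow> real) \<Rightarrow> bool" where
  "is_solution \<epsilon> T \<phi> \<phi>b v w \<longleftrightarrow>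
     cont_radial T v \<and>
     (\<forall>r\<ge>1. \<forall>t. 0 < t \<and> ereal t < T \<longrightarrow> (\<lambda>\<rho>. v \<rho> t) differentiable (at r within {1..})) \<and>
     cont_radial T (\<lambda>r t. dnu (\<lambda>\<rho>. v \<rho> t) r) \<and>
     cont_radial T w \<and>
     (\<forall>x\<in>Omega. \<forall>t. 0 < t \<and> ereal t < T \<longrightarrow> (let r = norm x in
        set_integrable lebesgue {0<..<t} (\<lambda>s. S2 (t - s) (dnu (\<lambda>\<rho>. v \<rho> s) 1) r) \<and>
        w r t = S2 t \<phi>b r
                - (LINT s:{0<..<t}|lebesgue. S2 (t - s) (dnu (\<lambda>\<rho>. v \<rho> s) 1) r) \<and>
        set_integrable lebesgue {0<..<t} (F2_integrand v r t) \<and>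
        set_integrable lebesgue {1<..} (S1_integrand (t / \<epsilon>) (\<lambda>\<rho>. \<phi> \<rho> - S2 0 \<phi>b \<rho>) r) \<and>
        (\<forall>s. 0 < s \<and> s < t \<longrightarrow>
           set_integrable lebesgue {1<..} (S1_integrand ((t - s) / \<epsilon>) (\<lambda>\<rho>. dtw \<phi>b v \<rho> s) r)) \<and>
        set_integrable lebesgue {0<..<t} (\<lambda>s. S1 ((t - s) / \<epsilon>) (\<lambda>\<rho>. dtw \<phi>b v \<rho> s) r) \<and>
        v r t = S1 (t / \<epsilon>) (\<lambda>\<rho>. \<phi> \<rho> - S2 0 \<phi>b \<rho>) r
                - (LINT s:{0<..<t}|lebesgue. S1 ((t - s) / \<epsilon>) (\<lambda>\<rho>. dtw \<phi>b v \<rho> s) r)))"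

definition sup_norm ::
  "real \<Rightarrow> real \<Rightarrow> (real \<Rightarrow> real \<Rightarrow> real) \<Rightarrow> (real \<Rightarrow> real \<Rightarrow> real) \<Rightarrow> ereal" where
  "sup_norm \<epsilon> T v w =
     (SUP t\<in>{0<..<T}. Linf_norm (\<lambda>r. v r t)
        + ereal (sqrt (t / \<epsilon>)) * Linf_norm (dnu (\<lambda>\<rho>. v \<rho> t))
        + Linf_norm (\<lambda>r. w r t))"

definition bounded_global_solution ::
  "real \<Rightarrow> (real \<Rightarrow> real) \<Rightarrow> real \<Rightarrow>
   (real \<Rightarrow> real \<Rightarrow> real) \<Rightarrow> (real \<Rightarrow> real \<Rightarrow> real) \<Rightarrow> bool" where
  "bounded_global_solution \<epsilon> \<phi> \<phi>b v w \<longleftrightarrow>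
     is_solution \<epsilon> \<infinity> \<phi> \<phi>b v w \<and> (\<forall>T>0. sup_norm \<epsilon> T v w < \<infinity>)"

definition dir_deriv :: "real^3 \<Rightarrow> (real^3 \<Rightarrow> real) \<Rightarrow> real^3 \<Rightarrow> real" where
  "dir_deriv b U x = deriv (\<lambda>s. U (x + s *\<^sub>R b)) 0"

definition laplacian :: "(real^3 \<Rightarrow> real) \<Rightarrow> real^3 \<Rightarrow> real" where
  "laplacian U x = (\<Sum>b\<in>Basis. dir_deriv b (dir_deriv b U) x)"

text \<open>
  Continuous on the closure of \<open>Omega\<close>, continuously differentiable once in time and twice
  in space in the interior.
\<close>

definition C21 :: "(real^3 \<Rightarrow> real \<Rightarrow> real) \<Rightarrow> bool" where
  "C21 U \<longleftrightarrow>
     continuous_on (closure Omega \<times> {0<..}) (\<lambda>(x, t). U x t) \<and>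
     (\<forall>x\<in>interior Omega. \<forall>t>0.
        U x differentiable (at t) \<and>
        (\<lambda>y. U y t) differentiable (at x) \<and>
        (\<forall>b\<in>Basis. dir_deriv b (\<lambda>y. U y t) differentiable (at x))) \<and>
     continuous_on (interior Omega \<times> {0<..}) (\<lambda>(x, t). deriv (U x) t) \<and>
     (\<forall>b\<in>Basis. continuous_on (interior Omega \<times> {0<..}) (\<lambda>(x, t). dir_deriv b (\<lambda>y. U y t) x) \<and>
        (\<forall>c\<in>Basis. continuous_on (interior Omega \<times> {0<..})
           (\<lambda>(x, t). dir_deriv c (dir_deriv b (\<lambda>y. U y t)) x)))"

definition classical_solution :: "real \<Rightarrow> (real \<Rightarrow> real \<Rightarrow> real) \<Rightarrow> bool" where
  "classical_solution \<epsilon> u \<longleftrightarrow>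
     C21 (\<lambda>x t. rad (\<lambda>r. u r t) x) \<and>
     (\<forall>x\<in>interior Omega. \<forall>t>0.
        \<epsilon> * deriv (\<lambda>s. rad (\<lambda>r. u r s) x) t - laplacian (rad (\<lambda>r. u r t)) x = 0) \<and>
     (\<forall>x\<in>frontier Omega. \<forall>t>0.
        u (norm x) differentiable (at t) \<and>
        (\<lambda>\<rho>. u \<rho> t) differentiable (at (norm x) within {1..}) \<and>
        deriv (u (norm x)) t + dnu (\<lambda>\<rho>. u \<rho> t) (norm x) = 0)"

end

(*
  Multiplication by r turns the radial problem into a half-line problem: w = W(t) / r and
  v = V / r, where V solves the one-dimensional Dirichlet problem driven by a source h(t) that
  depends only on time. Both are determined by the boundary flux g of v, with W' = h = - W - g.
  Taking the normal derivative of the Duhamel formula at r = 1 gives a linear Volterra equation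
  for g with kernel sqrt (eps / pi) / sqrt t. It is a contraction in a norm weighted by
  exp (lam t) / sqrt t, which yields existence, uniqueness and the bound g = O(sqrt eps) for
  decaying data, and hence all estimates. For the classical regularity one rewrites r (v + w)
  with the complementary error function as kernel, which vanishes rapidly at time 0 inside the
  domain, so that one may differentiate under the integral.
*)
theory Submission
  imports Defs "HOL-Probability.Distributions"
begin

section \<open>Integration on intervals\<close>

text \<open>Two features shape the argument. The flux of bounded data blows up like 1 / sqrt t at
  time 0, and the convolution kernel has the same singularity, so a plain sup norm in time is
  unsuitable. With the factor exp (lam t) the convolution has norm at most 1/2 and the source costs
  a factor 3/2, so the Volterra map contracts by 3/4 on all of (0, infinity) at once for every
  coefficient sqrt (eps / pi) <= 1; no gluing of time steps is required. Secondly, r times a bounded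
  function grows linearly, and is carried through with a bound A + B * |rho|. The B part yields a
  flux that does not shrink with eps, since the growth sqrt (t / eps) cancels the decay of the
  kernel. Boundedness of rho * phi permits B = 0, and then the whole flux carries a factor sqrt eps.
  Norms and measurability refer to R^3 while the analysis lives on a half-line; the passage rests on
  the fact that radii filling a null set of R^3 form a null set of reals. Uniqueness starts from the
  norm bound, which puts the flux of an arbitrary solution into the class where the Volterra
  equation has only one solution.\<close>

lemma has_real_derivative_integral_dominated:
  fixes f f' :: "real \<Rightarrow> 'a \<Rightarrow> real"
  assumes x0: "x0 \<in> {a<..<b}"
    and int: "\<And>x. x \<in> {a<..<b} \<Longrightarrow> integrable M (f x)"
    and der: "\<And>x y. x \<in> {a<..<b} \<Longrightarrow> y \<in> space M \<Longrightarrow> ((\<lambda>x. f x y) has_real_derivative f' x y) (at x)"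
    and bnd: "\<And>x y. x \<in> {a<..<b} \<Longrightarrow> y \<in> space M \<Longrightarrow> \<bar>f' x y\<bar> \<le> D y"
    and D: "integrable M D"
    and meas: "f' x0 \<in> borel_measurable M"
  shows "((\<lambda>x. integral\<^sup>L M (f x)) has_real_derivative integral\<^sup>L M (f' x0)) (at x0)"
proof -
  let ?I = "{a<..<b}"
  have "((\<lambda>x. (integral\<^sup>L M (f x) - integral\<^sup>L M (f x0)) / (x - x0)) \<longlongrightarrow> integral\<^sup>L M (f' x0)) (at x0 within ?I)"
    unfolding tendsto_at_iff_sequentially
  proof (intro allI impI)
    fix X assume X: "\<forall>i::nat. X i \<in> ?I - {x0}" and lim: "X \<longlonglongrightarrow> x0"
    have eq: "(integral\<^sup>L M (f (X i)) - integral\<^sup>L M (f x0)) / (X i - x0)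
        = (\<integral>y. (f (X i) y - f x0 y) / (X i - x0) \<partial>M)" for i
      using X x0 int by (subst Bochner_Integration.integral_diff[symmetric]) auto
    have "(\<lambda>i. \<integral>y. (f (X i) y - f x0 y) / (X i - x0) \<partial>M) \<longlonglongrightarrow> integral\<^sup>L M (f' x0)"
    proof (rule integral_dominated_convergence[where w=D])
      show "f' x0 \<in> borel_measurable M" by fact
      show "(\<lambda>y. (f (X i) y - f x0 y) / (X i - x0)) \<in> borel_measurable M" for i
        using int[of "X i"] int[OF x0] X by (auto intro!: borel_measurable_divide borel_measurable_diff)
      show "integrable M D" by fact
      show "AE y in M. (\<lambda>i. (f (X i) y - f x0 y) / (X i - x0)) \<longlonglongrightarrow> f' x0 y"
      proof (intro AE_I2)
        fix y assume y: "y \<in> space M"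
        from der[OF x0 y] have "((\<lambda>x. (f x y - f x0 y) / (x - x0)) \<longlongrightarrow> f' x0 y) (at x0)"
          by (simp add: has_field_derivative_iff)
        then have "((\<lambda>x. (f x y - f x0 y) / (x - x0)) \<longlongrightarrow> f' x0 y) (at x0 within ?I)"
          by (rule tendsto_within_subset) simp
        then show "(\<lambda>i. (f (X i) y - f x0 y) / (X i - x0)) \<longlonglongrightarrow> f' x0 y"
          using X lim unfolding tendsto_at_iff_sequentially comp_def by blast
      qed
      show "AE y in M. norm ((f (X i) y - f x0 y) / (X i - x0)) \<le> D y" for i
      proof (intro AE_I2)
        fix y assume y: "y \<in> space M"
        \<comment> \<open>The mean value inequality turns the bound on the derivative into a
          majorant of all difference quotients.\<close>
        have "norm (f (X i) y - f x0 y) \<le> D y * norm (X i - x0)"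
        proof (rule field_differentiable_bound[where S="?I" and f'="\<lambda>x. f' x y"])
          show "\<And>z. z \<in> ?I \<Longrightarrow> ((\<lambda>x. f x y) has_field_derivative f' z y) (at z within ?I)"
            using der y has_field_derivative_at_within by blast
        qed (use X x0 bnd y in auto)
        then show "norm ((f (X i) y - f x0 y) / (X i - x0)) \<le> D y"
          using X[rule_format, of i] by (simp add: norm_divide divide_le_eq)
      qed
    qed
    then show "((\<lambda>x. (integral\<^sup>L M (f x) - integral\<^sup>L M (f x0)) / (x - x0)) \<circ> X) \<longlonglongrightarrow> integral\<^sup>L M (f' x0)"
      by (simp add: comp_def eq)
  qed
  then show ?thesis
    using x0 at_within_open[of x0 ?I] by (simp add: has_field_derivative_iff)
qed

text \<open>Dominated convergence along sequences. The majorant may depend on the point: a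
  convergent sequence is eventually inside \<open>U\<close>, and its first \<open>N\<close> terms
  are dropped.\<close>

lemma continuous_on_integral_dominated:
  fixes f :: "'b::{first_countable_topology,t2_space} \<Rightarrow> 'a \<Rightarrow> real"
  assumes meas: "\<And>p. p \<in> S \<Longrightarrow> f p \<in> borel_measurable M"
    and cont: "\<And>y. y \<in> space M \<Longrightarrow> continuous_on S (\<lambda>p. f p y)"
    and dom: "\<And>p. p \<in> S \<Longrightarrow> \<exists>U D. open U \<and> p \<in> U \<and> integrable M D \<and> (\<forall>q\<in>S \<inter> U. \<forall>y\<in>space M. \<bar>f q y\<bar> \<le> D y)"
  shows "continuous_on S (\<lambda>p. integral\<^sup>L M (f p))"
proof (rule continuous_on_sequentiallyI)
  fix u p assume u: "\<forall>n::nat. u n \<in> S" and p: "p \<in> S" and lim: "u \<longlonglongrightarrow> p"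
  obtain U D where U: "open U" "p \<in> U" "integrable M D" "\<forall>q\<in>S \<inter> U. \<forall>y\<in>space M. \<bar>f q y\<bar> \<le> D y"
    using dom[OF p] by blast
  obtain N where N: "\<And>n. n \<ge> N \<Longrightarrow> u n \<in> U"
    using lim U(1,2) unfolding tendsto_def eventually_sequentially by meson
  have "(\<lambda>n. integral\<^sup>L M (f (u (n + N)))) \<longlonglongrightarrow> integral\<^sup>L M (f p)"
  proof (rule integral_dominated_convergence[where w=D])
    show "AE y in M. (\<lambda>n. f (u (n + N)) y) \<longlonglongrightarrow> f p y"
    proof (intro AE_I2)
      fix y assume "y \<in> space M"
      then have "(\<lambda>n. f (u n) y) \<longlonglongrightarrow> f p y"
        using cont u p lim unfolding continuous_on_sequentially comp_def by blast
      then show "(\<lambda>n. f (u (n + N)) y) \<longlonglongrightarrow> f p y" by (rule LIMSEQ_ignore_initial_segment)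
    qed
  qed (use meas u p U N in auto)
  then show "(\<lambda>n. integral\<^sup>L M (f (u n))) \<longlonglongrightarrow> integral\<^sup>L M (f p)" by (rule LIMSEQ_offset)
qed

text \<open>The derivative may be singular at the end points, as 1 / sqrt s is; only the primitive
  is continuous there. The fundamental theorem gives a gauge integral, and nonnegativity makes it
  absolutely convergent, hence a Lebesgue integral.\<close>

lemma set_integral_FTC_nonneg:
  fixes F f :: "real \<Rightarrow> real"
  assumes "a \<le> b" and "continuous_on {a..b} F"
    and der: "\<And>x. a < x \<Longrightarrow> x < b \<Longrightarrow> (F has_real_derivative f x) (at x)"
    and nn: "\<And>x. a < x \<Longrightarrow> x < b \<Longrightarrow> 0 \<le> f x"
  shows "set_integrable lebesgue {a<..<b} f" "(LINT x:{a<..<b}|lebesgue. f x) = F b - F a"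
proof -
  have "(f has_integral (F b - F a)) {a..b}"
    using assms(1,2) der
    by (intro fundamental_theorem_of_calculus_interior) (auto simp: has_real_derivative_iff_has_vector_derivative)
  then have *: "(f has_integral (F b - F a)) {a<..<b}"
    by (simp add: has_integral_Icc_iff_Ioo)
  show i: "set_integrable lebesgue {a<..<b} f"
    by (rule nonnegative_absolutely_integrable_1) (use * nn in \<open>auto simp: has_integral_iff\<close>)
  show "(LINT x:{a<..<b}|lebesgue. f x) = F b - F a"
    using set_lebesgue_integral_eq_integral(2)[OF i] * by (simp add: has_integral_iff)
qed

lemma set_integrable_lebesgue_bound:
  fixes f g :: "real \<Rightarrow> real"
  assumes g: "set_integrable lebesgue {a<..<b} g" and f: "continuous_on {a<..<b} f"
    and le: "\<And>x. a < x \<Longrightarrow> x < b \<Longrightarrow> \<bar>f x\<bar> \<le> g x"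
  shows "set_integrable lebesgue {a<..<b} f" "\<bar>LINT x:{a<..<b}|lebesgue. f x\<bar> \<le> (LINT x:{a<..<b}|lebesgue. g x)"
proof -
  have m: "set_borel_measurable lebesgue {a<..<b} f"
    unfolding set_borel_measurable_def
    by (rule measurable_completion) (use borel_measurable_continuous_on_indicator[OF _ f] in simp)
  show i: "set_integrable lebesgue {a<..<b} f"
    by (rule set_integrable_bound[OF g m]) (use le in \<open>auto intro!: AE_I2 order_trans[OF le]\<close>)
  have "\<bar>LINT x:{a<..<b}|lebesgue. f x\<bar> \<le> (LINT x:{a<..<b}|lebesgue. \<bar>f x\<bar>)"
    using set_integral_norm_bound[OF i] by simp
  also have "\<dots> \<le> (LINT x:{a<..<b}|lebesgue. g x)"
    by (rule set_integral_mono) (use i g le in \<open>auto intro: set_integrable_abs\<close>)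
  finally show "\<bar>LINT x:{a<..<b}|lebesgue. f x\<bar> \<le> (LINT x:{a<..<b}|lebesgue. g x)" .
qed

section \<open>Explicit integrals with an inverse square root singularity\<close>

lemma set_integral_inverse_sqrt:
  assumes "0 \<le> t"
  shows "set_integrable lebesgue {0<..<t} (\<lambda>s. 1 / sqrt s)" "(LINT s:{0<..<t}|lebesgue. 1 / sqrt s) = 2 * sqrt t"
    "set_integrable lebesgue {0<..<t} (\<lambda>s. 1 / sqrt (t - s))" "(LINT s:{0<..<t}|lebesgue. 1 / sqrt (t - s)) = 2 * sqrt t"
proof -
  have 1: "((\<lambda>x. 2 * sqrt x) has_real_derivative 1 / sqrt x) (at x)" if "0 < x" for x
    using that by (auto intro!: derivative_eq_intros simp: divide_simps)
  have 2: "((\<lambda>x. - (2 * sqrt (t - x))) has_real_derivative 1 / sqrt (t - x)) (at x)" if "x < t" for x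
    using that by (auto intro!: derivative_eq_intros simp: divide_simps)
  have c: "continuous_on {0..t} (\<lambda>x. 2 * sqrt x)" "continuous_on {0..t} (\<lambda>x. - (2 * sqrt (t - x)))"
    by (auto intro!: continuous_intros)
  note a = set_integral_FTC_nonneg[OF assms c(1), of "\<lambda>s. 1 / sqrt s"] set_integral_FTC_nonneg[OF assms c(2), of "\<lambda>s. 1 / sqrt (t - s)"]
  show "set_integrable lebesgue {0<..<t} (\<lambda>s. 1 / sqrt s)" "(LINT s:{0<..<t}|lebesgue. 1 / sqrt s) = 2 * sqrt t"
    "set_integrable lebesgue {0<..<t} (\<lambda>s. 1 / sqrt (t - s))" "(LINT s:{0<..<t}|lebesgue. 1 / sqrt (t - s)) = 2 * sqrt t"
    using a 1 2 by auto
qed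

lemma exp_minus_le_inverse: "exp (- x) \<le> 1 / (1 + x)" if "0 \<le> x" for x :: real
proof -
  have "1 + x \<le> exp x" by (rule exp_ge_add_one_self)
  then show ?thesis using that by (simp add: exp_minus field_simps)
qed

text \<open>The majorant 1 / (sqrt s * (1 + l * s)) has the elementary primitive 2 / sqrt l * arctan
  (sqrt (l * s)). Since arctan stays below pi / 2, the bound is independent of t and tends to 0 as l
  grows, which makes the exponential weight effective.\<close>

lemma exp_div_sqrt_integral:
  assumes "0 \<le> t" "0 < l"
  shows "set_integrable lebesgue {0<..<t} (\<lambda>s. exp (- (l * s)) / sqrt s)"
    "(LINT s:{0<..<t}|lebesgue. exp (- (l * s)) / sqrt s) \<le> pi / sqrt l"
    "set_integrable lebesgue {0<..<t} (\<lambda>s. exp (- (l * (t - s))) / sqrt (t - s))"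
    "(LINT s:{0<..<t}|lebesgue. exp (- (l * (t - s))) / sqrt (t - s)) \<le> pi / sqrt l"
proof -
  let ?F = "\<lambda>s. 2 / sqrt l * arctan (sqrt (l * s))" and ?f = "\<lambda>s. 1 / (sqrt s * (1 + l * s))"
  have d: "(?F has_real_derivative ?f x) (at x)" if "0 < x" for x
  proof -
    have "sqrt (l * x) = sqrt l * sqrt x" "sqrt l * sqrt l = l" "sqrt x * sqrt x = x" "1 + l * x > 0"
      using that assms by (auto simp: real_sqrt_mult intro: add_pos_pos)
    then show ?thesis using that assms
      by (auto intro!: derivative_eq_intros simp: divide_simps real_sqrt_mult power2_eq_square) (auto simp: algebra_simps)
  qed
  have d2: "((\<lambda>s. - ?F (t - s)) has_real_derivative ?f (t - x)) (at x)" if "x < t" for x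
  proof -
    have "(?F has_real_derivative ?f (t - x)) (at (t - x))" by (rule d) (use that in auto)
    then have "((\<lambda>s. ?F (t - s)) has_real_derivative ?f (t - x) * (- 1)) (at x)"
      by (rule DERIV_chain2) (auto intro!: derivative_eq_intros)
    then show ?thesis using DERIV_minus by fastforce
  qed
  have c: "continuous_on {0..t} ?F" "continuous_on {0..t} (\<lambda>s. - ?F (t - s))"
    using assms by (auto intro!: continuous_intros)
  have nn: "0 \<le> ?f x" if "0 < x" for x using that assms by auto
  note a = set_integral_FTC_nonneg[OF assms(1) c(1), of ?f] set_integral_FTC_nonneg[OF assms(1) c(2), of "\<lambda>s. ?f (t - s)"]
  have le: "\<bar>exp (- (l * s)) / sqrt s\<bar> \<le> ?f s" if "0 < s" for s
    using divide_right_mono[OF exp_minus_le_inverse[of "l * s"], of "sqrt s"] that assms by (simp add: mult.commute)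
  have b: "?F t - ?F 0 \<le> pi / sqrt l"
    using arctan_ubound[of "sqrt (l * t)"] assms by (simp add: divide_simps)
  have b2: "- ?F (t - t) - - ?F (t - 0) \<le> pi / sqrt l" using b by simp
  have c1: "continuous_on {0<..<t} (\<lambda>s. exp (- (l * s)) / sqrt s)"
    "continuous_on {0<..<t} (\<lambda>s. exp (- (l * (t - s))) / sqrt (t - s))"
    by (auto intro!: continuous_intros)
  have A: "set_integrable lebesgue {0<..<t} ?f" "(LINT x:{0<..<t}|lebesgue. ?f x) = ?F t - ?F 0"
    "set_integrable lebesgue {0<..<t} (\<lambda>s. ?f (t - s))" "(LINT x:{0<..<t}|lebesgue. ?f (t - x)) = - ?F (t - t) - - ?F (t - 0)"
    using a d d2 nn by auto
  note B = set_integrable_lebesgue_bound[OF A(1) c1(1)] set_integrable_lebesgue_bound[OF A(3) c1(2)]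
  have le2: "\<bar>exp (- (l * (t - s))) / sqrt (t - s)\<bar> \<le> ?f (t - s)" if "s < t" for s
    using le[of "t - s"] that by simp
  show "set_integrable lebesgue {0<..<t} (\<lambda>s. exp (- (l * s)) / sqrt s)"
    "set_integrable lebesgue {0<..<t} (\<lambda>s. exp (- (l * (t - s))) / sqrt (t - s))"
    using B le le2 by auto
  show "(LINT s:{0<..<t}|lebesgue. exp (- (l * s)) / sqrt s) \<le> pi / sqrt l"
    "(LINT s:{0<..<t}|lebesgue. exp (- (l * (t - s))) / sqrt (t - s)) \<le> pi / sqrt l"
    using B(2) B(4) le le2 b b2 A by auto
qed

section \<open>Weakly singular convolutions\<close>

text \<open>
  The rate for which convolution with \<open>1 / sqrt t\<close> has norm at most 1/2
  in the norm weighted by \<open>exp (lam * t) / sqrt t\<close>.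
\<close>

definition lam :: real where "lam = 36 * pi\<^sup>2"

definition weight :: "real \<Rightarrow> real" where "weight t = exp (lam * t) / sqrt t"

lemma sqrt_le_one_plus: "0 \<le> x \<Longrightarrow> sqrt x \<le> 1 + x"
  by (intro real_le_lsqrt) (auto simp: power2_eq_square algebra_simps)

lemma lam_pos: "0 < lam" and sqrt_lam: "sqrt lam = 6 * pi" and lam_ge_1: "1 \<le> lam"
proof -
  show "0 < lam" by (simp add: lam_def)
  show "sqrt lam = 6 * pi" by (simp add: lam_def real_sqrt_mult)
  have "1 \<le> pi" using pi_gt3 by simp
  then have "1 \<le> pi\<^sup>2" by (simp add: one_le_power)
  then show "1 \<le> lam" by (simp add: lam_def)
qed

lemma weight_pos: "0 < t \<Longrightarrow> 0 < weight t"
  by (simp add: weight_def)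

lemma inverse_sqrt_le_weight: "0 < t \<Longrightarrow> 1 / sqrt t \<le> weight t"
  using lam_pos by (simp add: weight_def divide_right_mono)

lemma one_le_weight: assumes "0 < t" shows "1 \<le> weight t"
proof -
  have "sqrt t \<le> 1 + t" using assms by (intro sqrt_le_one_plus) simp
  also have "\<dots> \<le> exp t" by (rule exp_ge_add_one_self)
  also have "\<dots> \<le> exp (lam * t)" using lam_ge_1 assms by simp
  finally show ?thesis using assms by (simp add: weight_def)
qed

lemma weight_le: "0 < t \<Longrightarrow> t \<le> T \<Longrightarrow> weight t \<le> exp (lam * T) * (1 / sqrt t)"
  using lam_pos by (simp add: weight_def divide_right_mono)

lemma continuous_on_weight: "continuous_on {0<..} weight"
  unfolding weight_def by (auto intro!: continuous_intros)

text \<open>The integrand is singular at both ends. The two singularities are separated, so that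
  each resulting term is one of the integrals of \<open>exp_div_sqrt_integral\<close>.\<close>

lemma weight_convolution:
  assumes t: "0 < t"
  shows "set_integrable lebesgue {0<..<t} (\<lambda>s. weight s / sqrt (t - s))"
    "(LINT s:{0<..<t}|lebesgue. weight s / sqrt (t - s)) \<le> weight t / 2"
proof -
  let ?a = "\<lambda>s. exp (- (lam * (t - s))) / sqrt (t - s)" and ?b = "\<lambda>s. exp (- (lam * s)) / sqrt s"
  let ?g = "\<lambda>s. weight t * (2 * ?a s + ?b s)"
  note e = exp_div_sqrt_integral[OF less_imp_le[OF t] lam_pos]
  have i: "set_integrable lebesgue {0<..<t} ?g"
    using e by (intro set_integrable_mult_right set_integral_add(1)) auto
  have c: "continuous_on {0<..<t} (\<lambda>s. weight s / sqrt (t - s))"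
    by (intro continuous_intros continuous_on_subset[OF continuous_on_weight]) auto
  have le: "\<bar>weight s / sqrt (t - s)\<bar> \<le> ?g s" if s: "0 < s" "s < t" for s
  proof -
    let ?x = "sqrt s" and ?y = "sqrt (t - s)" and ?e = "exp (- (lam * (t - s)))"
    have p: "0 < ?x" "0 < ?y" "0 < sqrt t" using s t by auto
    have xy: "sqrt t \<le> ?x + ?y" using sqrt_add_le_add_sqrt[of s "t - s"] s by simp
    have ex: "exp (lam * s) = exp (lam * t) * ?e"
      by (simp add: exp_add[symmetric] algebra_simps)
    \<comment> \<open>Partial fractions: the inequality \<open>sqrt t \<le> ?x + ?y\<close> extracts
      the factor 1 / sqrt t belonging to \<open>weight t\<close>.\<close>
    have "1 / (?x * ?y) \<le> (1 / sqrt t) * (1 / ?y + 1 / ?x)"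
    proof -
      have "1 / (?x * ?y) = sqrt t / (sqrt t * (?x * ?y))" using p by simp
      also have "\<dots> \<le> (?x + ?y) / (sqrt t * (?x * ?y))" using xy p by (intro divide_right_mono) auto
      also have "\<dots> = (1 / sqrt t) * (1 / ?y + 1 / ?x)" using p by (simp add: field_simps)
      finally show ?thesis .
    qed
    then have "exp (lam * s) * (1 / (?x * ?y)) \<le> exp (lam * s) * ((1 / sqrt t) * (1 / ?y + 1 / ?x))"
      by (intro mult_left_mono) auto
    then have 1: "weight s / ?y \<le> weight t * (?a s + ?e / ?x)"
      by (simp add: weight_def ex algebra_simps add_divide_distrib)
    \<comment> \<open>In this mixed term the exponential decays from the wrong end. On the first
      half of the interval it is below exp (- lam s); on the second half 1 / sqrt s is below 1 /
      sqrt (t - s).\<close>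
    have 2: "?e / ?x \<le> ?a s + ?b s"
    proof (cases "s \<le> t - s")
      case True
      then have "?e \<le> exp (- (lam * s))" using lam_pos by simp
      then have "?e / ?x \<le> ?b s" using p by (simp add: divide_right_mono)
      moreover have "0 \<le> ?a s" using p by simp
      ultimately show ?thesis by linarith
    next
      case False
      then have "?y \<le> ?x" by simp
      then have "?e / ?x \<le> ?a s" using p by (intro divide_left_mono) auto
      moreover have "0 \<le> ?b s" using p by simp
      ultimately show ?thesis by linarith
    qed
    have "weight s / ?y \<le> ?g s"
      by (rule order_trans[OF 1]) (use 2 weight_pos[OF t] in \<open>intro mult_left_mono, auto\<close>)
    moreover have "0 \<le> weight s / ?y" using p weight_pos[of s] s by simp
    ultimately show ?thesis by simp
  qed
  note B = set_integrable_lebesgue_bound[OF i c le]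
  show "set_integrable lebesgue {0<..<t} (\<lambda>s. weight s / sqrt (t - s))" using B(1) by simp
  have "(LINT s:{0<..<t}|lebesgue. ?g s) = weight t * (2 * (LINT s:{0<..<t}|lebesgue. ?a s) + (LINT s:{0<..<t}|lebesgue. ?b s))"
    using e by (simp only: set_integral_mult_right set_integral_add(2)[OF set_integrable_mult_right] set_integrable_mult_right)
  \<comment> \<open>Three integrals of size at most pi / sqrt lam; with sqrt lam = 6 * pi they add
    up to 1/2, which explains the choice of \<open>lam\<close>.\<close>
  also have "\<dots> \<le> weight t * (2 * (pi / sqrt lam) + pi / sqrt lam)"
    using e weight_pos[OF t] by (intro mult_left_mono add_mono) auto
  also have "\<dots> = weight t / 2" by (simp add: sqrt_lam field_simps)
  finally show "(LINT s:{0<..<t}|lebesgue. weight s / sqrt (t - s)) \<le> weight t / 2"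
    using B(2) by simp
qed

text \<open>The integrand of the Beta function at (1/2, 1/2). It is the majorant for a convolution
  of two inverse square root singularities.\<close>

lemma set_integrable_beta_half:
  assumes t: "0 < t"
  shows "set_integrable lebesgue {0<..<t} (\<lambda>s. 1 / (sqrt s * sqrt (t - s)))"
proof (rule set_integrable_lebesgue_bound(1)[OF weight_convolution(1)[OF t]])
  show "continuous_on {0<..<t} (\<lambda>s. 1 / (sqrt s * sqrt (t - s)))"
    by (auto intro!: continuous_intros)
  fix s assume s: "0 < s" "s < t"
  then have "1 / sqrt s / sqrt (t - s) \<le> weight s / sqrt (t - s)"
    by (intro divide_right_mono inverse_sqrt_le_weight) auto
  then show "\<bar>1 / (sqrt s * sqrt (t - s))\<bar> \<le> weight s / sqrt (t - s)" using s by simp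
qed

text \<open>
  The class in which all boundary fluxes live: continuous for positive times, with at most
  the singularity of the heat flux at \<open>t = 0\<close>.
\<close>

definition sqrt_sing :: "(real \<Rightarrow> real) \<Rightarrow> bool" where
  "sqrt_sing h \<longleftrightarrow> continuous_on {0<..} h \<and> (\<forall>T>0. \<exists>H. \<forall>s\<in>{0<..<T}. \<bar>h s\<bar> \<le> H / sqrt s)"

definition conv :: "(real \<Rightarrow> real) \<Rightarrow> (real \<Rightarrow> real) \<Rightarrow> real \<Rightarrow> real" where
  "conv k h t = (LINT s:{0<..<t}|lebesgue. h s * k (t - s))"

lemma sqrt_singD: 
  assumes "sqrt_sing h" "0 < T"
  obtains H where "0 \<le> H" "\<And>s. 0 < s \<Longrightarrow> s < T \<Longrightarrow> \<bar>h s\<bar> \<le> H / sqrt s"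
proof -
  from assms obtain H where H: "\<forall>s\<in>{0<..<T}. \<bar>h s\<bar> \<le> H / sqrt s"
    unfolding sqrt_sing_def by auto
  have "\<bar>h s\<bar> \<le> max H 0 / sqrt s" if "0 < s" "s < T" for s
  proof -
    have "\<bar>h s\<bar> \<le> H / sqrt s" using H that by auto
    also have "\<dots> \<le> max H 0 / sqrt s" using that by (intro divide_right_mono) auto
    finally show ?thesis .
  qed
  then show ?thesis using that[of "max H 0"] by auto
qed

lemma sqrt_sing_cont: "sqrt_sing h \<Longrightarrow> A \<subseteq> {0<..} \<Longrightarrow> continuous_on A h"
  unfolding sqrt_sing_def by (blast intro: continuous_on_subset)

lemma sqrt_singI_weight:
  assumes "continuous_on {0<..} h" and "\<And>s. 0 < s \<Longrightarrow> \<bar>h s\<bar> \<le> H * weight s"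
  shows "sqrt_sing h"
  unfolding sqrt_sing_def
proof (intro conjI allI impI assms(1))
  fix T :: real assume "0 < T"
  have "\<bar>h s\<bar> \<le> (\<bar>H\<bar> * exp (lam * T)) / sqrt s" if "0 < s" "s < T" for s
  proof -
    have "\<bar>h s\<bar> \<le> H * weight s" by (rule assms(2)) fact
    also have "\<dots> \<le> \<bar>H\<bar> * weight s" using weight_pos[OF \<open>0 < s\<close>] by (intro mult_right_mono) auto
    also have "\<dots> \<le> \<bar>H\<bar> * (exp (lam * T) * (1 / sqrt s))"
      using that by (intro mult_left_mono weight_le) auto
    finally show ?thesis by simp
  qed
  then show "\<exists>H. \<forall>s\<in>{0<..<T}. \<bar>h s\<bar> \<le> H / sqrt s"
    by (intro exI[of _ "\<bar>H\<bar> * exp (lam * T)"]) auto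
qed

lemma sqrt_sing_scale: assumes "sqrt_sing f" shows "sqrt_sing (\<lambda>s. c * f s)"
  unfolding sqrt_sing_def
proof (intro conjI allI impI)
  show "continuous_on {0<..} (\<lambda>s. c * f s)"
    using assms by (auto intro!: continuous_intros simp: sqrt_sing_def)
  fix T :: real assume "0 < T"
  then obtain H where "\<And>s. 0 < s \<Longrightarrow> s < T \<Longrightarrow> \<bar>f s\<bar> \<le> H / sqrt s" using sqrt_singD[OF assms] by metis
  then have "\<forall>s\<in>{0<..<T}. \<bar>c * f s\<bar> \<le> (\<bar>c\<bar> * H) / sqrt s"
    by (auto simp: abs_mult mult_left_mono simp flip: times_divide_eq_right)
  then show "\<exists>H. \<forall>s\<in>{0<..<T}. \<bar>c * f s\<bar> \<le> H / sqrt s" by blast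
qed

lemma sqrt_sing_add: assumes "sqrt_sing f" "sqrt_sing g" shows "sqrt_sing (\<lambda>s. f s + g s)"
  unfolding sqrt_sing_def
proof (intro conjI allI impI)
  show "continuous_on {0<..} (\<lambda>s. f s + g s)"
    using assms by (auto intro!: continuous_intros simp: sqrt_sing_def)
  fix T :: real assume "0 < T"
  then obtain H H' where "\<And>s. 0 < s \<Longrightarrow> s < T \<Longrightarrow> \<bar>f s\<bar> \<le> H / sqrt s"  "\<And>s. 0 < s \<Longrightarrow> s < T \<Longrightarrow> \<bar>g s\<bar> \<le> H' / sqrt s"
    using sqrt_singD[OF assms(1)] sqrt_singD[OF assms(2)] by metis
  then have "\<forall>s\<in>{0<..<T}. \<bar>f s + g s\<bar> \<le> (H + H') / sqrt s"
    by (auto simp: add_divide_distrib intro!: order_trans[OF abs_triangle_ineq] add_mono)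
  then show "\<exists>H. \<forall>s\<in>{0<..<T}. \<bar>f s + g s\<bar> \<le> H / sqrt s" by blast
qed

lemma sqrt_sing_diff: assumes "sqrt_sing f" "sqrt_sing g" shows "sqrt_sing (\<lambda>s. f s - g s)"
  using sqrt_sing_add[OF assms(1) sqrt_sing_scale[OF assms(2), of "-1"]] by simp

lemma sqrt_sing_exp: "sqrt_sing (\<lambda>s. exp (- s))"
proof (rule sqrt_singI_weight[of _ 1])
  fix s :: real assume "0 < s"
  then show "\<bar>exp (- s)\<bar> \<le> 1 * weight s" using one_le_weight[of s] by (simp, meson exp_le_one_iff le_minus_iff neg_le_0_iff_le less_imp_le order_trans)
qed (auto intro!: continuous_intros)

lemma conv_integrable:
  assumes h: "sqrt_sing h" and k: "continuous_on {0<..} k"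
    and kb: "\<And>u. 0 < u \<Longrightarrow> u < t \<Longrightarrow> \<bar>k u\<bar> \<le> C / sqrt u"
  shows "set_integrable lebesgue {0<..<t} (\<lambda>s. h s * k (t - s))"
proof (cases "0 < t")
  case True
  obtain H where H: "0 \<le> H" "\<And>s. 0 < s \<Longrightarrow> s < t \<Longrightarrow> \<bar>h s\<bar> \<le> H / sqrt s" using sqrt_singD[OF h True] by metis
  show ?thesis
  proof (rule set_integrable_lebesgue_bound(1)[OF set_integrable_mult_right[where a="H * C", OF set_integrable_beta_half[OF True]]])
    show "continuous_on {0<..<t} (\<lambda>s. h s * k (t - s))"
      by (intro continuous_intros sqrt_sing_cont[OF h] continuous_on_compose2[OF k]) auto
    fix s assume s: "0 < s" "s < t"
    have "\<bar>h s * k (t - s)\<bar> \<le> (H / sqrt s) * (C / sqrt (t - s))"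
      unfolding abs_mult using H(2)[OF s] kb[of "t - s"] s by (intro mult_mono) (auto intro: divide_nonneg_nonneg H(1))
    then show "\<bar>h s * k (t - s)\<bar> \<le> H * C * (1 / (sqrt s * sqrt (t - s)))" by simp
  qed
qed (simp add: set_integrable_def)

text \<open>The basic weighted estimate; the factor 1/2 is that of
  \<open>weight_convolution\<close>.\<close>

lemma conv_bound:
  assumes h: "continuous_on {0<..<t} h" and hb: "\<And>s. 0 < s \<Longrightarrow> s < t \<Longrightarrow> \<bar>h s\<bar> \<le> H * weight s"
    and k: "continuous_on {0<..} k" and kb: "\<And>u. 0 < u \<Longrightarrow> u < t \<Longrightarrow> \<bar>k u\<bar> \<le> C / sqrt u"
    and nn: "0 \<le> H" "0 \<le> C" "0 < t"
  shows "\<bar>conv k h t\<bar> \<le> H * C * (weight t / 2)"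
proof -
  note i = set_integrable_mult_right[where a="H * C", OF weight_convolution(1)[OF nn(3)]]
  have "\<bar>conv k h t\<bar> \<le> (LINT s:{0<..<t}|lebesgue. H * C * (weight s / sqrt (t - s)))"
    unfolding conv_def
  proof (rule set_integrable_lebesgue_bound(2)[OF i])
    show "continuous_on {0<..<t} (\<lambda>s. h s * k (t - s))"
      by (intro continuous_intros h continuous_on_compose2[OF k]) auto
    fix s assume s: "0 < s" "s < t"
    have "\<bar>h s * k (t - s)\<bar> \<le> (H * weight s) * (C / sqrt (t - s))"
      unfolding abs_mult using hb[OF s] kb[of "t - s"] s weight_pos[of s] nn by (intro mult_mono) auto
    then show "\<bar>h s * k (t - s)\<bar> \<le> H * C * (weight s / sqrt (t - s))" by (simp add: algebra_simps)
  qed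
  also have "\<dots> = H * C * (LINT s:{0<..<t}|lebesgue. weight s / sqrt (t - s))"
    by (rule set_integral_mult_right)
  also have "\<dots> \<le> H * C * (weight t / 2)"
    using nn by (intro mult_left_mono weight_convolution) auto
  finally show ?thesis .
qed

text \<open>On the fixed interval \<open>(0, 1)\<close> the singularities no longer move with \<open>t\<close>.\<close>

lemma conv_rescale:
  assumes "0 < t"
  shows "conv k h t = (LINT \<sigma>|lebesgue. indicator {0<..<1} \<sigma> * (t * h (t * \<sigma>) * k (t * (1 - \<sigma>))))"
proof -
  have "conv k h t = \<bar>t\<bar> * (LINT \<sigma>|lebesgue. indicator {0<..<t} (0 + t * \<sigma>) *\<^sub>R (h (0 + t * \<sigma>) * k (t - (0 + t * \<sigma>))))"
    unfolding conv_def set_lebesgue_integral_def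
    using assms by (subst lebesgue_integral_real_affine[where c=t and t=0]) (auto simp only: real_scaleR_def)
  also have "\<dots> = (LINT \<sigma>|lebesgue. \<bar>t\<bar> * (indicator {0<..<t} (0 + t * \<sigma>) *\<^sub>R (h (0 + t * \<sigma>) * k (t - (0 + t * \<sigma>)))))"
    by simp
  also have "\<dots> = (LINT \<sigma>|lebesgue. indicator {0<..<1} \<sigma> * (t * h (t * \<sigma>) * k (t * (1 - \<sigma>))))"
    using assms by (intro Bochner_Integration.integral_cong) (auto simp: indicator_def zero_less_mult_iff algebra_simps)
  finally show ?thesis .
qed

text \<open>On (0, 1) the factor t cancels the two factors sqrt t from the bounds of
  \<open>h\<close> and \<open>k\<close>, leaving a majorant of Beta type that is independent of t.
  The parameter \<open>x\<close> will be the radius, so that joint continuity in radius and time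
  results.\<close>

lemma conv_continuous:
  fixes k :: "'b::{first_countable_topology,t2_space} \<Rightarrow> real \<Rightarrow> real"
  assumes h: "sqrt_sing h"
    and k: "continuous_on (X \<times> {0<..}) (\<lambda>(x, u). k x u)"
    and C: "continuous_on X C" and kb: "\<And>x u. x \<in> X \<Longrightarrow> 0 < u \<Longrightarrow> \<bar>k x u\<bar> \<le> C x / sqrt u"
  shows "continuous_on (X \<times> {0<..}) (\<lambda>(x, t). conv (k x) h t)"
proof -
  let ?f = "\<lambda>(x, t::real) \<sigma>. indicator {0<..<1::real} \<sigma> * (t * h (t * \<sigma>) * k x (t * (1 - \<sigma>)))"
  have "continuous_on (X \<times> {0::real<..}) (\<lambda>p. LINT \<sigma>|lebesgue. ?f p \<sigma>)"
  proof (rule continuous_on_integral_dominated)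
    fix p assume "p \<in> X \<times> {0::real<..}"
    then obtain x and t :: real where p: "p = (x, t)" and xt: "x \<in> X" "0 < t" by auto
    have "continuous_on {0<..} (\<lambda>u. (\<lambda>(x, u). k x u) (x, u))"
      by (rule continuous_on_compose2[OF k]) (use xt in \<open>auto intro!: continuous_intros\<close>)
    then have ck: "continuous_on {0<..} (k x)" by simp
    have "continuous_on {0<..<1} (\<lambda>\<sigma>. t * h (t * \<sigma>) * k x (t * (1 - \<sigma>)))"
      using xt by (intro continuous_intros continuous_on_compose2[OF ck] continuous_on_compose2[OF sqrt_sing_cont[OF h order_refl]]) auto
    from borel_measurable_continuous_on_indicator[OF _ this]
    show "?f p \<in> borel_measurable lebesgue" unfolding p by (auto intro: measurable_completion)
    show "\<exists>U D. open U \<and> p \<in> U \<and> integrable lebesgue D \<and> (\<forall>q\<in>(X \<times> {0<..}) \<inter> U. \<forall>y\<in>space lebesgue. \<bar>?f q y\<bar> \<le> D y)"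
    proof -
      obtain H where H: "0 \<le> H" "\<And>s. 0 < s \<Longrightarrow> s < 2 * t \<Longrightarrow> \<bar>h s\<bar> \<le> H / sqrt s" using sqrt_singD[OF h, of "2 * t"] xt by auto
      \<comment> \<open>Near \<open>x\<close> the continuous constant \<open>C\<close> stays below C
        x + 1, so one majorant serves a whole neighbourhood.\<close>
      obtain V where V: "open V" "V \<inter> X = (C -` {..<C x + 1}) \<inter> X"
        using C unfolding continuous_on_open_invariant by (metis open_lessThan)
      let ?U = "V \<times> {..<2 * t}" and ?D = "\<lambda>\<sigma>. indicator {0<..<1::real} \<sigma> *\<^sub>R ((H * (C x + 1)) * (1 / (sqrt \<sigma> * sqrt (1 - \<sigma>))))"
      have "open ?U" using V by (intro open_Times) auto
      moreover have "p \<in> ?U" using V xt p by auto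
      moreover have "integrable lebesgue ?D"
        using set_integrable_mult_right[where a="H * (C x + 1)", OF set_integrable_beta_half[of 1]]
        unfolding set_integrable_def by simp
      moreover have "\<bar>?f q \<sigma>\<bar> \<le> ?D \<sigma>" if q: "q \<in> (X \<times> {0<..}) \<inter> ?U" for q \<sigma>
      proof -
        obtain y s where y: "q = (y, s)" "y \<in> X" "y \<in> V" "0 < s" "s < 2 * t" using q by auto
        have "y \<in> C -` {..<C x + 1} \<inter> X" using V y by blast
        then have Cy: "C y \<le> C x + 1" by simp
        show ?thesis
        proof (cases "\<sigma> \<in> {0<..<1}")
          case True
          have s2: "s * \<sigma> < 2 * t" using True y by (intro less_le_trans[OF _ less_imp_le[OF y(5)]]) (simp add: mult_less_cancel_left2)
          have "\<bar>k y (s * (1 - \<sigma>))\<bar> \<le> C y / sqrt (s * (1 - \<sigma>))" using kb[of y] y True by auto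
          also have "\<dots> \<le> (C x + 1) / sqrt (s * (1 - \<sigma>))" using Cy True y by (intro divide_right_mono) auto
          finally have 1: "\<bar>k y (s * (1 - \<sigma>))\<bar> \<le> (C x + 1) / sqrt (s * (1 - \<sigma>))" .
          have 2: "\<bar>h (s * \<sigma>)\<bar> \<le> H / sqrt (s * \<sigma>)" using H s2 True y by auto
          have "\<bar>h (s * \<sigma>)\<bar> * \<bar>k y (s * (1 - \<sigma>))\<bar> \<le> (H / sqrt (s * \<sigma>)) * ((C x + 1) / sqrt (s * (1 - \<sigma>)))"
            using H(1) y True by (intro mult_mono 1 2) auto
          then have "s * (\<bar>h (s * \<sigma>)\<bar> * \<bar>k y (s * (1 - \<sigma>))\<bar>) \<le> s * ((H / sqrt (s * \<sigma>)) * ((C x + 1) / sqrt (s * (1 - \<sigma>))))"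
            using y by (intro mult_left_mono) auto
          also have "\<dots> = (H * (C x + 1)) * (1 / (sqrt \<sigma> * sqrt (1 - \<sigma>)))"
          proof -
            have "sqrt (s * \<sigma>) * sqrt (s * (1 - \<sigma>)) = (sqrt s * sqrt s) * (sqrt \<sigma> * sqrt (1 - \<sigma>))"
              by (simp only: real_sqrt_mult mult_ac)
            also have "\<dots> = s * (sqrt \<sigma> * sqrt (1 - \<sigma>))" using y by simp
            finally have eq: "sqrt (s * \<sigma>) * sqrt (s * (1 - \<sigma>)) = s * (sqrt \<sigma> * sqrt (1 - \<sigma>))" .
            have "s * ((H / a) * (K / b)) = s * (H * K) / (a * b)" for a b K by simp
            from this[of "sqrt (s * \<sigma>)" "C x + 1" "sqrt (s * (1 - \<sigma>))"] show ?thesis unfolding eq using y by simp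
          qed
          finally show ?thesis using True y by (simp add: abs_mult mult.assoc)
        qed (auto simp: y)
      qed
      ultimately show ?thesis by blast
    qed
  next
    fix \<sigma> :: real
    show "continuous_on (X \<times> {0<..}) (\<lambda>p. ?f p \<sigma>)"
    proof (cases "\<sigma> \<in> {0<..<1}")
      case True
      have "continuous_on (X \<times> {0<..}) (\<lambda>p. snd p * h (snd p * \<sigma>) * (\<lambda>(x,u). k x u) (fst p, snd p * (1 - \<sigma>)))"
        using True by (intro continuous_intros continuous_on_compose2[OF k] continuous_on_compose2[OF sqrt_sing_cont[OF h order_refl]]) auto
      then show ?thesis using True by (simp add: case_prod_beta')
    qed (simp add: case_prod_beta')
  qed
  then show ?thesis
    by (rule continuous_on_eq) (auto simp: conv_rescale)
qed

section \<open>The Volterra equation for the boundary flux\<close>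

lemma conv_sqrt_sing:
  assumes h: "sqrt_sing h" and k: "continuous_on {0<..} k" and kb: "\<And>u. 0 < u \<Longrightarrow> \<bar>k u\<bar> \<le> C / sqrt u"
  shows "sqrt_sing (conv k h)"
  unfolding sqrt_sing_def
proof (intro conjI allI impI)
  \<comment> \<open>A dummy parameter is introduced in order to apply \<open>conv_continuous\<close>
    to a kernel of time alone.\<close>
  have "continuous_on (UNIV \<times> {0<..}) (\<lambda>(x::real, u). k u)"
    using continuous_on_compose2[OF k continuous_on_snd[OF continuous_on_id], of "UNIV \<times> {0<..}"]
    by (auto simp: case_prod_beta')
  from conv_continuous[OF h this continuous_on_const[of _ C] kb]
  have "continuous_on (UNIV \<times> {0<..}) (\<lambda>(x::real, t). conv k h t)" by simp
  then have "continuous_on {0<..} (\<lambda>t. (\<lambda>(x::real, t). conv k h t) (0, t))"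
    by (rule continuous_on_compose2) (auto intro!: continuous_intros)
  then show "continuous_on {0<..} (conv k h)" by simp
  fix T :: real assume T: "0 < T"
  obtain H where H: "0 \<le> H" "\<And>s. 0 < s \<Longrightarrow> s < T \<Longrightarrow> \<bar>h s\<bar> \<le> H / sqrt s" using sqrt_singD[OF h T] by metis
  have C: "0 \<le> C" using order_trans[OF abs_ge_zero kb[of 1]] by simp
  have "\<bar>conv k h t\<bar> \<le> (H * C * exp (lam * T) / 2) / sqrt t" if t: "t \<in> {0<..<T}" for t
  proof -
    have "\<bar>conv k h t\<bar> \<le> H * C * (weight t / 2)"
    proof (rule conv_bound[OF sqrt_sing_cont[OF h] _ k kb H(1) C])
      fix s assume s: "0 < s" "s < t"
      have "\<bar>h s\<bar> \<le> H * (1 / sqrt s)" using H(2)[of s] s t by simp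
      also have "\<dots> \<le> H * weight s" using s H(1) by (intro mult_left_mono inverse_sqrt_le_weight) auto
      finally show "\<bar>h s\<bar> \<le> H * weight s" .
    qed (use t in auto)
    also have "\<dots> \<le> H * C * (exp (lam * T) * (1 / sqrt t) / 2)"
      using t H(1) C by (intro mult_left_mono divide_right_mono weight_le) auto
    finally show ?thesis by simp
  qed
  then show "\<exists>H. \<forall>s\<in>{0<..<T}. \<bar>conv k h s\<bar> \<le> H / sqrt s" by blast
qed

lemma conv_diff:
  assumes f: "sqrt_sing f" and g: "sqrt_sing g" and k: "continuous_on {0<..} k"
    and kb: "\<And>u. 0 < u \<Longrightarrow> \<bar>k u\<bar> \<le> C / sqrt u"
  shows "conv k (\<lambda>s. f s - g s) t = conv k f t - conv k g t"
  unfolding conv_def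
  using set_integral_diff(2)[OF conv_integrable[OF f k kb, of t] conv_integrable[OF g k kb, of t]]
  by (simp add: left_diff_distrib)

lemma conv_cong: "(\<And>s. 0 < s \<Longrightarrow> s < t \<Longrightarrow> f s = g s) \<Longrightarrow> conv k f t = conv k g t"
  unfolding conv_def by (intro set_lebesgue_integral_cong) auto

definition ksqrt :: "real \<Rightarrow> real" where "ksqrt u = 1 / sqrt u"
definition kexp :: "real \<Rightarrow> real" where "kexp u = exp (- u)"

lemma continuous_ksqrt: "continuous_on {0<..} ksqrt"
  unfolding ksqrt_def by (auto intro!: continuous_intros)
lemma continuous_kexp: "continuous_on {0<..} kexp"
  unfolding kexp_def by (auto intro!: continuous_intros)
lemma ksqrt_bound: "0 < u \<Longrightarrow> \<bar>ksqrt u\<bar> \<le> 1 / sqrt u"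
  by (simp add: ksqrt_def)
lemma kexp_bound: assumes "0 < u" shows "\<bar>kexp u\<bar> \<le> 1 / sqrt u"
proof -
  have "sqrt u \<le> 1 + u" using assms by (intro sqrt_le_one_plus) simp
  also have "\<dots> \<le> exp u" by (rule exp_ge_add_one_self)
  finally show ?thesis using assms by (simp add: kexp_def exp_minus field_simps)
qed

text \<open>
  If \<open>g\<close> is the boundary flux \<open>\<partial>\<^sub>\<nu> v\<close>, then \<open>source \<phi>b g t / r\<close> is the expression standing
  for \<open>\<partial>\<^sub>t w\<close>.
\<close>

definition source :: "real \<Rightarrow> (real \<Rightarrow> real) \<Rightarrow> real \<Rightarrow> real" where
  "source \<phi>b g t = - \<phi>b * exp (- t) - g t + conv kexp g t"

lemma sqrt_sing_source: assumes "sqrt_sing g" shows "sqrt_sing (source \<phi>b g)"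
  unfolding source_def
  by (intro sqrt_sing_add sqrt_sing_diff sqrt_sing_scale sqrt_sing_exp assms conv_sqrt_sing[OF _ continuous_kexp kexp_bound])

lemma source_diff:
  assumes "sqrt_sing g1" "sqrt_sing g2"
  shows "source \<phi>b g1 t - source \<phi>b g2 t = source 0 (\<lambda>s. g1 s - g2 s) t"
  using conv_diff[OF assms continuous_kexp kexp_bound] by (simp add: source_def)

text \<open>The factor 3/2 is 1 for the term \<open>g\<close> itself plus 1/2 for its convolution
  with \<open>kexp\<close>; the datum is bounded by the weight because \<open>weight\<close> is at
  least 1.\<close>

lemma source_bound:
  assumes g: "sqrt_sing g" and gb: "\<And>s. 0 < s \<Longrightarrow> s < T \<Longrightarrow> \<bar>g s\<bar> \<le> D * weight s" and D: "0 \<le> D" and t: "0 < t" "t < T"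
  shows "\<bar>source \<phi>b g t\<bar> \<le> (\<bar>\<phi>b\<bar> + 3 / 2 * D) * weight t"
proof -
  have "\<bar>conv kexp g t\<bar> \<le> D * 1 * (weight t / 2)"
    by (rule conv_bound[OF sqrt_sing_cont[OF g] _ continuous_kexp kexp_bound D]) (use t gb in auto)
  moreover have "\<bar>g t\<bar> \<le> D * weight t" using gb t by auto
  moreover have "\<bar>- \<phi>b * exp (- t)\<bar> \<le> \<bar>\<phi>b\<bar> * weight t"
  proof -
    have "exp (- t) \<le> 1" using t by simp
    also have "1 \<le> weight t" using one_le_weight t by simp
    finally show ?thesis by (simp add: abs_mult mult_left_mono)
  qed
  ultimately show ?thesis unfolding source_def by (simp add: algebra_simps)
qed

text \<open>Convolution with \<open>ksqrt\<close> halves the factor 3/2 of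
  \<open>source_bound\<close>. The result 3/4 is below 1, so the Volterra map contracts whenever its
  coefficient is at most 1.\<close>

lemma volterra_step:
  assumes g: "sqrt_sing g" and gb: "\<And>s. 0 < s \<Longrightarrow> s < T \<Longrightarrow> \<bar>g s\<bar> \<le> D * weight s" and D: "0 \<le> D" and t: "0 < t" "t < T"
  shows "\<bar>conv ksqrt (source \<phi>b g) t\<bar> \<le> (\<bar>\<phi>b\<bar> / 2 + 3 / 4 * D) * weight t"
proof -
  have sb: "\<bar>source \<phi>b g s\<bar> \<le> (\<bar>\<phi>b\<bar> + 3 / 2 * D) * weight s" if "0 < s" "s < t" for s
    by (rule source_bound[OF g gb D]) (use that t in auto)
  have "\<bar>conv ksqrt (source \<phi>b g) t\<bar> \<le> (\<bar>\<phi>b\<bar> + 3 / 2 * D) * 1 * (weight t / 2)"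
    by (rule conv_bound[OF sqrt_sing_cont[OF sqrt_sing_source[OF g]] sb continuous_ksqrt ksqrt_bound])
      (use t D in auto)
  then show ?thesis by (simp add: algebra_simps)
qed

definition volterra :: "real \<Rightarrow> real \<Rightarrow> (real \<Rightarrow> real) \<Rightarrow> (real \<Rightarrow> real) \<Rightarrow> bool" where
  "volterra a \<phi>b g0 g \<longleftrightarrow> sqrt_sing g \<and> (\<forall>t>0. g t = g0 t + a * conv ksqrt (source \<phi>b g) t)"

lemma conv_source_diff:
  assumes "sqrt_sing g1" "sqrt_sing g2"
  shows "conv ksqrt (source \<phi>b g1) t - conv ksqrt (source \<phi>b g2) t = conv ksqrt (source 0 (\<lambda>s. g1 s - g2 s)) t"
proof -
  have "conv ksqrt (source \<phi>b g1) t - conv ksqrt (source \<phi>b g2) t = conv ksqrt (\<lambda>s. source \<phi>b g1 s - source \<phi>b g2 s) t"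
    using conv_diff[OF sqrt_sing_source[OF assms(1)] sqrt_sing_source[OF assms(2)] continuous_ksqrt ksqrt_bound] by simp
  then show ?thesis using source_diff[OF assms] by simp
qed

text \<open>Two solutions are known to be O(1 / sqrt s) only locally in time, so their difference
  need not lie in the globally weighted space of the existence proof. Instead
  \<open>volterra_step\<close> is iterated on the bounded interval (0, t + 1): the inhomogeneity
  cancels and the weighted bound shrinks by 3/4 each time.\<close>

lemma volterra_unique:
  assumes g1: "volterra a \<phi>b g0 g1" and g2: "volterra a \<phi>b g0 g2" and a: "0 \<le> a" "a \<le> 1" and t: "0 < t"
  shows "g1 t = g2 t"
proof -
  let ?d = "\<lambda>s. g1 s - g2 s"
  have s: "sqrt_sing g1" "sqrt_sing g2" using g1 g2 by (auto simp: volterra_def)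
  have d: "sqrt_sing ?d" by (rule sqrt_sing_diff[OF s])
  have eq: "?d u = a * conv ksqrt (source 0 ?d) u" if "0 < u" for u
    using g1 g2 that conv_source_diff[OF s, of \<phi>b u] by (simp add: volterra_def algebra_simps)
  obtain H where H: "0 \<le> H" "\<And>s. 0 < s \<Longrightarrow> s < t + 1 \<Longrightarrow> \<bar>?d s\<bar> \<le> H / sqrt s" using sqrt_singD[OF d, of "t + 1"] t by auto
  have "\<bar>?d u\<bar> \<le> ((3 / 4) ^ n * H) * weight u" if "0 < u" "u < t + 1" for n u
    using that
  proof (induction n arbitrary: u)
    case 0
    have "\<bar>?d u\<bar> \<le> H * (1 / sqrt u)" using H(2) 0 by simp
    also have "\<dots> \<le> H * weight u" using 0 H(1) by (intro mult_left_mono inverse_sqrt_le_weight) auto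
    finally show ?case by simp
  next
    case (Suc n)
    have "\<bar>?d u\<bar> = a * \<bar>conv ksqrt (source 0 ?d) u\<bar>" using eq[OF Suc.prems(1)] a by (simp add: abs_mult)
    also have "\<dots> \<le> 1 * ((\<bar>0\<bar> / 2 + 3 / 4 * ((3 / 4) ^ n * H)) * weight u)"
      by (intro mult_mono volterra_step[OF d Suc.IH]) (use a H(1) Suc.prems in auto)
    finally show ?case by simp
  qed
  from this[of t] have *: "\<bar>?d t\<bar> \<le> ((3 / 4) ^ n * H) * weight t" for n using t by auto
  have "(\<lambda>n. ((3 / 4) ^ n * H) * weight t) \<longlonglongrightarrow> (0 * H) * weight t"
    by (intro tendsto_intros LIMSEQ_realpow_zero) auto
  then have "\<bar>?d t\<bar> \<le> (0 * H) * weight t" by (rule LIMSEQ_le_const) (use * in auto)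
  then show ?thesis by simp
qed

text \<open>Banach's fixed point theorem for the Volterra map divided by the weight. Keeping the
  coefficient \<open>a\<close> in the resulting bound matters: later it is sqrt (eps / pi) and makes
  the contribution of the boundary datum small.\<close>

lemma volterra_exists:
  assumes g0: "continuous_on {0<..} g0" and g0b: "\<And>t. 0 < t \<Longrightarrow> \<bar>g0 t\<bar> \<le> G * weight t" and G: "0 \<le> G"
    and a: "0 \<le> a" "a \<le> 1"
  obtains g where "volterra a \<phi>b g0 g" "\<And>t. 0 < t \<Longrightarrow> \<bar>g t\<bar> \<le> (4 * G + 2 * a * \<bar>\<phi>b\<bar>) * weight t"
proof -
  \<comment> \<open>The substitution \<open>t = exp z\<close> turns the weighted space into bounded continuous functions on the line,
    since no limit at \<open>t = 0\<close> can be expected.\<close>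
  define gy :: "(real \<Rightarrow>\<^sub>C real) \<Rightarrow> real \<Rightarrow> real" where "gy y t = weight t * apply_bcontfun y (ln t)" for y t
  define F where "F y z = (g0 (exp z) + a * conv ksqrt (source \<phi>b (gy y)) (exp z)) / weight (exp z)" for y z
  have gyb: "\<bar>gy y t\<bar> \<le> norm y * weight t" if "0 < t" for y t
    using norm_bounded[of y "ln t"] weight_pos[OF that] by (simp add: gy_def abs_mult mult.commute)
  have gyc: "continuous_on {0<..} (gy y)" for y
    unfolding gy_def
    by (intro continuous_intros continuous_on_weight continuous_on_compose2[OF continuous_on_apply_bcontfun[of UNIV]]) auto
  have gys: "sqrt_sing (gy y)" for y
    by (rule sqrt_singI_weight[OF gyc gyb])
  have Fb: "\<bar>F y z\<bar> \<le> G + a * (\<bar>\<phi>b\<bar> / 2) + 3 / 4 * norm y" for y z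
  proof -
    have "\<bar>conv ksqrt (source \<phi>b (gy y)) (exp z)\<bar> \<le> (\<bar>\<phi>b\<bar> / 2 + 3 / 4 * norm y) * weight (exp z)"
      by (rule volterra_step[OF gys gyb, of "exp z + 1"]) auto
    then have "a * \<bar>conv ksqrt (source \<phi>b (gy y)) (exp z)\<bar> \<le> a * ((\<bar>\<phi>b\<bar> / 2 + 3 / 4 * norm y) * weight (exp z))"
      using a by (intro mult_left_mono) auto
    also have "\<dots> = (a * (\<bar>\<phi>b\<bar> / 2) + a * (3 / 4 * norm y)) * weight (exp z)" by (simp add: algebra_simps)
    also have "\<dots> \<le> (a * (\<bar>\<phi>b\<bar> / 2) + 3 / 4 * norm y) * weight (exp z)"
      using a weight_pos[of "exp z"] mult_right_mono[of a 1 "3 / 4 * norm y"] by (intro mult_right_mono add_left_mono) auto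
    finally have "a * \<bar>conv ksqrt (source \<phi>b (gy y)) (exp z)\<bar> \<le> (a * (\<bar>\<phi>b\<bar> / 2) + 3 / 4 * norm y) * weight (exp z)" .
    then have "\<bar>g0 (exp z) + a * conv ksqrt (source \<phi>b (gy y)) (exp z)\<bar> \<le> G * weight (exp z) + (a * (\<bar>\<phi>b\<bar> / 2) + 3 / 4 * norm y) * weight (exp z)"
      using g0b[of "exp z"] a by (intro order_trans[OF abs_triangle_ineq] add_mono) (auto simp: abs_mult)
    then show ?thesis using weight_pos[of "exp z"] unfolding F_def by (simp add: divide_le_eq algebra_simps)
  qed
  have Fc: "continuous_on UNIV (F y)" for y
    unfolding F_def
    by (intro continuous_intros continuous_on_compose2[OF g0] continuous_on_compose2[OF continuous_on_weight]
       continuous_on_compose2[OF sqrt_sing_cont[OF conv_sqrt_sing[OF sqrt_sing_source[OF gys] continuous_ksqrt ksqrt_bound] order_refl]])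
      (use weight_pos in \<open>auto simp: less_imp_neq[symmetric]\<close>)
  define T where "T y = Bcontfun (F y)" for y
  have FT: "apply_bcontfun (T y) = F y" for y
    unfolding T_def by (rule Bcontfun_inverse) (use Fc Fb in \<open>auto intro!: bcontfun_normI\<close>)
  have "dist (T y1) (T y2) \<le> 3 / 4 * dist y1 y2" for y1 y2
  proof (rule dist_bound)
    fix z
    \<comment> \<open>The source is affine in the flux, so the difference of two images is governed
      by the source with boundary datum 0.\<close>
    let ?d = "\<lambda>s. gy y1 s - gy y2 s"
    have "\<bar>conv ksqrt (source 0 ?d) (exp z)\<bar> \<le> (\<bar>0\<bar> / 2 + 3 / 4 * dist y1 y2) * weight (exp z)"
    proof (rule volterra_step[OF sqrt_sing_diff[OF gys gys], of "exp z + 1"])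
      fix s :: real assume "0 < s"
      then show "\<bar>?d s\<bar> \<le> dist y1 y2 * weight s"
        using dist_bounded[of y1 "ln s" y2] weight_pos[of s]
        by (simp add: gy_def dist_real_def abs_mult mult.commute[of "weight s"] flip: left_diff_distrib)
    qed auto
    then have 1: "\<bar>conv ksqrt (source 0 ?d) (exp z)\<bar> / weight (exp z) \<le> 3 / 4 * dist y1 y2"
      using weight_pos[of "exp z"] by (simp add: divide_le_eq)
    have "F y1 z - F y2 z = a * (conv ksqrt (source 0 ?d) (exp z) / weight (exp z))"
      unfolding F_def using conv_source_diff[OF gys gys, of \<phi>b y1 "exp z" y2]
      by (simp add: diff_divide_distrib[symmetric] right_diff_distrib[symmetric])
    then have "\<bar>F y1 z - F y2 z\<bar> = a * (\<bar>conv ksqrt (source 0 ?d) (exp z)\<bar> / weight (exp z))"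
      using a weight_pos[of "exp z"] by (simp add: abs_mult)
    also have "\<dots> \<le> 1 * (3 / 4 * dist y1 y2)" using a 1 weight_pos[of "exp z"] by (intro mult_mono) auto
    finally show "dist (apply_bcontfun (T y1) z) (apply_bcontfun (T y2) z) \<le> 3 / 4 * dist y1 y2"
      by (simp add: FT dist_real_def)
  qed
  then have "\<exists>!y. T y = y" by (intro banach_fix_type[of "3/4"]) auto
  then obtain y where y: "T y = y" by blast
  have yF: "apply_bcontfun y z = F y z" for z using FT[of y] y by simp
  \<comment> \<open>The fixed point is bounded in terms of itself; absorbing the last term
    multiplies the rest by 4 = 1 / (1 - 3/4).\<close>
  have "norm y \<le> G + a * (\<bar>\<phi>b\<bar> / 2) + 3 / 4 * norm y"
    by (rule norm_bound) (use Fb[of y] yF in auto)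
  then have ny: "norm y \<le> 4 * G + 2 * a * \<bar>\<phi>b\<bar>" by (simp add: algebra_simps)
  show thesis
  proof (rule that)
    show "volterra a \<phi>b g0 (gy y)"
      unfolding volterra_def
    proof (intro conjI allI impI gys)
      fix t :: real assume t: "0 < t"
      have "gy y t = weight t * F y (ln t)" by (simp add: gy_def yF)
      then show "gy y t = g0 t + a * conv ksqrt (source \<phi>b (gy y)) t"
        using t weight_pos[OF t] by (simp add: F_def)
    qed
    fix t :: real assume t: "0 < t"
    have "\<bar>gy y t\<bar> \<le> norm y * weight t" by (rule gyb[OF t])
    also have "\<dots> \<le> (4 * G + 2 * a * \<bar>\<phi>b\<bar>) * weight t" using ny weight_pos[OF t] by (intro mult_right_mono) auto
    finally show "\<bar>gy y t\<bar> \<le> (4 * G + 2 * a * \<bar>\<phi>b\<bar>) * weight t" .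
  qed
qed

section \<open>The heat kernel on the line\<close>

definition heatk :: "real \<Rightarrow> real \<Rightarrow> real" where
  "heatk \<tau> z = exp (- (z\<^sup>2 / (4 * \<tau>))) / sqrt (4 * pi * \<tau>)"

definition heatk1 :: "real \<Rightarrow> real \<Rightarrow> real" where
  "heatk1 \<tau> z = - (z / (2 * \<tau>)) * heatk \<tau> z"

definition heatk2 :: "real \<Rightarrow> real \<Rightarrow> real" where
  "heatk2 \<tau> z = (z\<^sup>2 / (4 * \<tau>\<^sup>2) - 1 / (2 * \<tau>)) * heatk \<tau> z"

lemma heatk_nonneg: "0 \<le> \<tau> \<Longrightarrow> 0 \<le> heatk \<tau> z" and heatk_pos: "0 < \<tau> \<Longrightarrow> 0 < heatk \<tau> z"
  by (auto simp: heatk_def)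

lemma heatk_minus [simp]: "heatk \<tau> (- z) = heatk \<tau> z"
  by (simp add: heatk_def)

lemma heatk_deriv: "0 < \<tau> \<Longrightarrow> (heatk \<tau> has_real_derivative heatk1 \<tau> z) (at z)"
  unfolding heatk_def[abs_def] heatk1_def
  by (auto intro!: derivative_eq_intros simp: field_simps)

lemma heatk1_deriv:
  assumes "0 < \<tau>" shows "(heatk1 \<tau> has_real_derivative heatk2 \<tau> z) (at z)"
proof -
  have "((\<lambda>z. - (z / (2 * \<tau>))) has_real_derivative - (1 / (2 * \<tau>))) (at z)"
    by (intro DERIV_minus DERIV_cdivide DERIV_ident)
  from DERIV_mult[OF this heatk_deriv[OF assms]]
  show ?thesis unfolding heatk1_def[abs_def]
    by (rule DERIV_cong) (simp add: heatk2_def algebra_simps power2_eq_square)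
qed

text \<open>The time derivative is again \<open>heatk2\<close>, the second space derivative: this is
  the heat equation for the kernel.\<close>

lemma heatk_deriv_time:
  assumes "0 < \<tau>" shows "((\<lambda>\<tau>. heatk \<tau> z) has_real_derivative heatk2 \<tau> z) (at \<tau>)"
proof -
  have 1: "((\<lambda>\<tau>. exp (- (z\<^sup>2 / (4 * \<tau>)))) has_real_derivative exp (- (z\<^sup>2 / (4 * \<tau>))) * (z\<^sup>2 / (4 * \<tau>\<^sup>2))) (at \<tau>)"
    using assms by (auto intro!: derivative_eq_intros simp: field_simps power2_eq_square)
  have 2: "((\<lambda>\<tau>. sqrt (4 * pi * \<tau>)) has_real_derivative sqrt (4 * pi * \<tau>) / (2 * \<tau>)) (at \<tau>)"
  proof -
    have e: "sqrt (4 * pi * \<tau>) * sqrt (4 * pi * \<tau>) = 4 * pi * \<tau>" using assms by simp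
    have "((\<lambda>\<tau>. sqrt (4 * pi * \<tau>)) has_real_derivative (inverse (sqrt (4 * pi * \<tau>)) / 2) * (4 * pi)) (at \<tau>)"
      by (rule DERIV_chain2[where f=sqrt, OF DERIV_real_sqrt])
        (use assms in \<open>auto intro!: derivative_eq_intros\<close>)
    moreover have "(inverse (sqrt (4 * pi * \<tau>)) / 2) * (4 * pi) = sqrt (4 * pi * \<tau>) / (2 * \<tau>)"
      using assms e by (simp add: divide_simps del: real_sqrt_mult_self) 
    ultimately show ?thesis by simp
  qed
  have "((\<lambda>\<tau>. heatk \<tau> z) has_real_derivative
    (exp (- (z\<^sup>2 / (4 * \<tau>))) * (z\<^sup>2 / (4 * \<tau>\<^sup>2)) * sqrt (4 * pi * \<tau>) - exp (- (z\<^sup>2 / (4 * \<tau>))) * (sqrt (4 * pi * \<tau>) / (2 * \<tau>)))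
     / (sqrt (4 * pi * \<tau>) * sqrt (4 * pi * \<tau>))) (at \<tau>)"
    unfolding heatk_def[abs_def] by (rule DERIV_divide[OF 1 2]) (use assms in auto)
  moreover have gen: "(e * x * s - e * (s / y)) / (s * s) = (x - 1 / y) * (e / s)" if "s \<noteq> 0" "y \<noteq> 0" for e x s y :: real
    using that by (simp add: field_simps)
  ultimately show ?thesis unfolding heatk2_def heatk_def
    by (elim DERIV_cong, intro gen) (use assms in auto)
qed

lemma heatk_continuous:
  "continuous_on ({0<..} \<times> UNIV) (\<lambda>(\<tau>, z). heatk \<tau> z)"
  "continuous_on ({0<..} \<times> UNIV) (\<lambda>(\<tau>, z). heatk1 \<tau> z)"
  "continuous_on ({0<..} \<times> UNIV) (\<lambda>(\<tau>, z). heatk2 \<tau> z)"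
  unfolding heatk_def heatk1_def heatk2_def case_prod_beta'
  by (auto intro!: continuous_intros)

text \<open>Half of the Gaussian exponent is split off to absorb polynomial factors; the other half
  is the heat kernel at the doubled time.\<close>

lemma heatk_double: assumes "0 < \<tau>" shows "heatk \<tau> z = sqrt 2 * exp (- (z\<^sup>2 / (8 * \<tau>))) * heatk (2 * \<tau>) z"
proof -
  have "sqrt (4 * pi * (2 * \<tau>)) = sqrt 2 * sqrt (4 * pi * \<tau>)"
    by (subst real_sqrt_mult[symmetric]) (simp add: mult_ac)
  moreover have "exp (- (z\<^sup>2 / (4 * \<tau>))) = exp (- (z\<^sup>2 / (8 * \<tau>))) * exp (- (z\<^sup>2 / (8 * \<tau>)))"
    using assms by (simp add: exp_add[symmetric])
  ultimately show ?thesis using assms by (simp add: heatk_def)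
qed

lemma exp_power_bounds:
  assumes u: "0 \<le> (u::real)"
  shows "sqrt u * exp (- u) \<le> 1" "u * exp (- u) \<le> 1" "u\<^sup>2 * exp (- u) \<le> 2"
proof -
  have e1: "1 + u \<le> exp u" by (rule exp_ge_add_one_self)
  have "sqrt u \<le> 1 + u" using u by (rule sqrt_le_one_plus)
  with e1 have "sqrt u \<le> exp u" by linarith
  then show "sqrt u * exp (- u) \<le> 1" by (simp add: exp_minus field_simps)
  from e1 have "u \<le> exp u" by linarith
  then show "u * exp (- u) \<le> 1" by (simp add: exp_minus field_simps)
  have "u\<^sup>2 \<le> 2 * exp u" using exp_lower_Taylor_quadratic[OF u] u by simp
  then show "u\<^sup>2 * exp (- u) \<le> 2" by (simp add: exp_minus field_simps)
qed

lemma sqrt2_le: "sqrt 2 \<le> 3 / 2"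
  by (rule real_le_lsqrt) (auto simp: power2_eq_square)

text \<open>With u = z^2 / (8 * \<tau>), powers of u times exp (- u) are bounded, and
  \<open>heatk_double\<close> leaves the kernel at time 2 * \<tau>. The constants come from sqrt 2 *
  sqrt 8 = 4, 3/2 * 8 = 12 and 3/2 * 64 * 2 = 192, with 3/2 as a bound for sqrt 2.\<close>

lemma heatk_bounds:
  assumes t: "0 < \<tau>"
  shows "heatk \<tau> z \<le> 3 / 2 * heatk (2 * \<tau>) z"
    "\<bar>z\<bar> * heatk \<tau> z \<le> 4 * sqrt \<tau> * heatk (2 * \<tau>) z"
    "z\<^sup>2 * heatk \<tau> z \<le> 12 * \<tau> * heatk (2 * \<tau>) z"
    "z ^ 4 * heatk \<tau> z \<le> 192 * \<tau>\<^sup>2 * heatk (2 * \<tau>) z"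
    "\<bar>heatk1 \<tau> z\<bar> \<le> (2 / sqrt \<tau>) * heatk (2 * \<tau>) z"
    "\<bar>heatk2 \<tau> z\<bar> \<le> (4 / \<tau>) * heatk (2 * \<tau>) z"
proof -
  let ?u = "z\<^sup>2 / (8 * \<tau>)" and ?E = "exp (- (z\<^sup>2 / (8 * \<tau>)))" and ?H = "heatk (2 * \<tau>) z"
  have u: "0 \<le> ?u" using t by simp
  have H: "0 \<le> ?H" using t by (simp add: heatk_nonneg)
  have z2: "z\<^sup>2 = 8 * \<tau> * ?u" using t by simp
  note eb = exp_power_bounds[OF u]
  have gen: "c * heatk \<tau> z \<le> D * ?H" if "c * ?E \<le> C" "sqrt 2 * C \<le> D" for c C D
  proof -
    have "c * heatk \<tau> z = (sqrt 2 * (c * ?E)) * ?H" by (simp add: heatk_double[OF t])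
    also have "\<dots> \<le> (sqrt 2 * C) * ?H" using that H by (intro mult_right_mono mult_left_mono) auto
    also have "\<dots> \<le> D * ?H" using that H by (intro mult_right_mono) auto
    finally show ?thesis .
  qed
  show 0: "heatk \<tau> z \<le> 3 / 2 * ?H" using gen[of 1 1 "3/2"] sqrt2_le t by simp
  have "\<bar>z\<bar> = sqrt (8 * \<tau>) * sqrt ?u" using z2 t by (simp flip: real_sqrt_mult)
  then have "\<bar>z\<bar> * ?E = sqrt (8 * \<tau>) * (sqrt ?u * ?E)" by simp
  also have "\<dots> \<le> sqrt (8 * \<tau>) * 1" using eb t by (intro mult_left_mono) auto
  finally have "\<bar>z\<bar> * ?E \<le> sqrt (8 * \<tau>)" by simp
  moreover have "sqrt 2 * sqrt (8 * \<tau>) = 4 * sqrt \<tau>"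
  proof -
    have "sqrt 2 * sqrt (8 * \<tau>) = sqrt (4\<^sup>2 * \<tau>)" by (simp flip: real_sqrt_mult)
    also have "\<dots> = 4 * sqrt \<tau>" by (simp only: real_sqrt_mult real_sqrt_abs)
    finally show ?thesis .
  qed
  ultimately show 1: "\<bar>z\<bar> * heatk \<tau> z \<le> 4 * sqrt \<tau> * ?H" by (intro gen) auto
  have "z\<^sup>2 * ?E = 8 * \<tau> * (?u * ?E)" using t by simp
  also have "\<dots> \<le> 8 * \<tau> * 1" using eb t by (intro mult_left_mono) auto
  finally show 2: "z\<^sup>2 * heatk \<tau> z \<le> 12 * \<tau> * ?H" using sqrt2_le t mult_right_mono[of "sqrt 2" "3/2" "8 * \<tau>"] by (intro gen) auto
  have "z ^ 4 * ?E = (8 * \<tau>)\<^sup>2 * (?u\<^sup>2 * ?E)" using t by (simp add: power_divide power_mult_distrib flip: power_mult)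
  also have "\<dots> \<le> (8 * \<tau>)\<^sup>2 * 2" using eb t by (intro mult_left_mono) auto
  finally show "z ^ 4 * heatk \<tau> z \<le> 192 * \<tau>\<^sup>2 * ?H"
    using sqrt2_le mult_right_mono[of "sqrt 2" "3/2" "(8 * \<tau>)\<^sup>2 * 2"] by (intro gen) (auto simp: power_mult_distrib)
  have "\<bar>heatk1 \<tau> z\<bar> = (\<bar>z\<bar> * heatk \<tau> z) / (2 * \<tau>)" using heatk_nonneg[of \<tau> z] t by (simp add: heatk1_def abs_mult)
  also have "\<dots> \<le> (4 * sqrt \<tau> * ?H) / (2 * \<tau>)" using 1 t by (intro divide_right_mono) auto
  also have "\<dots> = (2 / sqrt \<tau>) * ?H"
  proof -
    have "4 * s * H / (2 * (s * s)) = (2 / s) * H" if "s > 0" for s H :: real using that by (simp add: field_simps)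
    from this[of "sqrt \<tau>" ?H] show ?thesis using t by simp
  qed
  finally show "\<bar>heatk1 \<tau> z\<bar> \<le> (2 / sqrt \<tau>) * ?H" .
  have "\<bar>heatk2 \<tau> z\<bar> \<le> (z\<^sup>2 / (4 * \<tau>\<^sup>2) + 1 / (2 * \<tau>)) * heatk \<tau> z"
    unfolding heatk2_def abs_mult using t heatk_nonneg[of \<tau> z]
    by (intro mult_mono) (auto intro!: order_trans[OF abs_triangle_ineq4])
  also have "\<dots> = (z\<^sup>2 * heatk \<tau> z) / (4 * \<tau>\<^sup>2) + heatk \<tau> z / (2 * \<tau>)" by (simp add: algebra_simps)
  also have "\<dots> \<le> (12 * \<tau> * ?H) / (4 * \<tau>\<^sup>2) + (3 / 2 * ?H) / (2 * \<tau>)"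
    using 0 2 t by (intro add_mono divide_right_mono) auto
  also have "\<dots> \<le> (4 / \<tau>) * ?H" using H t by (simp add: field_simps power2_eq_square)
  finally show "\<bar>heatk2 \<tau> z\<bar> \<le> (4 / \<tau>) * ?H" .
qed

text \<open>The heat kernel is the normal density with variance 2 * \<tau>, so its mass is known
  from probability theory.\<close>

lemma heatk_normal_density: "0 < \<tau> \<Longrightarrow> heatk \<tau> (r - \<rho>) = normal_density r (sqrt (2 * \<tau>)) \<rho>"
  by (simp add: heatk_def normal_density_def power2_commute[of r \<rho>])

lemma heatk_integral:
  assumes "0 < \<tau>"
  shows "integrable lebesgue (\<lambda>\<rho>. heatk \<tau> (r - \<rho>))" "(LINT \<rho>|lebesgue. heatk \<tau> (r - \<rho>)) = 1"
proof -
  have "(\<lambda>\<rho>. heatk \<tau> (r - \<rho>)) = normal_density r (sqrt (2 * \<tau>))" using heatk_normal_density[OF assms] by auto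
  then show "integrable lebesgue (\<lambda>\<rho>. heatk \<tau> (r - \<rho>))" "(LINT \<rho>|lebesgue. heatk \<tau> (r - \<rho>)) = 1"
    using assms by (auto simp: integrable_completion integral_completion)
qed

definition heat_conv :: "(real \<Rightarrow> real \<Rightarrow> real) \<Rightarrow> (real \<Rightarrow> real) \<Rightarrow> real \<Rightarrow> real \<Rightarrow> real" where
  "heat_conv k F \<tau> r = (LINT \<rho>|lebesgue. k \<tau> (r - \<rho>) * F \<rho>)"

text \<open>Linear growth is what r times a bounded profile has; B = 0 will encode the decaying
  case. The bound is required everywhere rather than almost everywhere, so that pointwise domination
  applies.\<close>

definition lin_growth :: "(real \<Rightarrow> real) \<Rightarrow> real \<Rightarrow> real \<Rightarrow> bool" where
  "lin_growth F A B \<longleftrightarrow> F \<in> borel_measurable lebesgue \<and> 0 \<le> A \<and> 0 \<le> B \<and> (\<forall>\<rho>. \<bar>F \<rho>\<bar> \<le> A + B * \<bar>\<rho>\<bar>)"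

lemma continuous_lebesgue_measurable: "continuous_on UNIV (f :: real \<Rightarrow> real) \<Longrightarrow> f \<in> borel_measurable lebesgue"
  by (intro measurable_completion) (simp add: borel_measurable_continuous_onI)

text \<open>From |\<rho>| <= |r| + |r - \<rho>| the growth of \<open>F\<close> costs one first
  moment of the kernel, which doubles its time once more. The constant 6 bounds 4 * sqrt 2.\<close>

lemma heat_conv_bound:
  assumes F: "lin_growth F A B" and t: "0 < \<tau>" and k: "continuous_on UNIV (k \<tau>)"
    and kb: "\<And>z. \<bar>k \<tau> z\<bar> \<le> M * heatk (2 * \<tau>) z"
  shows "integrable lebesgue (\<lambda>\<rho>. k \<tau> (r - \<rho>) * F \<rho>)"
    "\<bar>heat_conv k F \<tau> r\<bar> \<le> M * (A + B * \<bar>r\<bar> + 6 * B * sqrt \<tau>)"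
proof -
  have AB: "0 \<le> A" "0 \<le> B" and Fb: "\<And>\<rho>. \<bar>F \<rho>\<bar> \<le> A + B * \<bar>\<rho>\<bar>" and Fm: "F \<in> borel_measurable lebesgue"
    using F by (auto simp: lin_growth_def)
  have M: "0 \<le> M" 
    using order_trans[OF abs_ge_zero kb[of 0]] heatk_pos[of "2 * \<tau>" 0] t by (simp add: zero_le_mult_iff)
  let ?g = "\<lambda>\<rho>. M * ((A + B * \<bar>r\<bar>) * heatk (2 * \<tau>) (r - \<rho>) + B * (6 * sqrt \<tau>) * heatk (4 * \<tau>) (r - \<rho>))"
  have gi: "integrable lebesgue ?g"
    using t by (intro integrable_mult_right Bochner_Integration.integrable_add heatk_integral) auto
  have le: "\<bar>k \<tau> (r - \<rho>) * F \<rho>\<bar> \<le> ?g \<rho>" for \<rho>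
  proof -
    let ?z = "r - \<rho>"
    have H: "0 \<le> heatk (2 * \<tau>) ?z" "0 \<le> heatk (4 * \<tau>) ?z" using t by (auto intro: heatk_nonneg)
    have "B * \<bar>\<rho>\<bar> \<le> B * (\<bar>r\<bar> + \<bar>?z\<bar>)" by (rule mult_left_mono[OF _ AB(2)]) linarith
    then have "\<bar>F \<rho>\<bar> \<le> A + B * (\<bar>r\<bar> + \<bar>?z\<bar>)" using Fb[of \<rho>] by linarith
    then have "heatk (2 * \<tau>) ?z * \<bar>F \<rho>\<bar> \<le> heatk (2 * \<tau>) ?z * (A + B * (\<bar>r\<bar> + \<bar>?z\<bar>))"
      by (rule mult_left_mono[OF _ H(1)])
    also have "\<dots> = (A + B * \<bar>r\<bar>) * heatk (2 * \<tau>) ?z + B * (\<bar>?z\<bar> * heatk (2 * \<tau>) ?z)" by (simp add: algebra_simps)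
    also have "\<dots> \<le> (A + B * \<bar>r\<bar>) * heatk (2 * \<tau>) ?z + B * (6 * sqrt \<tau> * heatk (4 * \<tau>) ?z)"
    proof -
      have "\<bar>?z\<bar> * heatk (2 * \<tau>) ?z \<le> 4 * sqrt (2 * \<tau>) * heatk (2 * (2 * \<tau>)) ?z" using t by (intro heatk_bounds) auto
      also have "\<dots> = (4 * sqrt 2) * (sqrt \<tau> * heatk (4 * \<tau>) ?z)" by (simp add: real_sqrt_mult)
      also have "\<dots> \<le> 6 * (sqrt \<tau> * heatk (4 * \<tau>) ?z)" using sqrt2_le H t by (intro mult_right_mono) auto
      finally show ?thesis using AB by (intro add_left_mono mult_left_mono) auto
    qed
    finally have 1: "heatk (2 * \<tau>) ?z * \<bar>F \<rho>\<bar> \<le> (A + B * \<bar>r\<bar>) * heatk (2 * \<tau>) ?z + B * (6 * sqrt \<tau> * heatk (4 * \<tau>) ?z)" .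
    have "\<bar>k \<tau> ?z * F \<rho>\<bar> \<le> (M * heatk (2 * \<tau>) ?z) * \<bar>F \<rho>\<bar>" unfolding abs_mult by (intro mult_right_mono kb) auto
    also have "\<dots> = M * (heatk (2 * \<tau>) ?z * \<bar>F \<rho>\<bar>)" by simp
    also have "\<dots> \<le> ?g \<rho>" using mult_left_mono[OF 1 M] by (simp add: mult.assoc)
    finally show ?thesis .
  qed
  have km: "(\<lambda>\<rho>. k \<tau> (r - \<rho>)) \<in> borel_measurable lebesgue"
    by (intro continuous_lebesgue_measurable continuous_intros continuous_on_compose2[OF k]) auto
  show i: "integrable lebesgue (\<lambda>\<rho>. k \<tau> (r - \<rho>) * F \<rho>)"
    by (rule Bochner_Integration.integrable_bound[OF gi]) (use km Fm le in \<open>auto intro!: AE_I2 borel_measurable_times order_trans[OF le]\<close>)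
  have "\<bar>heat_conv k F \<tau> r\<bar> \<le> (LINT \<rho>|lebesgue. \<bar>k \<tau> (r - \<rho>) * F \<rho>\<bar>)"
    unfolding heat_conv_def by (rule integral_abs_bound)
  also have "\<dots> \<le> (LINT \<rho>|lebesgue. ?g \<rho>)" using i gi le by (intro integral_mono) auto
  also have "\<dots> = M * ((A + B * \<bar>r\<bar>) * 1 + B * (6 * sqrt \<tau>) * 1)"
    using t by (simp add: heatk_integral)
  finally show "\<bar>heat_conv k F \<tau> r\<bar> \<le> M * (A + B * \<bar>r\<bar> + 6 * B * sqrt \<tau>)" by (simp add: algebra_simps)
qed

text \<open>A common property of the heat kernel and its first two derivatives, uniform for times
  bounded away from 0, so that integrability, continuity and differentiation are proved for all
  three at once.\<close>

definition gauss_dom :: "(real \<Rightarrow> real \<Rightarrow> real) \<Rightarrow> bool" where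
  "gauss_dom k \<longleftrightarrow> continuous_on ({0<..} \<times> UNIV) (\<lambda>(\<tau>, z). k \<tau> z) \<and>
     (\<forall>a>0. \<exists>M\<ge>0. \<forall>\<tau>\<ge>a. \<forall>z. \<bar>k \<tau> z\<bar> \<le> M * heatk (2 * \<tau>) z)"

lemma gauss_dom_heatk: "gauss_dom heatk" "gauss_dom heatk1" "gauss_dom heatk2"
proof -
  have "\<bar>heatk \<tau> z\<bar> \<le> 3 / 2 * heatk (2 * \<tau>) z" if "0 < a" "a \<le> \<tau>" for a \<tau> z
    using heatk_bounds(1)[of \<tau> z] heatk_nonneg[of \<tau> z] that by simp
  then show "gauss_dom heatk" unfolding gauss_dom_def
    by (intro conjI heatk_continuous allI impI exI[of _ "3/2"]) auto
  have "\<bar>heatk1 \<tau> z\<bar> \<le> 2 / sqrt a * heatk (2 * \<tau>) z" if "0 < a" "a \<le> \<tau>" for a \<tau> z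
  proof -
    have "\<bar>heatk1 \<tau> z\<bar> \<le> 2 / sqrt \<tau> * heatk (2 * \<tau>) z" using that by (intro heatk_bounds) auto
    also have "\<dots> \<le> 2 / sqrt a * heatk (2 * \<tau>) z" using that by (intro mult_right_mono divide_left_mono heatk_nonneg) auto
    finally show ?thesis .
  qed
  then show "gauss_dom heatk1" unfolding gauss_dom_def
    by (intro conjI heatk_continuous allI impI) (metis divide_nonneg_nonneg real_sqrt_ge_zero zero_le_numeral less_imp_le)
  have "\<bar>heatk2 \<tau> z\<bar> \<le> 4 / a * heatk (2 * \<tau>) z" if "0 < a" "a \<le> \<tau>" for a \<tau> z
  proof -
    have "\<bar>heatk2 \<tau> z\<bar> \<le> 4 / \<tau> * heatk (2 * \<tau>) z" using that by (intro heatk_bounds) auto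
    also have "\<dots> \<le> 4 / a * heatk (2 * \<tau>) z" using that by (intro mult_right_mono divide_left_mono heatk_nonneg) auto
    finally show ?thesis .
  qed
  then show "gauss_dom heatk2" unfolding gauss_dom_def
    by (intro conjI heatk_continuous allI impI) (metis divide_nonneg_nonneg zero_le_numeral less_imp_le)
qed

lemma gauss_dom_cont: assumes "gauss_dom k" "0 < \<tau>" shows "continuous_on UNIV (k \<tau>)"
proof -
  have "continuous_on UNIV (\<lambda>z. (\<lambda>(\<tau>, z). k \<tau> z) (\<tau>, z))"
    by (rule continuous_on_compose2[of "{0<..} \<times> UNIV"]) (use assms in \<open>auto simp: gauss_dom_def intro!: continuous_intros\<close>)
  then show ?thesis by simp
qed

lemma gauss_dom_integrable:
  assumes "gauss_dom k" "lin_growth F A B" "0 < \<tau>"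
  shows "integrable lebesgue (\<lambda>\<rho>. k \<tau> (r - \<rho>) * F \<rho>)"
proof -
  obtain M where "\<And>z. \<bar>k \<tau> z\<bar> \<le> M * heatk (2 * \<tau>) z" using assms(1,3) unfolding gauss_dom_def by blast
  then show ?thesis by (rule heat_conv_bound(1)[where k=k and \<tau>=\<tau>, OF assms(2,3) gauss_dom_cont[OF assms(1,3)]])
qed

text \<open>For bounded r and times in [a, b], every shifted Gaussian lies below a multiple of one
  wider Gaussian centred at 0, which is integrable against linear growth. This single majorant
  serves all later interchanges of limit and integral.\<close>

lemma gauss_majorant:
  assumes k: "gauss_dom k" and F: "lin_growth F A B" and ab: "0 < a" "a \<le> b"
  obtains D where "integrable lebesgue D"
    "\<And>\<tau> r \<rho>. a \<le> \<tau> \<Longrightarrow> \<tau> \<le> b \<Longrightarrow> \<bar>r\<bar> \<le> R \<Longrightarrow> \<bar>k \<tau> (r - \<rho>) * F \<rho>\<bar> \<le> D \<rho>"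
proof -
  obtain M where M: "0 \<le> M" "\<And>\<tau> z. a \<le> \<tau> \<Longrightarrow> \<bar>k \<tau> z\<bar> \<le> M * heatk (2 * \<tau>) z"
    using k ab unfolding gauss_dom_def by meson
  let ?K = "M * (exp (R\<^sup>2 / (8 * b)) * sqrt (16 * pi * b) / sqrt (8 * pi * a))"
  let ?D = "\<lambda>\<rho>. ?K * \<bar>heatk (4 * b) (0 - \<rho>) * F \<rho>\<bar>"
  show thesis
  proof (rule that[of ?D])
    show "integrable lebesgue ?D"
      by (rule integrable_mult_right[OF integrable_abs[OF gauss_dom_integrable[OF gauss_dom_heatk(1) F]]]) (use ab in auto)
    fix \<tau> r \<rho> assume t: "a \<le> \<tau>" "\<tau> \<le> b" and r: "\<bar>r\<bar> \<le> R"
    have pos: "0 < \<tau>" "0 < b" using t ab by auto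
    \<comment> \<open>Equivalent to (2 * r - \<rho>)^2 >= 0; it moves the centre of the Gaussian
      from r to 0 at the price of halving the exponent.\<close>
    have "\<rho>\<^sup>2 \<le> 2 * (r - \<rho>)\<^sup>2 + 2 * r\<^sup>2"
      using zero_le_power2[of "2 * r - \<rho>"] by (simp add: power2_eq_square algebra_simps)
    moreover have "r\<^sup>2 \<le> R\<^sup>2" using r by (simp add: power2_le_iff_abs_le abs_le_square_iff)
    ultimately have sq: "\<rho>\<^sup>2 \<le> 2 * (r - \<rho>)\<^sup>2 + 2 * R\<^sup>2" by linarith
    have "- ((r - \<rho>)\<^sup>2 / (8 * \<tau>)) \<le> - ((r - \<rho>)\<^sup>2 / (8 * b))"
      using t pos by (simp add: frac_le)
    also have "\<dots> \<le> R\<^sup>2 / (8 * b) + - (\<rho>\<^sup>2 / (16 * b))" using sq pos by (simp add: field_simps)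
    finally have "exp (- ((r - \<rho>)\<^sup>2 / (8 * \<tau>))) \<le> exp (R\<^sup>2 / (8 * b)) * exp (- (\<rho>\<^sup>2 / (16 * b)))"
      by (simp flip: exp_add)
    moreover have "heatk (2 * \<tau>) (r - \<rho>) = exp (- ((r - \<rho>)\<^sup>2 / (8 * \<tau>))) / sqrt (8 * pi * \<tau>)" by (simp add: heatk_def)
    ultimately have "heatk (2 * \<tau>) (r - \<rho>) \<le> (exp (R\<^sup>2 / (8 * b)) * exp (- (\<rho>\<^sup>2 / (16 * b)))) / sqrt (8 * pi * a)"
      using t ab by (auto intro!: frac_le)
    also have "\<dots> = (exp (R\<^sup>2 / (8 * b)) * sqrt (16 * pi * b) / sqrt (8 * pi * a)) * heatk (4 * b) (0 - \<rho>)"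
    proof -
      have "exp (- (\<rho>\<^sup>2 / (16 * b))) = sqrt (16 * pi * b) * heatk (4 * b) (0 - \<rho>)"
      proof -
        have "4 * pi * (4 * b) = 16 * pi * b" "4 * (4 * b) = 16 * b" "(0 - \<rho>)\<^sup>2 = \<rho>\<^sup>2" "sqrt (16 * pi * b) \<noteq> 0" using pos by auto
        moreover have "e = s * (e / s)" if "s \<noteq> 0" for e s :: real using that by simp
        ultimately show ?thesis unfolding heatk_def by metis
      qed
      then show ?thesis by (simp only: times_divide_eq_left mult.assoc)
    qed
    finally have "\<bar>k \<tau> (r - \<rho>)\<bar> \<le> M * ((exp (R\<^sup>2 / (8 * b)) * sqrt (16 * pi * b) / sqrt (8 * pi * a)) * heatk (4 * b) (0 - \<rho>))"
      using M t by (intro order_trans[OF M(2)] mult_left_mono) auto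
    also have "\<dots> = ?K * \<bar>heatk (4 * b) (0 - \<rho>)\<bar>"
      using pos by (simp only: abs_of_nonneg[OF heatk_nonneg] mult.assoc)
    finally have *: "\<bar>k \<tau> (r - \<rho>)\<bar> \<le> ?K * \<bar>heatk (4 * b) (0 - \<rho>)\<bar>" .
    have "\<bar>k \<tau> (r - \<rho>) * F \<rho>\<bar> = \<bar>k \<tau> (r - \<rho>)\<bar> * \<bar>F \<rho>\<bar>" by (rule abs_mult)
    also have "\<dots> \<le> (?K * \<bar>heatk (4 * b) (0 - \<rho>)\<bar>) * \<bar>F \<rho>\<bar>" by (rule mult_right_mono[OF *]) simp
    also have "\<dots> = ?D \<rho>" by (simp only: abs_mult mult.assoc)
    finally show "\<bar>k \<tau> (r - \<rho>) * F \<rho>\<bar> \<le> ?D \<rho>" .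
  qed
qed

lemma heat_conv_continuous:
  assumes k: "gauss_dom k" and F: "lin_growth F A B"
  shows "continuous_on ({0<..} \<times> UNIV) (\<lambda>(\<tau>, r). heat_conv k F \<tau> r)"
proof -
  let ?f = "\<lambda>(\<tau>, r) \<rho>. k \<tau> (r - \<rho>) * F \<rho>"
  have "continuous_on ({0::real<..} \<times> UNIV) (\<lambda>p. LINT \<rho>|lebesgue. ?f p \<rho>)"
  proof (rule continuous_on_integral_dominated)
    fix p assume "p \<in> {0::real<..} \<times> (UNIV::real set)"
    then obtain t r where p: "p = (t, r)" "0 < t" by auto
    show "?f p \<in> borel_measurable lebesgue"
      using gauss_dom_integrable[OF k F p(2), of r] p by auto
    obtain D where D: "integrable lebesgue D"
      "\<And>\<tau> x \<rho>. t / 2 \<le> \<tau> \<Longrightarrow> \<tau> \<le> 2 * t \<Longrightarrow> \<bar>x\<bar> \<le> \<bar>r\<bar> + 1 \<Longrightarrow> \<bar>k \<tau> (x - \<rho>) * F \<rho>\<bar> \<le> D \<rho>"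
      using gauss_majorant[OF k F, of "t/2" "2 * t" "\<bar>r\<bar> + 1"] p by auto
    show "\<exists>U D. open U \<and> p \<in> U \<and> integrable lebesgue D \<and> (\<forall>q\<in>({0<..} \<times> UNIV) \<inter> U. \<forall>y\<in>space lebesgue. \<bar>?f q y\<bar> \<le> D y)"
    proof (intro exI conjI)
      show "open ({t/2<..<2 * t} \<times> {r - 1<..<r + 1})" by (intro open_Times) auto
      show "p \<in> {t/2<..<2 * t} \<times> {r - 1<..<r + 1}" using p by auto
    qed (use D in auto)
  next
    fix \<rho> :: real
    have "continuous_on ({0<..} \<times> UNIV) (\<lambda>p. (\<lambda>(\<tau>, z). k \<tau> z) (fst p, snd p - \<rho>) * F \<rho>)"
      by (intro continuous_intros continuous_on_compose2[OF conjunct1[OF k[unfolded gauss_dom_def]]]) auto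
    then show "continuous_on ({0<..} \<times> UNIV) (\<lambda>p. ?f p \<rho>)" by (simp add: case_prod_beta')
  qed
  then show ?thesis by (simp add: heat_conv_def case_prod_beta')
qed

lemma heat_conv_deriv:
  assumes k: "gauss_dom k" "gauss_dom k'" and F: "lin_growth F A B" and t: "0 < \<tau>"
    and der: "\<And>z. (k \<tau> has_real_derivative k' \<tau> z) (at z)"
  shows "(heat_conv k F \<tau> has_real_derivative heat_conv k' F \<tau> r) (at r)"
proof -
  \<comment> \<open>Only the radius varies here, so the time interval of the majorant is the single
    point \<open>\<tau>\<close>.\<close>
  obtain D where D: "integrable lebesgue D"
    "\<And>s x \<rho>. \<tau> \<le> s \<Longrightarrow> s \<le> \<tau> \<Longrightarrow> \<bar>x\<bar> \<le> \<bar>r\<bar> + 1 \<Longrightarrow> \<bar>k' s (x - \<rho>) * F \<rho>\<bar> \<le> D \<rho>"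
    using gauss_majorant[OF k(2) F, of \<tau> \<tau> "\<bar>r\<bar> + 1"] t by auto
  show ?thesis
    unfolding heat_conv_def[abs_def]
  proof (rule has_real_derivative_integral_dominated[where a="r - 1" and b="r + 1" and D=D])
    fix x \<rho>
    have "((\<lambda>x. k \<tau> (x - \<rho>)) has_real_derivative k' \<tau> (x - \<rho>) * 1) (at x)"
      by (rule DERIV_chain2[OF der]) (auto intro!: derivative_eq_intros)
    then show "((\<lambda>x. k \<tau> (x - \<rho>) * F \<rho>) has_real_derivative k' \<tau> (x - \<rho>) * F \<rho>) (at x)"
      by (intro DERIV_cmult_right) simp
  qed (use D t gauss_dom_integrable[OF k(1) F t] gauss_dom_integrable[OF k(2) F t] in auto)
qed

lemma heat_conv_deriv_time:
  assumes F: "lin_growth F A B" and t: "0 < \<tau>"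
  shows "((\<lambda>\<tau>. heat_conv heatk F \<tau> r) has_real_derivative heat_conv heatk2 F \<tau> r) (at \<tau>)"
proof -
  obtain D where D: "integrable lebesgue D"
    "\<And>s x \<rho>. \<tau> / 2 \<le> s \<Longrightarrow> s \<le> 2 * \<tau> \<Longrightarrow> \<bar>x\<bar> \<le> \<bar>r\<bar> \<Longrightarrow> \<bar>heatk2 s (x - \<rho>) * F \<rho>\<bar> \<le> D \<rho>"
    using gauss_majorant[OF gauss_dom_heatk(3) F, of "\<tau> / 2" "2 * \<tau>" "\<bar>r\<bar>"] t by auto
  show ?thesis
    unfolding heat_conv_def
  proof (rule has_real_derivative_integral_dominated[where a="\<tau> / 2" and b="2 * \<tau>" and D=D])
    fix s \<rho> assume "s \<in> {\<tau> / 2<..<2 * \<tau>}"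
    then show "((\<lambda>s. heatk s (r - \<rho>) * F \<rho>) has_real_derivative heatk2 s (r - \<rho>) * F \<rho>) (at s)"
      using t by (intro DERIV_cmult_right heatk_deriv_time) auto
  qed (use D t gauss_dom_integrable[OF gauss_dom_heatk(1) F] gauss_dom_integrable[OF gauss_dom_heatk(3) F t] in auto)
qed

section \<open>The Dirichlet problem on a half-line\<close>

text \<open>
  \<open>dirP F \<tau> r / r\<close> is the Dirichlet semigroup applied to \<open>F / r\<close>: the reflection \<open>r \<mapsto> 2 - r\<close>
  at \<open>r = 1\<close> enforces the boundary condition. The formula makes sense for all real \<open>r\<close>, so that
  derivatives at the boundary need not be one-sided.
\<close>

definition dirP :: "(real \<Rightarrow> real) \<Rightarrow> real \<Rightarrow> real \<Rightarrow> real" where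
  "dirP F \<tau> r = heat_conv heatk F \<tau> r - heat_conv heatk F \<tau> (2 - r)"
definition dirP1 :: "(real \<Rightarrow> real) \<Rightarrow> real \<Rightarrow> real \<Rightarrow> real" where
  "dirP1 F \<tau> r = heat_conv heatk1 F \<tau> r + heat_conv heatk1 F \<tau> (2 - r)"
definition dirP2 :: "(real \<Rightarrow> real) \<Rightarrow> real \<Rightarrow> real \<Rightarrow> real" where
  "dirP2 F \<tau> r = heat_conv heatk2 F \<tau> r - heat_conv heatk2 F \<tau> (2 - r)"

lemma dirP_derivs:
  assumes F: "lin_growth F A B" and t: "0 < \<tau>"
  shows "(dirP F \<tau> has_real_derivative dirP1 F \<tau> r) (at r)"
    "(dirP1 F \<tau> has_real_derivative dirP2 F \<tau> r) (at r)"
    "((\<lambda>\<tau>. dirP F \<tau> r) has_real_derivative dirP2 F \<tau> r) (at \<tau>)"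
proof -
  have 0: "(heat_conv heatk F \<tau> has_real_derivative heat_conv heatk1 F \<tau> r) (at r)" for r
    by (rule heat_conv_deriv[OF gauss_dom_heatk(1,2) F t heatk_deriv[OF t]])
  have 1: "(heat_conv heatk1 F \<tau> has_real_derivative heat_conv heatk2 F \<tau> r) (at r)" for r
    by (rule heat_conv_deriv[OF gauss_dom_heatk(2,3) F t heatk1_deriv[OF t]])
  have r: "((\<lambda>r. 2 - r) has_real_derivative - 1) (at r)" for r :: real
    by (auto intro!: derivative_eq_intros)
  from DERIV_diff[OF 0 DERIV_chain2[OF 0 r]] show "(dirP F \<tau> has_real_derivative dirP1 F \<tau> r) (at r)"
    unfolding dirP_def[abs_def] dirP1_def by (simp del: DERIV_mirror)
  from DERIV_add[OF 1 DERIV_chain2[OF 1 r]] show "(dirP1 F \<tau> has_real_derivative dirP2 F \<tau> r) (at r)"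
    unfolding dirP1_def[abs_def] dirP2_def by (simp del: DERIV_mirror)
  show "((\<lambda>\<tau>. dirP F \<tau> r) has_real_derivative dirP2 F \<tau> r) (at \<tau>)"
    unfolding dirP_def dirP2_def by (intro DERIV_diff heat_conv_deriv_time[OF F t])
qed

lemma heat_conv_reflect_continuous:
  assumes k: "gauss_dom k" and F: "lin_growth F A B"
  shows "continuous_on ({0<..} \<times> UNIV) (\<lambda>(\<tau>, r). heat_conv k F \<tau> (2 - r))"
proof -
  have "continuous_on ({0<..} \<times> UNIV) (\<lambda>p. (\<lambda>(\<tau>, r). heat_conv k F \<tau> r) (fst p, 2 - snd p))"
    by (intro continuous_intros continuous_on_compose2[OF heat_conv_continuous[OF k F]]) auto
  then show ?thesis by (simp add: case_prod_beta')
qed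

lemma dirP_continuous:
  assumes F: "lin_growth F A B"
  shows "continuous_on ({0<..} \<times> UNIV) (\<lambda>(\<tau>, r). dirP F \<tau> r)"
    "continuous_on ({0<..} \<times> UNIV) (\<lambda>(\<tau>, r). dirP1 F \<tau> r)"
    "continuous_on ({0<..} \<times> UNIV) (\<lambda>(\<tau>, r). dirP2 F \<tau> r)"
proof -
  note c = heat_conv_continuous[OF gauss_dom_heatk(1) F] heat_conv_continuous[OF gauss_dom_heatk(2) F] heat_conv_continuous[OF gauss_dom_heatk(3) F]
  note d = heat_conv_reflect_continuous[OF gauss_dom_heatk(1) F] heat_conv_reflect_continuous[OF gauss_dom_heatk(2) F] heat_conv_reflect_continuous[OF gauss_dom_heatk(3) F]
  show "continuous_on ({0<..} \<times> UNIV) (\<lambda>(\<tau>, r). dirP F \<tau> r)"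
    using continuous_on_diff[OF c(1) d(1)] by (simp add: case_prod_beta' dirP_def)
  show "continuous_on ({0<..} \<times> UNIV) (\<lambda>(\<tau>, r). dirP1 F \<tau> r)"
    using continuous_on_add[OF c(2) d(2)] by (simp add: case_prod_beta' dirP1_def)
  show "continuous_on ({0<..} \<times> UNIV) (\<lambda>(\<tau>, r). dirP2 F \<tau> r)"
    using continuous_on_diff[OF c(3) d(3)] by (simp add: case_prod_beta' dirP2_def)
qed

lemma dirP_at_1 [simp]: "dirP F \<tau> 1 = 0"
  by (simp add: dirP_def)

text \<open>The reflected point satisfies |2 - r| <= r for r >= 1, so both terms obey the same
  bound. The third estimate integrates the second from r = 1, where \<open>dirP\<close> vanishes: it
  gains 1 / sqrt \<tau>, the source of smallness in eps, for a factor r that the later division by r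
  removes.\<close>

lemma dirP_bounds:
  assumes F: "lin_growth F A B" and t: "0 < \<tau>" and r: "1 \<le> r"
  shows "\<bar>dirP F \<tau> r\<bar> \<le> 3 * (A + B * r + 6 * B * sqrt \<tau>)"
    "\<bar>dirP1 F \<tau> r\<bar> \<le> (4 / sqrt \<tau>) * (A + B * r + 6 * B * sqrt \<tau>)"
    "\<bar>dirP F \<tau> r\<bar> \<le> (4 / sqrt \<tau>) * (A + B * r + 6 * B * sqrt \<tau>) * r"
proof -
  have AB: "0 \<le> A" "0 \<le> B" using F by (auto simp: lin_growth_def)
  have b0: "\<bar>heat_conv heatk F \<tau> y\<bar> \<le> 3 / 2 * (A + B * r + 6 * B * sqrt \<tau>)" if "\<bar>y\<bar> \<le> r" for y
  proof -
    have "\<bar>heat_conv heatk F \<tau> y\<bar> \<le> 3 / 2 * (A + B * \<bar>y\<bar> + 6 * B * sqrt \<tau>)"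
      by (rule heat_conv_bound(2)[where k=heatk and \<tau>=\<tau>, OF F t gauss_dom_cont[OF gauss_dom_heatk(1) t]])
        (use heatk_bounds(1)[OF t] heatk_nonneg[of \<tau>] t in auto)
    also have "\<dots> \<le> 3 / 2 * (A + B * r + 6 * B * sqrt \<tau>)"
      using that AB by (intro mult_left_mono add_mono) auto
    finally show ?thesis .
  qed
  have b1: "\<bar>heat_conv heatk1 F \<tau> y\<bar> \<le> 2 / sqrt \<tau> * (A + B * r + 6 * B * sqrt \<tau>)" if "\<bar>y\<bar> \<le> r" for y r
  proof -
    have "\<bar>heat_conv heatk1 F \<tau> y\<bar> \<le> 2 / sqrt \<tau> * (A + B * \<bar>y\<bar> + 6 * B * sqrt \<tau>)"
      by (rule heat_conv_bound(2)[where k=heatk1 and \<tau>=\<tau>, OF F t gauss_dom_cont[OF gauss_dom_heatk(2) t] heatk_bounds(5)[OF t]])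
    also have "\<dots> \<le> 2 / sqrt \<tau> * (A + B * r + 6 * B * sqrt \<tau>)"
      using that AB t by (intro mult_left_mono add_mono) auto
    finally show ?thesis .
  qed
  show "\<bar>dirP F \<tau> r\<bar> \<le> 3 * (A + B * r + 6 * B * sqrt \<tau>)"
    using b0[of r] b0[of "2 - r"] r unfolding dirP_def by linarith
  have P1: "\<bar>dirP1 F \<tau> y\<bar> \<le> (4 / sqrt \<tau>) * (A + B * r + 6 * B * sqrt \<tau>)" if "1 \<le> y" "y \<le> r" for y
  proof -
    have "\<bar>dirP1 F \<tau> y\<bar> \<le> \<bar>heat_conv heatk1 F \<tau> y\<bar> + \<bar>heat_conv heatk1 F \<tau> (2 - y)\<bar>"
      unfolding dirP1_def by (rule abs_triangle_ineq)
    also have "\<dots> \<le> 2 / sqrt \<tau> * (A + B * r + 6 * B * sqrt \<tau>) + 2 / sqrt \<tau> * (A + B * r + 6 * B * sqrt \<tau>)"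
      by (intro add_mono b1) (use that in auto)
    also have "\<dots> = (4 / sqrt \<tau>) * (A + B * r + 6 * B * sqrt \<tau>)" by simp
    finally show ?thesis .
  qed
  then show "\<bar>dirP1 F \<tau> r\<bar> \<le> (4 / sqrt \<tau>) * (A + B * r + 6 * B * sqrt \<tau>)" using r by simp
  have nn: "0 \<le> (4 / sqrt \<tau>) * (A + B * r + 6 * B * sqrt \<tau>)" using AB t r by simp
  have "norm (dirP F \<tau> r - dirP F \<tau> 1) \<le> (4 / sqrt \<tau>) * (A + B * r + 6 * B * sqrt \<tau>) * norm (r - 1)"
    by (rule field_differentiable_bound[of "{1..r}" _ "dirP1 F \<tau>"])
      (use r P1 in \<open>auto intro!: has_field_derivative_at_within dirP_derivs(1)[OF F t]\<close>)
  also have "\<dots> \<le> (4 / sqrt \<tau>) * (A + B * r + 6 * B * sqrt \<tau>) * r"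
    using r by (intro mult_left_mono nn) auto
  finally show "\<bar>dirP F \<tau> r\<bar> \<le> (4 / sqrt \<tau>) * (A + B * r + 6 * B * sqrt \<tau>) * r" by simp
qed

text \<open>Multiplying the profile 1 / r of \<open>w\<close> and of the source by r gives the
  constant 1 on the half-line, extended by 0.\<close>

definition ind1 :: "real \<Rightarrow> real" where "ind1 = indicator {1<..}"

lemma lin_growth_ind1: "lin_growth ind1 1 0"
  unfolding lin_growth_def ind1_def
  by (intro conjI borel_measurable_indicator) (auto simp: indicator_def)

text \<open>\<open>erfk \<tau> r\<close> is the error function of \<open>(r - 1) / (2 * sqrt \<tau>)\<close>.\<close>

definition erfk :: "real \<Rightarrow> real \<Rightarrow> real" where "erfk = dirP ind1"

lemma heatk_le: assumes "0 < \<tau>" shows "heatk \<tau> z \<le> 1 / sqrt (4 * pi * \<tau>)"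
proof -
  have "exp (- (z\<^sup>2 / (4 * \<tau>))) \<le> 1" using assms by simp
  then show ?thesis unfolding heatk_def using assms by (intro divide_right_mono) auto
qed

lemma heatk_le_inverse_sqrt: assumes "0 < \<tau>" shows "heatk \<tau> z \<le> 1 / sqrt \<tau>"
proof -
  have "1 \<le> 4 * pi" using pi_gt3 by linarith
  then have "sqrt \<tau> \<le> sqrt (4 * pi * \<tau>)" using assms by simp
  then have "1 / sqrt (4 * pi * \<tau>) \<le> 1 / sqrt \<tau>" using assms by (intro divide_left_mono) auto
  with heatk_le[OF assms, of z] show ?thesis by linarith
qed

text \<open>A Markov type estimate with the fourth moment. The resulting \<tau>^2 is strong enough
  to leave a factor \<tau> after the loss of 1 / sqrt \<tau> from a derivative and of another 1 /
  sqrt \<tau> from the size of the kernel.\<close>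

lemma heatk_tail:
  assumes t: "0 < \<tau>" and x: "0 < x" "x \<le> \<bar>z\<bar>"
  shows "heatk \<tau> z \<le> 192 * \<tau>\<^sup>2 / x ^ 4 * heatk (2 * \<tau>) z"
proof -
  have "x ^ 4 \<le> \<bar>z\<bar> ^ 4" using x by (intro power_mono) auto
  then have "x ^ 4 * heatk \<tau> z \<le> z ^ 4 * heatk \<tau> z" using heatk_nonneg[of \<tau> z] t by (intro mult_right_mono) auto
  also have "\<dots> \<le> 192 * \<tau>\<^sup>2 * heatk (2 * \<tau>) z" by (rule heatk_bounds(4)[OF t])
  finally show ?thesis using x by (simp add: pos_le_divide_eq mult.commute)
qed

text \<open>As a function of \<rho>, the integrand has the primitive - heatk \<tau> (r - \<rho>),
  which vanishes at infinity; only the boundary value at \<rho> = 1 remains.\<close>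

lemma heat_conv_heatk1_ind1:
  assumes t: "0 < \<tau>" shows "heat_conv heatk1 ind1 \<tau> r = heatk \<tau> (r - 1)"
proof -
  let ?f = "\<lambda>\<rho>. heatk1 \<tau> (r - \<rho>)" and ?F = "\<lambda>\<rho>. - heatk \<tau> (r - \<rho>)"
  have e: "einterval 1 \<infinity> = {1<..}" by (auto simp: einterval_def one_ereal_def)
  have cf: "continuous_on UNIV ?f"
    by (intro continuous_on_compose2[OF gauss_dom_cont[OF gauss_dom_heatk(2) t]] continuous_intros) auto
  have fm: "?f \<in> borel_measurable borel" using cf by (rule borel_measurable_continuous_onI)
  have i: "integrable lebesgue (\<lambda>\<rho>. ?f \<rho> * ind1 \<rho>)"
    by (rule gauss_dom_integrable[OF gauss_dom_heatk(2) lin_growth_ind1 t])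
  have m: "(\<lambda>\<rho>. ?f \<rho> * ind1 \<rho>) \<in> borel_measurable lborel" using fm by (auto simp: ind1_def)
  have si: "set_integrable lborel (einterval 1 \<infinity>) ?f"
    unfolding set_integrable_def e using i m by (simp add: integrable_completion ind1_def mult.commute)
  have "(LBINT \<rho>=1..\<infinity>. ?f \<rho>) = 0 - (- heatk \<tau> (r - 1))"
  proof (rule interval_integral_FTC_integrable[OF _ _ _ si])
    fix \<rho> :: real
    have "(?F has_real_derivative - (heatk1 \<tau> (r - \<rho>) * (- 1))) (at \<rho>)"
      by (intro DERIV_minus DERIV_chain2[OF heatk_deriv[OF t]]) (auto intro!: derivative_eq_intros)
    then show "(?F has_vector_derivative ?f \<rho>) (at \<rho>)" by (simp add: has_real_derivative_iff_has_vector_derivative)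
    show "isCont ?f \<rho>" using cf by (simp add: continuous_on_eq_continuous_at)
  next
    have "continuous_on UNIV ?F"
      by (intro continuous_intros continuous_on_compose2[OF gauss_dom_cont[OF gauss_dom_heatk(1) t]]) auto
    then have c: "isCont ?F 1" by (simp add: continuous_on_eq_continuous_at)
    show "((?F \<circ> real_of_ereal) \<longlongrightarrow> - heatk \<tau> (r - 1)) (at_right 1)"
      using c unfolding one_ereal_def ereal_tendsto_simps1 isCont_def filterlim_at_split by blast
    have lim: "((\<lambda>\<rho>. 192 * \<tau>\<^sup>2 / \<bar>r - \<rho>\<bar> ^ 4 * (1 / sqrt (2 * \<tau>))) \<longlongrightarrow> 0) at_top"
    proof -
      have "filterlim (\<lambda>\<rho>::real. \<rho> - r) at_top at_top"
        using filterlim_tendsto_add_at_top[OF tendsto_const[of "- r"] filterlim_ident] by (simp add: add.commute)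
      then have "filterlim (\<lambda>\<rho>::real. \<bar>r - \<rho>\<bar>) at_top at_top"
        by (rule filterlim_at_top_mono) (auto intro: always_eventually)
      then have "filterlim (\<lambda>\<rho>::real. \<bar>r - \<rho>\<bar> ^ 4) at_top at_top" by (intro filterlim_pow_at_top) auto
      then have "((\<lambda>\<rho>. 192 * \<tau>\<^sup>2 / \<bar>r - \<rho>\<bar> ^ 4) \<longlongrightarrow> 0) at_top"
        by (intro tendsto_divide_0[OF tendsto_const] filterlim_at_top_imp_at_infinity)
      then show ?thesis by (intro tendsto_mult_left_zero)
    qed
    have "((\<lambda>\<rho>. heatk \<tau> (r - \<rho>)) \<longlongrightarrow> 0) at_top"
    proof (rule tendsto_sandwich[OF _ _ tendsto_const lim])
      show "\<forall>\<^sub>F \<rho> in at_top. heatk \<tau> (r - \<rho>) \<le> 192 * \<tau>\<^sup>2 / \<bar>r - \<rho>\<bar> ^ 4 * (1 / sqrt (2 * \<tau>))"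
        using eventually_gt_at_top[of r]
      proof eventually_elim
        case (elim \<rho>)
        have "heatk \<tau> (r - \<rho>) \<le> 192 * \<tau>\<^sup>2 / \<bar>r - \<rho>\<bar> ^ 4 * heatk (2 * \<tau>) (r - \<rho>)"
          using elim t by (intro heatk_tail) auto
        also have "\<dots> \<le> 192 * \<tau>\<^sup>2 / \<bar>r - \<rho>\<bar> ^ 4 * (1 / sqrt (2 * \<tau>))"
          using t by (intro mult_left_mono heatk_le_inverse_sqrt) auto
        finally show ?case .
      qed
    qed (use t in \<open>auto intro!: always_eventually heatk_nonneg\<close>)
    then have "(?F \<longlongrightarrow> - 0) at_top" by (rule tendsto_minus)
    then show "((?F \<circ> real_of_ereal) \<longlongrightarrow> 0) (at_left \<infinity>)"
      unfolding ereal_tendsto_simps1 by simp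
  qed auto
  moreover have "heat_conv heatk1 ind1 \<tau> r = (LBINT \<rho>=1..\<infinity>. ?f \<rho>)"
    unfolding heat_conv_def integral_completion[OF m]
    by (simp add: interval_lebesgue_integral_def e set_lebesgue_integral_def ind1_def mult.commute)
  ultimately show ?thesis by simp
qed

text \<open>By evenness the direct and the reflected terms of \<open>dirP1 ind1\<close> agree, hence
  the factor 2. The time derivative is \<open>dirP2 ind1\<close>, which is identified by
  differentiating this explicit formula once more in r.\<close>

lemma erfk_derivs:
  assumes t: "0 < \<tau>"
  shows "(erfk \<tau> has_real_derivative 2 * heatk \<tau> (r - 1)) (at r)"
    "((\<lambda>\<tau>. erfk \<tau> r) has_real_derivative 2 * heatk1 \<tau> (r - 1)) (at \<tau>)"
proof -
  have e1: "dirP1 ind1 \<tau> x = 2 * heatk \<tau> (x - 1)" for x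
    using heatk_minus[of \<tau> "x - 1"] by (simp add: dirP1_def heat_conv_heatk1_ind1[OF t])
  show "(erfk \<tau> has_real_derivative 2 * heatk \<tau> (r - 1)) (at r)"
    using dirP_derivs(1)[OF lin_growth_ind1 t] by (simp add: erfk_def e1)
  have "((\<lambda>x. 2 * heatk \<tau> (x - 1)) has_real_derivative 2 * (heatk1 \<tau> (r - 1) * 1)) (at r)"
    by (intro DERIV_cmult DERIV_chain2[OF heatk_deriv[OF t]]) (auto intro!: derivative_eq_intros)
  moreover have "((\<lambda>x. 2 * heatk \<tau> (x - 1)) has_real_derivative dirP2 ind1 \<tau> r) (at r)"
    using dirP_derivs(2)[OF lin_growth_ind1 t] by (simp add: e1[abs_def])
  ultimately have "dirP2 ind1 \<tau> r = 2 * heatk1 \<tau> (r - 1)" using DERIV_unique by fastforce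
  then show "((\<lambda>\<tau>. erfk \<tau> r) has_real_derivative 2 * heatk1 \<tau> (r - 1)) (at \<tau>)"
    using dirP_derivs(3)[OF lin_growth_ind1 t, of r] by (simp add: erfk_def)
qed

lemma erfk_continuous: "continuous_on ({0<..} \<times> UNIV) (\<lambda>(\<tau>, r). erfk \<tau> r)"
  using dirP_continuous(1)[OF lin_growth_ind1] by (simp add: erfk_def)

lemma erfk_at_1 [simp]: "erfk \<tau> 1 = 0"
  by (simp add: erfk_def)

lemma erfk_lipschitz: assumes t: "0 < \<tau>" shows "\<bar>erfk \<tau> r\<bar> \<le> \<bar>r - 1\<bar> / sqrt (pi * \<tau>)"
proof -
  have "norm (erfk \<tau> r - erfk \<tau> 1) \<le> (1 / sqrt (pi * \<tau>)) * norm (r - 1)"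
  proof (rule field_differentiable_bound[of UNIV _ "\<lambda>r. 2 * heatk \<tau> (r - 1)"])
    fix z :: real
    have "2 * heatk \<tau> (z - 1) \<le> 2 * (1 / sqrt (4 * pi * \<tau>))" by (intro mult_left_mono heatk_le[OF t]) auto
    also have "\<dots> = 1 / sqrt (pi * \<tau>)" by (simp add: real_sqrt_mult)
    finally show "norm (2 * heatk \<tau> (z - 1)) \<le> 1 / sqrt (pi * \<tau>)" using heatk_nonneg[of \<tau> "z - 1"] t by simp
  qed (use erfk_derivs(1)[OF t] in auto)
  then show ?thesis by simp
qed

text \<open>Monotonicity in r from the value 0 at r = 1 gives the lower bound and total mass 1 the
  upper one. For r > 1 the defect from 1 consists of two tails at distance at least r - 1 from the
  centre, each at most 192 * \<tau>^2 / (r - 1)^4.\<close>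

lemma erfk_range:
  assumes t: "0 < \<tau>" and r: "1 \<le> r"
  shows "0 \<le> erfk \<tau> r" "erfk \<tau> r \<le> 1" "1 < r \<Longrightarrow> 1 - erfk \<tau> r \<le> 384 * \<tau>\<^sup>2 / (r - 1) ^ 4"
proof -
  show "0 \<le> erfk \<tau> r"
    using DERIV_nonneg_imp_nondecreasing[OF r, of "erfk \<tau>"] erfk_derivs(1)[OF t] heatk_nonneg[of \<tau>] t by fastforce
  have i: "integrable lebesgue (\<lambda>\<rho>. heatk \<tau> (y - \<rho>) * ind1 \<rho>)" for y
    by (rule gauss_dom_integrable[OF gauss_dom_heatk(1) lin_growth_ind1 t])
  have nn: "0 \<le> heat_conv heatk ind1 \<tau> y" for y
    unfolding heat_conv_def using t by (intro Bochner_Integration.integral_nonneg) (auto simp: ind1_def heatk_nonneg)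
  have "heat_conv heatk ind1 \<tau> r \<le> (LINT \<rho>|lebesgue. heatk \<tau> (r - \<rho>))"
    unfolding heat_conv_def using i heatk_integral[OF t]
    by (intro integral_mono) (use t in \<open>auto simp: ind1_def indicator_def heatk_nonneg\<close>)
  then show "erfk \<tau> r \<le> 1" using nn[of "2 - r"] by (simp add: erfk_def dirP_def heatk_integral[OF t])
  assume r1: "1 < r"
  let ?x = "r - 1" and ?C = "192 * \<tau>\<^sup>2 / (r - 1) ^ 4"
  have a: "1 - heat_conv heatk ind1 \<tau> r \<le> ?C"
  proof -
    have "1 - heat_conv heatk ind1 \<tau> r = (LINT \<rho>|lebesgue. heatk \<tau> (r - \<rho>) - heatk \<tau> (r - \<rho>) * ind1 \<rho>)"
      unfolding heat_conv_def using i heatk_integral[OF t] by simp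
    also have "\<dots> \<le> (LINT \<rho>|lebesgue. ?C * heatk (2 * \<tau>) (r - \<rho>))"
    proof (intro integral_mono)
      fix \<rho>
      show "heatk \<tau> (r - \<rho>) - heatk \<tau> (r - \<rho>) * ind1 \<rho> \<le> ?C * heatk (2 * \<tau>) (r - \<rho>)"
      proof (cases "1 < \<rho>")
        case False
        then show ?thesis using heatk_tail[OF t, of ?x "r - \<rho>"] r1 by (simp add: ind1_def)
      next
        case True
        then show ?thesis using heatk_nonneg[of "2 * \<tau>"] t r1 by (simp add: ind1_def)
      qed
    qed (use i heatk_integral t in auto)
    also have "\<dots> = ?C" using t by (simp add: heatk_integral)
    finally show ?thesis .
  qed
  have b: "heat_conv heatk ind1 \<tau> (2 - r) \<le> ?C"
  proof -
    have "heat_conv heatk ind1 \<tau> (2 - r) \<le> (LINT \<rho>|lebesgue. ?C * heatk (2 * \<tau>) (2 - r - \<rho>))"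
      unfolding heat_conv_def
    proof (intro integral_mono)
      fix \<rho>
      show "heatk \<tau> (2 - r - \<rho>) * ind1 \<rho> \<le> ?C * heatk (2 * \<tau>) (2 - r - \<rho>)"
      proof (cases "1 < \<rho>")
        case True
        then show ?thesis using heatk_tail[OF t, of ?x "2 - r - \<rho>"] r1 by (simp add: ind1_def)
      next
        case False
        then show ?thesis using heatk_nonneg[of "2 * \<tau>"] t r1 by (simp add: ind1_def)
      qed
    qed (use i heatk_integral t in auto)
    also have "\<dots> = ?C" using t by (simp add: heatk_integral)
    finally show ?thesis .
  qed
  show "1 - erfk \<tau> r \<le> 384 * \<tau>\<^sup>2 / (r - 1) ^ 4" using a b by (simp add: erfk_def dirP_def)
qed

section \<open>The complementary error kernel\<close>

text \<open>
  For \<open>r > 1\<close> the complementary error kernel and its derivatives vanish to first order at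
  \<open>\<tau> = 0\<close>, so after extension by 0 the time convolution has no moving singular endpoint.
\<close>

definition ec0 :: "real \<Rightarrow> real \<Rightarrow> real" where "ec0 \<tau> r = (if \<tau> \<le> 0 then 0 else 1 - erfk \<tau> r)"
definition ec1 :: "real \<Rightarrow> real \<Rightarrow> real" where "ec1 \<tau> r = (if \<tau> \<le> 0 then 0 else - 2 * heatk \<tau> (r - 1))"
definition ec2 :: "real \<Rightarrow> real \<Rightarrow> real" where "ec2 \<tau> r = (if \<tau> \<le> 0 then 0 else - 2 * heatk1 \<tau> (r - 1))"

text \<open>One bound for all three kernels: their orders \<tau>^2, \<tau>^(3/2) and \<tau> are all
  covered by \<tau> + \<tau>^2, and 3072 = 2 * 1536 is the constant that \<open>ec2\<close>
  requires.\<close>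

definition ext_kernel :: "(real \<Rightarrow> real \<Rightarrow> real) \<Rightarrow> bool" where
  "ext_kernel k \<longleftrightarrow> (\<forall>\<tau> r. \<tau> \<le> 0 \<longrightarrow> k \<tau> r = 0) \<and> continuous_on ({0<..} \<times> UNIV) (\<lambda>(\<tau>, r). k \<tau> r) \<and>
     (\<forall>\<tau> r. 0 < \<tau> \<longrightarrow> 1 < r \<longrightarrow> \<bar>k \<tau> r\<bar> \<le> 3072 * (\<tau> + \<tau>\<^sup>2) / (r - 1) ^ 4)"

lemma shifted_kernel_continuous:
  assumes "continuous_on ({0<..} \<times> UNIV) (\<lambda>(\<tau>, z). k \<tau> z)"
  shows "continuous_on ({0<..} \<times> UNIV) (\<lambda>(\<tau>::real, r::real). k \<tau> (r - 1))"
proof -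
  have "continuous_on ({0<..} \<times> UNIV) (\<lambda>p. (\<lambda>(\<tau>, z). k \<tau> z) (fst p, snd p - 1))"
    by (intro continuous_intros continuous_on_compose2[OF assms]) auto
  then show ?thesis by (simp add: case_prod_beta')
qed

lemma ext_kernel_ec: "ext_kernel ec0" "ext_kernel ec1" "ext_kernel ec2"
proof -
  have cont: "continuous_on ({0<..} \<times> UNIV) (\<lambda>(\<tau>, r). if \<tau> \<le> 0 then 0 else k \<tau> r)"
    if "continuous_on ({0<..} \<times> UNIV) (\<lambda>(\<tau>, r). k \<tau> r)" for k :: "real \<Rightarrow> real \<Rightarrow> real"
    by (rule continuous_on_eq[OF that]) auto
  have K: "c / (r - 1) ^ 4 \<le> 3072 * (\<tau> + \<tau>\<^sup>2) / (r - 1) ^ 4" if "c \<le> 3072 * (\<tau> + \<tau>\<^sup>2)" for c r \<tau> :: real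
    using that by (intro divide_right_mono) auto
  show "ext_kernel ec0"
    unfolding ext_kernel_def
  proof (intro conjI allI impI)
    show "continuous_on ({0<..} \<times> UNIV) (\<lambda>(\<tau>, r). ec0 \<tau> r)"
      unfolding ec0_def using erfk_continuous by (intro cont) (auto simp: case_prod_beta' intro!: continuous_intros)
    fix \<tau> r :: real assume t: "0 < \<tau>" and r: "1 < r"
    have "\<bar>ec0 \<tau> r\<bar> \<le> 384 * \<tau>\<^sup>2 / (r - 1) ^ 4"
      using erfk_range[OF t, of r] r t by (simp add: ec0_def)
    also have "\<dots> \<le> 3072 * (\<tau> + \<tau>\<^sup>2) / (r - 1) ^ 4" using t by (intro K) (simp add: algebra_simps)
    finally show "\<bar>ec0 \<tau> r\<bar> \<le> 3072 * (\<tau> + \<tau>\<^sup>2) / (r - 1) ^ 4" .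
  qed (simp add: ec0_def)
  show "ext_kernel ec1"
    unfolding ext_kernel_def
  proof (intro conjI allI impI)
    show "continuous_on ({0<..} \<times> UNIV) (\<lambda>(\<tau>, r). ec1 \<tau> r)"
      unfolding ec1_def using shifted_kernel_continuous[OF heatk_continuous(1)]
      by (intro cont) (auto simp: case_prod_beta' intro!: continuous_intros)
    fix \<tau> r :: real assume t: "0 < \<tau>" and r: "1 < r"
    have "heatk \<tau> (r - 1) \<le> 192 * \<tau>\<^sup>2 / (r - 1) ^ 4 * heatk (2 * \<tau>) (r - 1)" using t r by (intro heatk_tail) auto
    also have "\<dots> \<le> 192 * \<tau>\<^sup>2 / (r - 1) ^ 4 * (1 / sqrt \<tau>)"
    proof (intro mult_left_mono)
      have "heatk (2 * \<tau>) (r - 1) \<le> 1 / sqrt (2 * \<tau>)" using t by (intro heatk_le_inverse_sqrt) auto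
      also have "\<dots> \<le> 1 / sqrt \<tau>" using t by (intro divide_left_mono) auto
      finally show "heatk (2 * \<tau>) (r - 1) \<le> 1 / sqrt \<tau>" .
    qed simp
    also have "\<dots> = (192 * (\<tau> * sqrt \<tau>)) / (r - 1) ^ 4"
    proof -
      have "192 * (s * s)\<^sup>2 / d * (1 / s) = (192 * ((s * s) * s)) / d" if "0 < s" for s d :: real
        using that by (simp add: power2_eq_square)
      from this[of "sqrt \<tau>" "(r - 1) ^ 4"] show ?thesis using t by simp
    qed
    finally have 1: "heatk \<tau> (r - 1) \<le> (192 * (\<tau> * sqrt \<tau>)) / (r - 1) ^ 4" .
    have "sqrt \<tau> \<le> 1 + \<tau>" using t by (intro sqrt_le_one_plus) simp
    then have "\<tau> * sqrt \<tau> \<le> \<tau> + \<tau>\<^sup>2" using mult_left_mono[of "sqrt \<tau>" "1 + \<tau>" \<tau>] t by (simp add: algebra_simps power2_eq_square)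
    moreover have "0 \<le> \<tau> * sqrt \<tau>" using t by simp
    moreover have "384 * q \<le> 3072 * p" if "q \<le> p" "0 \<le> q" for p q :: real using that by linarith
    ultimately have "384 * (\<tau> * sqrt \<tau>) \<le> 3072 * (\<tau> + \<tau>\<^sup>2)" by blast
    from K[OF this] have "(384 * (\<tau> * sqrt \<tau>)) / (r - 1) ^ 4 \<le> 3072 * (\<tau> + \<tau>\<^sup>2) / (r - 1) ^ 4" .
    moreover have "\<bar>ec1 \<tau> r\<bar> = 2 * heatk \<tau> (r - 1)" using t heatk_nonneg[of \<tau> "r - 1"] by (simp add: ec1_def)
    ultimately show "\<bar>ec1 \<tau> r\<bar> \<le> 3072 * (\<tau> + \<tau>\<^sup>2) / (r - 1) ^ 4" using 1 by simp
  qed (simp add: ec1_def)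
  show "ext_kernel ec2"
    unfolding ext_kernel_def
  proof (intro conjI allI impI)
    show "continuous_on ({0<..} \<times> UNIV) (\<lambda>(\<tau>, r). ec2 \<tau> r)"
      unfolding ec2_def using shifted_kernel_continuous[OF heatk_continuous(2)]
      by (intro cont) (auto simp: case_prod_beta' intro!: continuous_intros)
    fix \<tau> r :: real assume t: "0 < \<tau>" and r: "1 < r"
    have "\<bar>heatk1 \<tau> (r - 1)\<bar> \<le> (2 / sqrt \<tau>) * heatk (2 * \<tau>) (r - 1)" by (rule heatk_bounds(5)[OF t])
    also have "\<dots> \<le> (2 / sqrt \<tau>) * (192 * (2 * \<tau>)\<^sup>2 / (r - 1) ^ 4 * heatk (2 * (2 * \<tau>)) (r - 1))"
      using t r by (intro mult_left_mono heatk_tail) auto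
    also have "\<dots> \<le> (2 / sqrt \<tau>) * (192 * (2 * \<tau>)\<^sup>2 / (r - 1) ^ 4 * (1 / sqrt \<tau>))"
    proof (intro mult_left_mono)
      have "heatk (2 * (2 * \<tau>)) (r - 1) \<le> 1 / sqrt (2 * (2 * \<tau>))" using t by (intro heatk_le_inverse_sqrt) auto
      also have "\<dots> \<le> 1 / sqrt \<tau>" using t by (intro divide_left_mono) auto
      finally show "heatk (2 * (2 * \<tau>)) (r - 1) \<le> 1 / sqrt \<tau>" .
    qed (use t in auto)
    also have "\<dots> = 1536 * \<tau> / (r - 1) ^ 4"
    proof -
      have "(2 / s) * (192 * (2 * (s * s))\<^sup>2 / d * (1 / s)) = 1536 * (s * s) / d" if "0 < s" for s d :: real
        using that by (simp add: power2_eq_square)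
      from this[of "sqrt \<tau>" "(r - 1) ^ 4"] show ?thesis using t by simp
    qed
    finally have "\<bar>ec2 \<tau> r\<bar> \<le> (3072 * \<tau>) / (r - 1) ^ 4" using t by (simp add: ec2_def abs_mult)
    also have "\<dots> \<le> 3072 * (\<tau> + \<tau>\<^sup>2) / (r - 1) ^ 4" by (intro K) simp
    finally show "\<bar>ec2 \<tau> r\<bar> \<le> 3072 * (\<tau> + \<tau>\<^sup>2) / (r - 1) ^ 4" .
  qed (simp add: ec2_def)
qed

lemma ext_kernel_bound: 
  assumes "ext_kernel k" "1 < r" shows "\<bar>k \<tau> r\<bar> \<le> 3072 * (\<bar>\<tau>\<bar> + \<tau>\<^sup>2) / (r - 1) ^ 4"
proof (cases "\<tau> \<le> 0")
  case True
  then have "k \<tau> r = 0" using assms by (auto simp: ext_kernel_def)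
  then show ?thesis using assms by simp
next
  case False
  then have "\<bar>k \<tau> r\<bar> \<le> 3072 * (\<tau> + \<tau>\<^sup>2) / (r - 1) ^ 4" using assms unfolding ext_kernel_def by force
  then show ?thesis using False by simp
qed

text \<open>Only \<tau> = 0 is delicate; there the kernel is squeezed to 0 by its bound, uniformly
  for radii away from 1.\<close>

lemma ext_kernel_continuous:
  assumes k: "ext_kernel k" shows "continuous_on (UNIV \<times> {1<..}) (\<lambda>(\<tau>, r). k \<tau> r)"
proof -
  have "isCont (\<lambda>(\<tau>, r). k \<tau> r) p" if p: "p \<in> UNIV \<times> {1<..}" for p
  proof -
    obtain t r where tr: "p = (t, r)" "1 < r" using p by auto
    consider "0 < t" | "t < 0" | "t = 0" by linarith
    then show ?thesis
    proof cases
      case 1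
      have "open ({0::real<..} \<times> (UNIV :: real set))" by (intro open_Times) auto
      with k 1 tr show ?thesis unfolding ext_kernel_def
        by (auto simp: continuous_on_eq_continuous_at)
    next
      case 2
      have "open ({..<0::real} \<times> (UNIV :: real set))" by (intro open_Times) auto
      then have "\<forall>\<^sub>F q in nhds p. q \<in> {..<0::real} \<times> (UNIV :: real set)"
        using 2 tr by (intro eventually_nhds_in_open) auto
      then have "\<forall>\<^sub>F q in nhds p. (\<lambda>(\<tau>, r). k \<tau> r) q = 0"
        by eventually_elim (use k in \<open>auto simp: ext_kernel_def\<close>)
      from isCont_cong[OF this] show ?thesis by simp
    next
      case 3
      have k0: "(\<lambda>(\<tau>, r). k \<tau> r) p = 0" using k 3 tr by (auto simp: ext_kernel_def)
      have "((\<lambda>(\<tau>, r). k \<tau> r) \<longlongrightarrow> 0) (at p)"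
      proof (rule Lim_null_comparison)
        have "open ((UNIV :: real set) \<times> {1::real<..})" by (intro open_Times) auto
        then have "\<forall>\<^sub>F q in at p. q \<in> UNIV \<times> {1<..}" using p by (rule eventually_at_in_open')
        then show "\<forall>\<^sub>F q in at p. norm ((\<lambda>(\<tau>, r). k \<tau> r) q) \<le> 3072 * (\<bar>fst q\<bar> + (fst q)\<^sup>2) / (snd q - 1) ^ 4"
          by eventually_elim (use ext_kernel_bound[OF k] in auto)
        have "((\<lambda>q. 3072 * (\<bar>fst q\<bar> + (fst q)\<^sup>2) / (snd q - 1) ^ 4) \<longlongrightarrow> 3072 * (\<bar>fst p\<bar> + (fst p)\<^sup>2) / (snd p - 1) ^ 4) (at p)"
          using tr by (intro tendsto_intros) auto
        then show "((\<lambda>q. 3072 * (\<bar>fst q\<bar> + (fst q)\<^sup>2) / (snd q - 1) ^ 4) \<longlongrightarrow> 0) (at p)"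
          using tr 3 by simp
      qed
      then show ?thesis unfolding isCont_def k0 .
    qed
  qed
  then show ?thesis by (blast intro: continuous_at_imp_continuous_on)
qed

lemma ec_derivs:
  shows "(ec0 \<tau> has_real_derivative ec1 \<tau> r) (at r)"
    "(ec1 \<tau> has_real_derivative ec2 \<tau> r) (at r)"
    "1 < r \<Longrightarrow> ((\<lambda>\<tau>. ec0 \<tau> r) has_real_derivative ec2 \<tau> r) (at \<tau>)"
proof -
  have 1: "((\<lambda>r. 1 - erfk \<tau> r) has_real_derivative - 2 * heatk \<tau> (r - 1)) (at r)" if "0 < \<tau>"
    using DERIV_diff[OF DERIV_const erfk_derivs(1)[OF that]] by simp
  show "(ec0 \<tau> has_real_derivative ec1 \<tau> r) (at r)"
    using 1 unfolding ec0_def[abs_def] ec1_def by (cases "\<tau> \<le> 0") auto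
  have 2: "((\<lambda>r. - 2 * heatk \<tau> (r - 1)) has_real_derivative - 2 * (heatk1 \<tau> (r - 1) * 1)) (at r)" if "0 < \<tau>"
    by (intro DERIV_cmult DERIV_chain2[OF heatk_deriv[OF that]]) (auto intro!: derivative_eq_intros)
  then show "(ec1 \<tau> has_real_derivative ec2 \<tau> r) (at r)"
    unfolding ec1_def[abs_def] ec2_def by (cases "\<tau> \<le> 0") auto
  assume r: "1 < r"
  consider "0 < \<tau>" | "\<tau> < 0" | "\<tau> = 0" by linarith
  then show "((\<lambda>\<tau>. ec0 \<tau> r) has_real_derivative ec2 \<tau> r) (at \<tau>)"
  proof cases
    case 1
    have "((\<lambda>\<tau>. 1 - erfk \<tau> r) has_real_derivative ec2 \<tau> r) (at \<tau>)"
      using DERIV_diff[OF DERIV_const erfk_derivs(2)[OF 1, of r]] 1 by (simp add: ec2_def)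
    then show ?thesis
    proof (rule has_field_derivative_transform_within_open)
      show "open {0::real<..}" "\<tau> \<in> {0<..}" using 1 by auto
    qed (auto simp: ec0_def)
  next
    case 2
    have "((\<lambda>\<tau>. 0) has_real_derivative ec2 \<tau> r) (at \<tau>)" using 2 by (simp add: ec2_def)
    then show ?thesis
    proof (rule has_field_derivative_transform_within_open)
      show "open {..<0::real}" "\<tau> \<in> {..<0}" using 2 by auto
    qed (auto simp: ec0_def)
  next
    case 3
    \<comment> \<open>At \<tau> = 0 continuity of \<open>ec0\<close> would not suffice: the
      quadratic tail bound makes the difference quotient O(|h|).\<close>
    have "((\<lambda>h. (ec0 h r - ec0 0 r) / (h - 0)) \<longlongrightarrow> 0) (at 0)"
    proof (rule Lim_null_comparison)
      have "\<bar>ec0 h r\<bar> \<le> 384 / (r - 1) ^ 4 * \<bar>h\<bar> * \<bar>h\<bar>" for h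
        using erfk_range[of h r] r by (auto simp: ec0_def power2_eq_square)
      then have "\<bar>ec0 h r / h\<bar> \<le> 384 / (r - 1) ^ 4 * \<bar>h\<bar>" for h
        by (cases "h = 0") (auto simp: abs_divide pos_divide_le_eq)
      then show "\<forall>\<^sub>F h in at 0. norm ((ec0 h r - ec0 0 r) / (h - 0)) \<le> 384 / (r - 1) ^ 4 * \<bar>h\<bar>"
        by (intro always_eventually) (auto simp: ec0_def)
      have "((\<lambda>h. 384 / (r - 1) ^ 4 * \<bar>h\<bar>) \<longlongrightarrow> 384 / (r - 1) ^ 4 * \<bar>0\<bar>) (at 0)" by (intro tendsto_intros)
      then show "((\<lambda>h. 384 / (r - 1) ^ 4 * \<bar>h\<bar>) \<longlongrightarrow> 0) (at 0)" by simp
    qed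
    then show ?thesis using 3 by (simp add: has_field_derivative_iff ec2_def)
  qed
qed

text \<open>The time convolution over a fixed horizon T: the zero extension of the kernel removes
  all s >= t, so the domain of integration no longer depends on t and differentiation in t is
  possible under the integral.\<close>

definition zint :: "real \<Rightarrow> (real \<Rightarrow> real \<Rightarrow> real) \<Rightarrow> (real \<Rightarrow> real) \<Rightarrow> real \<Rightarrow> real \<Rightarrow> real \<Rightarrow> real" where
  "zint \<epsilon> k h T t r = (LINT s|lebesgue. indicator {0<..<T} s * (h s * k ((t - s) / \<epsilon>) r))"

lemma zint_eq_conv:
  assumes k: "ext_kernel k" and e: "0 < \<epsilon>" and t: "t \<le> T"
  shows "zint \<epsilon> k h T t r = conv (\<lambda>u. k (u / \<epsilon>) r) h t"
  unfolding zint_def conv_def set_lebesgue_integral_def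
proof (intro Bochner_Integration.integral_cong refl)
  fix s
  have "k ((t - s) / \<epsilon>) r = 0" if "t \<le> s" using k that e by (auto simp: ext_kernel_def divide_nonpos_pos)
  then show "indicator {0<..<T} s * (h s * k ((t - s) / \<epsilon>) r) = indicator {0<..<t} s *\<^sub>R (h s * k ((t - s) / \<epsilon>) r)"
    using t by (auto simp: indicator_def)
qed

text \<open>Radii stay at distance \<open>\<delta>\<close> from 1, so the kernel is uniformly
  bounded and the only singularity left is that of \<open>h\<close> at s = 0.\<close>

lemma zint_majorant:
  assumes k: "ext_kernel k" and h: "sqrt_sing h" and e: "0 < \<epsilon>" and d: "0 < \<delta>" and T: "0 < T"
  obtains D where "integrable lebesgue D"
    "\<And>t r s. t \<le> T \<Longrightarrow> 1 + \<delta> \<le> r \<Longrightarrow> \<bar>indicator {0<..<T} s * (h s * k ((t - s) / \<epsilon>) r)\<bar> \<le> D s"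
proof -
  obtain H where H: "0 \<le> H" "\<And>s. 0 < s \<Longrightarrow> s < T \<Longrightarrow> \<bar>h s\<bar> \<le> H / sqrt s" using sqrt_singD[OF h T] by metis
  let ?K = "3072 * (T / \<epsilon> + (T / \<epsilon>)\<^sup>2) / \<delta> ^ 4"
  show thesis
  proof (rule that[of "\<lambda>s. indicator {0<..<T} s *\<^sub>R ((H * ?K) * (1 / sqrt s))"])
    show "integrable lebesgue (\<lambda>s. indicator {0<..<T} s *\<^sub>R ((H * ?K) * (1 / sqrt s)))"
      using set_integrable_mult_right[where a="H * ?K", OF set_integral_inverse_sqrt(1)[OF less_imp_le[OF T]]]
      unfolding set_integrable_def .
    fix t r s assume t: "t \<le> T" and r: "1 + \<delta> \<le> r"
    show "\<bar>indicator {0<..<T} s * (h s * k ((t - s) / \<epsilon>) r)\<bar> \<le> indicator {0<..<T} s *\<^sub>R ((H * ?K) * (1 / sqrt s))"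
    proof (cases "s \<in> {0<..<T}")
      case True
      have "\<bar>k ((t - s) / \<epsilon>) r\<bar> \<le> ?K"
      proof (cases "t \<le> s")
        case True
        then have "k ((t - s) / \<epsilon>) r = 0" using k e by (auto simp: ext_kernel_def divide_nonpos_pos)
        then show ?thesis using d T e by simp
      next
        case False
        let ?\<tau> = "(t - s) / \<epsilon>"
        have tp: "0 < ?\<tau>" "?\<tau> \<le> T / \<epsilon>" using False e t True by (auto simp: divide_right_mono)
        have "\<bar>k ?\<tau> r\<bar> \<le> 3072 * (?\<tau> + ?\<tau>\<^sup>2) / (r - 1) ^ 4" using k tp r d unfolding ext_kernel_def by force
        also have "\<dots> \<le> ?K"
          using tp d r e T by (intro frac_le mult_left_mono add_mono power_mono) (auto intro!: divide_right_mono simp: divide_le_cancel)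
        finally show ?thesis .
      qed
      moreover have "\<bar>h s\<bar> \<le> H / sqrt s" using H True by auto
      ultimately have "\<bar>h s\<bar> * \<bar>k ((t - s) / \<epsilon>) r\<bar> \<le> (H / sqrt s) * ?K"
        using H(1) True by (intro mult_mono) auto
      then show ?thesis using True by (simp add: abs_mult mult_ac)
    qed auto
  qed
qed

lemma zint_measurable:
  assumes k: "ext_kernel k" and h: "sqrt_sing h" and e: "0 < \<epsilon>" and r: "1 < r"
  shows "(\<lambda>s. indicator {0<..<T} s * (h s * k ((t - s) / \<epsilon>) r)) \<in> borel_measurable lebesgue"
proof -
  have "continuous_on {0<..<T} (\<lambda>s. h s * (\<lambda>(\<tau>, r). k \<tau> r) ((t - s) / \<epsilon>, r))"
    using r e by (intro continuous_intros sqrt_sing_cont[OF h] continuous_on_compose2[OF ext_kernel_continuous[OF k]]) auto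
  from borel_measurable_continuous_on_indicator[OF _ this]
  have "(\<lambda>s. indicator {0<..<T} s * (h s * k ((t - s) / \<epsilon>) r)) \<in> borel_measurable borel" by simp
  then show ?thesis by (intro measurable_completion) simp
qed

lemma zint_integrable:
  assumes k: "ext_kernel k" and h: "sqrt_sing h" and e: "0 < \<epsilon>" and r: "1 < r" and T: "0 < T" "t \<le> T"
  shows "integrable lebesgue (\<lambda>s. indicator {0<..<T} s * (h s * k ((t - s) / \<epsilon>) r))"
proof -
  obtain D where "integrable lebesgue D"
    "\<And>t x s. t \<le> T \<Longrightarrow> 1 + (r - 1) \<le> x \<Longrightarrow> \<bar>indicator {0<..<T} s * (h s * k ((t - s) / \<epsilon>) x)\<bar> \<le> D s"
    using zint_majorant[OF k h e _ T(1), of "r - 1"] r by auto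
  then show ?thesis
    using T by (intro Bochner_Integration.integrable_bound[OF _ zint_measurable[OF k h e r]])
      (auto intro!: AE_I2 order_trans[OF _ abs_ge_self])
qed

lemma zint_continuous:
  assumes k: "ext_kernel k" and h: "sqrt_sing h" and e: "0 < \<epsilon>" and T: "0 < T"
  shows "continuous_on ({..<T} \<times> {1<..}) (\<lambda>(t, r). zint \<epsilon> k h T t r)"
proof -
  let ?f = "\<lambda>(t, r) s. indicator {0<..<T} s * (h s * k ((t - s) / \<epsilon>) r)"
  have "continuous_on ({..<T} \<times> {1<..}) (\<lambda>p. LINT s|lebesgue. ?f p s)"
  proof (rule continuous_on_integral_dominated)
    fix p assume "p \<in> {..<T} \<times> {1::real<..}"
    then obtain t r where p: "p = (t, r)" "t < T" "1 < r" by auto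
    show "?f p \<in> borel_measurable lebesgue" using zint_measurable[OF k h e p(3)] p by simp
    obtain D where D: "integrable lebesgue D"
      "\<And>t x s. t \<le> T \<Longrightarrow> 1 + (r - 1) / 2 \<le> x \<Longrightarrow> \<bar>indicator {0<..<T} s * (h s * k ((t - s) / \<epsilon>) x)\<bar> \<le> D s"
      using zint_majorant[OF k h e _ T, of "(r - 1) / 2"] p by auto
    show "\<exists>U D. open U \<and> p \<in> U \<and> integrable lebesgue D \<and> (\<forall>q\<in>({..<T} \<times> {1<..}) \<inter> U. \<forall>y\<in>space lebesgue. \<bar>?f q y\<bar> \<le> D y)"
    proof (intro exI conjI)
      show "open ({..<T} \<times> {1 + (r - 1) / 2<..})" by (intro open_Times) auto
      show "p \<in> {..<T} \<times> {1 + (r - 1) / 2<..}" using p by (auto simp: field_simps)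
    qed (use D in auto)
  next
    fix s :: real
    have "continuous_on ({..<T} \<times> {1<..}) (\<lambda>p. indicator {0<..<T} s * (h s * (\<lambda>(\<tau>, r). k \<tau> r) ((fst p - s) / \<epsilon>, snd p)))"
      using e by (intro continuous_intros continuous_on_compose2[OF ext_kernel_continuous[OF k]]) auto
    then show "continuous_on ({..<T} \<times> {1<..}) (\<lambda>p. ?f p s)" by (simp add: case_prod_beta')
  qed
  then show ?thesis by (simp add: zint_def case_prod_beta')
qed

definition zconv :: "real \<Rightarrow> (real \<Rightarrow> real \<Rightarrow> real) \<Rightarrow> (real \<Rightarrow> real) \<Rightarrow> real \<Rightarrow> real \<Rightarrow> real" where
  "zconv \<epsilon> k h t r = conv (\<lambda>u. k (u / \<epsilon>) r) h t"

lemma zconv_continuous: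
  assumes k: "ext_kernel k" and h: "sqrt_sing h" and e: "0 < \<epsilon>"
  shows "continuous_on ({0<..} \<times> {1<..}) (\<lambda>(t, r). zconv \<epsilon> k h t r)"
proof -
  have "isCont (\<lambda>(t, r). zconv \<epsilon> k h t r) p" if p: "p \<in> {0<..} \<times> {1<..}" for p
  proof -
    \<comment> \<open>The horizon lies beyond the time in question, so that \<open>zint\<close> and
      \<open>zconv\<close> agree on an open neighbourhood.\<close>
    let ?T = "fst p + 1" let ?S = "{0<..<?T} \<times> {1::real<..}"
    have T: "0 < ?T" using p by auto
    have "continuous_on ?S (\<lambda>(t, r). zint \<epsilon> k h ?T t r)"
      by (rule continuous_on_subset[OF zint_continuous[OF k h e T]]) auto
    then have "continuous_on ?S (\<lambda>(t, r). zconv \<epsilon> k h t r)"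
      by (rule continuous_on_eq) (auto simp: zconv_def zint_eq_conv[OF k e])
    moreover have "open ?S" by (intro open_Times) auto
    moreover have "p \<in> ?S" using p by auto
    ultimately show ?thesis by (metis continuous_on_eq_continuous_at)
  qed
  then show ?thesis by (blast intro: continuous_at_imp_continuous_on)
qed

lemma zconv_deriv:
  assumes k: "ext_kernel k" "ext_kernel k'" and h: "sqrt_sing h" and e: "0 < \<epsilon>" and t: "0 < t" and r: "1 < r"
    and der: "\<And>\<tau> r. (k \<tau> has_real_derivative k' \<tau> r) (at r)"
  shows "(zconv \<epsilon> k h t has_real_derivative zconv \<epsilon> k' h t r) (at r)"
proof -
  obtain D where D: "integrable lebesgue D"
    "\<And>u x s. u \<le> t \<Longrightarrow> 1 + (r - 1) / 2 \<le> x \<Longrightarrow> \<bar>indicator {0<..<t} s * (h s * k' ((u - s) / \<epsilon>) x)\<bar> \<le> D s"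
    using zint_majorant[OF k(2) h e _ t, of "(r - 1) / 2"] r by auto
  have "(zint \<epsilon> k h t t has_real_derivative zint \<epsilon> k' h t t r) (at r)"
    unfolding zint_def[abs_def]
  proof (rule has_real_derivative_integral_dominated[where a="1 + (r - 1) / 2" and b="r + 1" and D=D])
    show "integrable lebesgue (\<lambda>s. indicator {0<..<t} s * (h s * k ((t - s) / \<epsilon>) x))" if "x \<in> {1 + (r - 1) / 2<..<r + 1}" for x
      using that r t by (intro zint_integrable[OF k(1) h e]) (auto simp: field_simps)
    show "(\<lambda>s. indicator {0<..<t} s * (h s * k' ((t - s) / \<epsilon>) r)) \<in> borel_measurable lebesgue"
      by (rule zint_measurable[OF k(2) h e r])
    show "((\<lambda>r. indicator {0<..<t} s * (h s * k ((t - s) / \<epsilon>) r)) has_real_derivative indicator {0<..<t} s * (h s * k' ((t - s) / \<epsilon>) x)) (at x)" for s x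
      by (intro DERIV_cmult der)
    show "r \<in> {1 + (r - 1) / 2<..<r + 1}" using r by (auto simp: field_simps)
  qed (use D in auto)
  moreover have "zint \<epsilon> q h t t = zconv \<epsilon> q h t" if "ext_kernel q" for q
    by (rule ext) (simp add: zconv_def zint_eq_conv[OF that e])
  ultimately show ?thesis using k by simp
qed

text \<open>No boundary term at s = t appears because the extended kernel and its time derivative
  exist and vanish at \<tau> = 0. The factor 1 / \<epsilon> is the inner derivative of the rescaled
  time.\<close>

lemma zconv_deriv_time:
  assumes k: "ext_kernel k" "ext_kernel k'" and h: "sqrt_sing h" and e: "0 < \<epsilon>" and t: "0 < t" and r: "1 < r"
    and der: "\<And>\<tau>. ((\<lambda>\<tau>. k \<tau> r) has_real_derivative k' \<tau> r) (at \<tau>)"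
  shows "((\<lambda>t. zconv \<epsilon> k h t r) has_real_derivative zconv \<epsilon> k' h t r / \<epsilon>) (at t)"
proof -
  let ?T = "t + 1"
  have T: "0 < ?T" using t by simp
  obtain D where D: "integrable lebesgue D"
    "\<And>u x s. u \<le> ?T \<Longrightarrow> 1 + (r - 1) \<le> x \<Longrightarrow> \<bar>indicator {0<..<?T} s * (h s * k' ((u - s) / \<epsilon>) x)\<bar> \<le> D s"
    using zint_majorant[OF k(2) h e _ T, of "r - 1"] r by auto
  have "((\<lambda>u. zint \<epsilon> k h ?T u r) has_real_derivative (LINT s|lebesgue. indicator {0<..<?T} s * (h s * k' ((t - s) / \<epsilon>) r) / \<epsilon>)) (at t)"
    unfolding zint_def
  proof (rule has_real_derivative_integral_dominated[where a=0 and b="?T" and D="\<lambda>s. D s / \<epsilon>"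
        and f'="\<lambda>u s. indicator {0<..<?T} s * (h s * k' ((u - s) / \<epsilon>) r) / \<epsilon>"])
    fix u s
    have "((\<lambda>u. (u - s) / \<epsilon>) has_real_derivative 1 / \<epsilon>) (at u)" using e by (auto intro!: derivative_eq_intros)
    from DERIV_chain2[OF der this]
    have "((\<lambda>u. indicator {0<..<?T} s * (h s * k ((u - s) / \<epsilon>) r)) has_real_derivative
        indicator {0<..<?T} s * (h s * (k' ((u - s) / \<epsilon>) r * (1 / \<epsilon>)))) (at u)"
      by (intro DERIV_cmult)
    then show "((\<lambda>u. indicator {0<..<?T} s * (h s * k ((u - s) / \<epsilon>) r)) has_real_derivative
        indicator {0<..<?T} s * (h s * k' ((u - s) / \<epsilon>) r) / \<epsilon>) (at u)"
      by simp
    assume "u \<in> {0<..<?T}"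
    then have "\<bar>indicator {0<..<?T} s * (h s * k' ((u - s) / \<epsilon>) r)\<bar> \<le> D s" using D(2)[of u r s] by simp
    then show "\<bar>indicator {0<..<?T} s * (h s * k' ((u - s) / \<epsilon>) r) / \<epsilon>\<bar> \<le> D s / \<epsilon>"
      using e by (simp only: abs_divide) (simp add: divide_right_mono)
  next
    fix u assume "u \<in> {0<..<?T}"
    then show "integrable lebesgue (\<lambda>s. indicator {0<..<?T} s * (h s * k ((u - s) / \<epsilon>) r))"
      using r T by (intro zint_integrable[OF k(1) h e]) auto
  next
    show "(\<lambda>s. indicator {0<..<?T} s * (h s * k' ((t - s) / \<epsilon>) r) / \<epsilon>) \<in> borel_measurable lebesgue"
      by (intro borel_measurable_divide zint_measurable[OF k(2) h e r]) simp
  qed (use D t in auto)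
  then have "((\<lambda>u. zint \<epsilon> k h ?T u r) has_real_derivative zint \<epsilon> k' h ?T t r / \<epsilon>) (at t)"
    by (simp add: zint_def)
  then have "((\<lambda>u. zconv \<epsilon> k h u r) has_real_derivative zint \<epsilon> k' h ?T t r / \<epsilon>) (at t)"
  proof (rule has_field_derivative_transform_within_open)
    show "open {..<?T}" "t \<in> {..<?T}" by auto
  qed (auto simp: zconv_def zint_eq_conv[OF k(1) e])
  then show ?thesis by (simp add: zconv_def zint_eq_conv[OF k(2) e])
qed

section \<open>The boundary value and the semigroups\<close>

lemma sqrt_sing_integrable:
  assumes h: "sqrt_sing h" shows "set_integrable lebesgue {0<..<t} h"
proof -
  have "set_integrable lebesgue {0<..<t} (\<lambda>s. h s * 1)"
  \<comment> \<open>The kernel 1 is admissible on (0, t), since 1 <= sqrt t / sqrt u there.\<close>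
  proof (rule conv_integrable[OF h, where C="sqrt t"])
    show "\<bar>1\<bar> \<le> sqrt t / sqrt u" if "0 < u" "u < t" for u using that by simp
  qed simp
  then show ?thesis by simp
qed

lemma sqrt_sing_integral_bound:
  assumes h: "continuous_on {0<..<t} h" and H: "\<And>s. 0 < s \<Longrightarrow> s < t \<Longrightarrow> \<bar>h s\<bar> \<le> H / sqrt s" and t: "0 < t"
  shows "\<bar>LINT s:{0<..<t}|lebesgue. h s\<bar> \<le> 2 * H * sqrt t"
proof -
  note i = set_integrable_mult_right[where a=H, OF set_integral_inverse_sqrt(1)[OF less_imp_le[OF t]]]
  have "\<bar>LINT s:{0<..<t}|lebesgue. h s\<bar> \<le> (LINT s:{0<..<t}|lebesgue. H * (1 / sqrt s))"
    by (rule set_integrable_lebesgue_bound(2)[OF i h]) (use H in auto)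
  also have "\<dots> = H * (LINT s:{0<..<t}|lebesgue. 1 / sqrt s)" by (rule set_integral_mult_right)
  also have "\<dots> = 2 * H * sqrt t" using t by (simp add: set_integral_inverse_sqrt)
  finally show ?thesis .
qed

text \<open>The integrand may be unbounded near 0, so the integral is split at t / 2; the first
  piece is constant and the second has a continuous integrand.\<close>

lemma sqrt_sing_integral_deriv:
  assumes h: "sqrt_sing h" and t: "0 < t"
  shows "((\<lambda>t. LINT s:{0<..<t}|lebesgue. h s) has_real_derivative h t) (at t)"
proof -
  have eq: "(LINT s:{0<..<u}|lebesgue. h s) = integral {0..u} h" for u
    using set_lebesgue_integral_eq_integral(2)[OF sqrt_sing_integrable[OF h]] by (simp add: integral_open_interval_real)
  have int: "h integrable_on {0..u}" for u
    using set_lebesgue_integral_eq_integral(1)[OF sqrt_sing_integrable[OF h]] by (simp add: integrable_on_Icc_iff_Ioo)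
  let ?c = "t / 2" and ?b = "2 * t"
  have "continuous_on {?c..?b} h" using t by (intro sqrt_sing_cont[OF h]) auto
  then have "((\<lambda>u. integral {?c..u} h) has_vector_derivative h t) (at t within {?c..?b})"
    by (rule integral_has_vector_derivative) (use t in auto)
  moreover have "at t within {?c..?b} = at t" using t by (intro at_within_interior) auto
  ultimately have "((\<lambda>u. integral {?c..u} h) has_real_derivative h t) (at t)"
    by (simp add: has_real_derivative_iff_has_vector_derivative)
  then have "((\<lambda>u. integral {0..?c} h + integral {?c..u} h) has_real_derivative 0 + h t) (at t)"
    by (intro DERIV_add DERIV_const)
  then have "((\<lambda>u. integral {0..?c} h + integral {?c..u} h) has_real_derivative h t) (at t)" by simp
  then show ?thesis
  proof (rule has_field_derivative_transform_within_open)
    show "open {?c<..}" "t \<in> {?c<..}" using t by auto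
    show "integral {0..?c} h + integral {?c..u} h = (LINT s:{0<..<u}|lebesgue. h s)" if "u \<in> {?c<..}" for u
      unfolding eq by (rule Henstock_Kurzweil_Integration.integral_combine) (use that t int in auto)
  qed
qed

text \<open>The boundary value of \<open>w\<close>, so that \<open>w r t = bdW \<phi>b g t / r\<close>.\<close>

definition bdW :: "real \<Rightarrow> (real \<Rightarrow> real) \<Rightarrow> real \<Rightarrow> real" where
  "bdW \<phi>b g t = \<phi>b * exp (- t) - conv kexp g t"

lemma sqrt_sing_exp_mult: assumes g: "sqrt_sing g" shows "sqrt_sing (\<lambda>s. exp s * g s)"
  unfolding sqrt_sing_def
proof (intro conjI allI impI)
  show "continuous_on {0<..} (\<lambda>s. exp s * g s)" by (intro continuous_intros sqrt_sing_cont[OF g]) auto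
  fix T :: real assume T: "0 < T"
  obtain H where H: "0 \<le> H" "\<And>s. 0 < s \<Longrightarrow> s < T \<Longrightarrow> \<bar>g s\<bar> \<le> H / sqrt s" using sqrt_singD[OF g T] by metis
  have "\<bar>exp s * g s\<bar> \<le> (exp T * H) / sqrt s" if "s \<in> {0<..<T}" for s
  proof -
    have "exp s * \<bar>g s\<bar> \<le> exp T * (H / sqrt s)" using that H by (intro mult_mono) auto
    then show ?thesis by (simp add: abs_mult)
  qed
  then show "\<exists>H. \<forall>s\<in>{0<..<T}. \<bar>exp s * g s\<bar> \<le> H / sqrt s" by blast
qed

text \<open>The exponential kernel factorises, so that t occurs only in a prefactor and as an upper
  limit; the convolution becomes differentiable although \<open>g\<close> is merely
  continuous.\<close>

lemma conv_kexp_eq: "conv kexp g t = exp (- t) * (LINT s:{0<..<t}|lebesgue. exp s * g s)"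
proof -
  have "conv kexp g t = (LINT s:{0<..<t}|lebesgue. exp (- t) * (exp s * g s))"
    unfolding conv_def kexp_def
    by (intro set_lebesgue_integral_cong) (auto simp: exp_diff exp_minus field_simps)
  then show ?thesis by (simp only: set_integral_mult_right)
qed

lemma bdW_deriv:
  assumes g: "sqrt_sing g" and t: "0 < t"
  shows "(bdW \<phi>b g has_real_derivative source \<phi>b g t) (at t)"
proof -
  let ?J = "\<lambda>t. LINT s:{0<..<t}|lebesgue. exp s * g s"
  have e: "((\<lambda>t. exp (- t)) has_real_derivative - exp (- t)) (at t)" by (auto intro!: derivative_eq_intros)
  have "((\<lambda>t. \<phi>b * exp (- t) - exp (- t) * ?J t) has_real_derivative
      \<phi>b * (- exp (- t)) - (- exp (- t) * ?J t + exp t * g t * exp (- t))) (at t)"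
    by (intro DERIV_diff DERIV_cmult DERIV_mult e sqrt_sing_integral_deriv[OF sqrt_sing_exp_mult[OF g] t])
  moreover have "\<phi>b * (- exp (- t)) - (- exp (- t) * ?J t + exp t * g t * exp (- t)) = source \<phi>b g t"
    by (simp add: source_def conv_kexp_eq exp_minus)
  ultimately show ?thesis by (simp add: bdW_def[abs_def] conv_kexp_eq)
qed

text \<open>Both sides have the same derivative for t > 0. The constant of integration is read off
  from the limit at 0, where integrals of functions in \<open>sqrt_sing\<close> are O(sqrt
  t).\<close>

lemma bdW_eq_integral:
  assumes g: "sqrt_sing g" and t: "0 < t"
  shows "bdW \<phi>b g t = \<phi>b + (LINT s:{0<..<t}|lebesgue. source \<phi>b g s)"
proof -
  let ?I = "\<lambda>t. LINT s:{0<..<t}|lebesgue. source \<phi>b g s" and ?J = "\<lambda>t. LINT s:{0<..<t}|lebesgue. exp s * g s"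
  let ?D = "\<lambda>t. bdW \<phi>b g t - ?I t"
  have small: "((\<lambda>t. LINT s:{0<..<t}|lebesgue. f s) \<longlongrightarrow> 0) (at_right 0)" if f: "sqrt_sing f" for f
  proof -
    obtain H where H: "0 \<le> H" "\<And>s. 0 < s \<Longrightarrow> s < 1 \<Longrightarrow> \<bar>f s\<bar> \<le> H / sqrt s" using sqrt_singD[OF f, of 1] by auto
    show ?thesis
    proof (rule Lim_null_comparison)
      show "\<forall>\<^sub>F u in at_right 0. norm (LINT s:{0<..<u}|lebesgue. f s) \<le> 2 * H * sqrt u"
        using eventually_at_right_real[OF zero_less_one]
        by eventually_elim (auto intro!: sqrt_sing_integral_bound sqrt_sing_cont[OF f] H)
      have "((\<lambda>u. 2 * H * sqrt u) \<longlongrightarrow> 2 * H * sqrt 0) (at_right 0)" by (intro tendsto_intros)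
      then show "((\<lambda>u. 2 * H * sqrt u) \<longlongrightarrow> 0) (at_right 0)" by simp
    qed
  qed
  have "((\<lambda>t. \<phi>b * exp (- t) - exp (- t) * ?J t - ?I t) \<longlongrightarrow> \<phi>b * exp (- 0) - exp (- 0) * 0 - 0) (at_right 0)"
    by (intro tendsto_intros small[OF sqrt_sing_exp_mult[OF g]] small[OF sqrt_sing_source[OF g]])
  then have lim: "(?D \<longlongrightarrow> \<phi>b) (at_right 0)" by (simp add: bdW_def conv_kexp_eq)
  have der: "(?D has_real_derivative 0) (at u)" if "0 < u" for u
    using DERIV_diff[OF bdW_deriv[OF g that, of \<phi>b] sqrt_sing_integral_deriv[OF sqrt_sing_source[OF g, of \<phi>b] that]] by simp
  have const: "?D u = ?D t" if "0 < u" for u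
    by (rule DERIV_isconst3[of 0 "u + t + 1"]) (use t that der in auto)
  have "(?D \<longlongrightarrow> ?D t) (at_right 0)"
    by (rule tendsto_eventually) (use const eventually_at_right_less[of 0] in \<open>auto elim!: eventually_mono\<close>)
  with lim have "?D t = \<phi>b" using tendsto_unique trivial_limit_at_right_real by blast
  then show ?thesis by simp
qed

section \<open>The semigroups of the integral equations in half-line form\<close>

lemma heatk_S1_integrand:
  assumes t: "0 < \<tau>"
  shows "S1_integrand \<tau> f r \<rho> = sqrt (4 * pi * \<tau>) * ((heatk \<tau> (r - \<rho>) - heatk \<tau> (2 - r - \<rho>)) * (\<rho> * f \<rho>))"
proof -
  have "(r + \<rho> - 2)\<^sup>2 = (2 - r - \<rho>)\<^sup>2" by (simp add: power2_eq_square algebra_simps)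
  then show ?thesis using t by (simp add: S1_integrand_def heatk_def diff_divide_distrib[symmetric])
qed

text \<open>The datum is an element of L^infinity, hence only almost everywhere comparable with the
  representative \<open>F\<close> that obeys the growth bound; integrals do not see the
  difference.\<close>

lemma S1_eq:
  assumes F: "lin_growth F A B" and t: "0 < \<tau>"
    and ae: "AE \<rho> in lebesgue. indicator {1<..} \<rho> * (\<rho> * f \<rho>) = F \<rho>"
  shows "set_integrable lebesgue {1<..} (S1_integrand \<tau> f r)" "S1 \<tau> f r = dirP F \<tau> r / r"
proof -
  let ?c = "sqrt (4 * pi * \<tau>)"
  let ?g = "\<lambda>\<rho>. ?c * (heatk \<tau> (r - \<rho>) * F \<rho> - heatk \<tau> (2 - r - \<rho>) * F \<rho>)"
  let ?k = "\<lambda>\<rho>. indicator {1<..} \<rho> *\<^sub>R S1_integrand \<tau> f r \<rho>"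
  note i = gauss_dom_integrable[OF gauss_dom_heatk(1) F t]
  have gi: "integrable lebesgue ?g" by (intro integrable_mult_right Bochner_Integration.integrable_diff i)
  have eq: "AE \<rho> in lebesgue. ?g \<rho> = ?k \<rho>"
    using ae
  proof eventually_elim
    case (elim \<rho>)
    show ?case unfolding heatk_S1_integrand[OF t] elim[symmetric] by (simp add: algebra_simps)
  qed
  have km: "?k \<in> borel_measurable lebesgue" by (rule borel_measurable_AE[OF _ eq]) (use gi in auto)
  show "set_integrable lebesgue {1<..} (S1_integrand \<tau> f r)"
    unfolding set_integrable_def by (rule integrable_cong_AE_imp[OF gi km eq])
  have "(LINT \<rho>:{1<..}|lebesgue. S1_integrand \<tau> f r \<rho>) = (LINT \<rho>|lebesgue. ?g \<rho>)"
    unfolding set_lebesgue_integral_def by (rule integral_cong_AE[symmetric]) (use gi km eq in auto)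
  also have "\<dots> = ?c * dirP F \<tau> r"
    using i by (simp add: dirP_def heat_conv_def)
  finally show "S1 \<tau> f r = dirP F \<tau> r / r"
    using t by (simp add: S1_def)
qed

lemma dirP_scale_ind1: "dirP (\<lambda>\<rho>. c * ind1 \<rho>) \<tau> r = c * erfk \<tau> r"
proof -
  have "heat_conv heatk (\<lambda>\<rho>. c * ind1 \<rho>) \<tau> y = c * heat_conv heatk ind1 \<tau> y" for y
    unfolding heat_conv_def by (simp add: mult.left_commute[of _ c])
  then show ?thesis by (simp add: dirP_def erfk_def right_diff_distrib)
qed

text \<open>For f = c / \<rho> the half-line datum is the constant c, whose Dirichlet evolution is
  the error function. The source in the Duhamel term has this form at every time.\<close>

lemma S1_inverse:
  assumes t: "0 < \<tau>" and f: "\<And>\<rho>. 1 < \<rho> \<Longrightarrow> f \<rho> = c / \<rho>"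
  shows "set_integrable lebesgue {1<..} (S1_integrand \<tau> f r)" "S1 \<tau> f r = c * erfk \<tau> r / r"
proof -
  have F: "lin_growth (\<lambda>\<rho>. c * ind1 \<rho>) \<bar>c\<bar> 0"
  proof -
    have "(\<lambda>\<rho>. c * ind1 \<rho>) \<in> borel_measurable lebesgue"
      using lin_growth_ind1 unfolding lin_growth_def by (intro borel_measurable_times) auto
    then show ?thesis unfolding lin_growth_def by (auto simp: ind1_def indicator_def)
  qed
  have ae: "AE \<rho> in lebesgue. indicator {1<..} \<rho> * (\<rho> * f \<rho>) = c * ind1 \<rho>"
    by (intro AE_I2) (auto simp: ind1_def f indicator_def)
  note a = S1_eq[OF F t ae]
  show "set_integrable lebesgue {1<..} (S1_integrand \<tau> f r)" "S1 \<tau> f r = c * erfk \<tau> r / r"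
    using a[of r] by (simp_all add: dirP_scale_ind1)
qed

lemma S2_exp: "S2 t c r = c * exp (- t) / r"
  by (simp add: S2_def exp_minus field_simps)

lemma S2_deriv: "((\<lambda>\<tau>. S2 (\<tau> - s) c r) has_real_derivative - (c * exp (- (t - s)) / r)) (at t)"
proof -
  have "S2 (\<tau> - s) c r = (c / r) * exp (- (\<tau> - s))" for \<tau> by (simp only: S2_exp times_divide_eq_left)
  moreover have "((\<lambda>\<tau>. (c / r) * exp (- (\<tau> - s))) has_real_derivative (c / r) * (exp (- (t - s)) * (- (1 - 0)))) (at t)"
    by (intro DERIV_cmult DERIV_fun_exp DERIV_minus DERIV_diff DERIV_ident DERIV_const)
  ultimately show ?thesis by simp
qed

lemma F1_eq: "F1 \<phi>b r t = - \<phi>b * exp (- t) / r"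
  using DERIV_imp_deriv[OF S2_deriv[of 0 \<phi>b r t]] by (simp add: F1_def)

lemma F2_integrand_eq: "F2_integrand v r t s = - (dnu (\<lambda>\<rho>. v \<rho> s) 1 * kexp (t - s)) / r"
  using DERIV_imp_deriv[OF S2_deriv[of s "dnu (\<lambda>\<rho>. v \<rho> s) 1" r t]] by (simp add: F2_integrand_def kexp_def)

lemma S2_eq: "S2 (t - s) c r = c * kexp (t - s) / r"
  by (simp only: S2_exp kexp_def)

text \<open>The time derivative of \<open>S2\<close> brings a minus sign that cancels the one in
  front of the memory integral of \<open>F2\<close>; hence the positive sign of the convolution in
  \<open>source\<close>.\<close>

lemma F2_eq:
  assumes g: "sqrt_sing g" and v: "\<And>s. 0 < s \<Longrightarrow> dnu (\<lambda>\<rho>. v \<rho> s) 1 = g s" and t: "0 < t"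
  shows "set_integrable lebesgue {0<..<t} (F2_integrand v r t)" "F2 v r t = (- g t + conv kexp g t) / r"
    "set_integrable lebesgue {0<..<t} (\<lambda>s. S2 (t - s) (dnu (\<lambda>\<rho>. v \<rho> s) 1) r)"
    "(LINT s:{0<..<t}|lebesgue. S2 (t - s) (dnu (\<lambda>\<rho>. v \<rho> s) 1) r) = conv kexp g t / r"
    "dtw \<phi>b v r t = source \<phi>b g t / r"
proof -
  have i: "set_integrable lebesgue {0<..<t} (\<lambda>s. (g s * kexp (t - s)) * c)" for c
    by (intro set_integrable_mult_left conv_integrable[OF g continuous_kexp kexp_bound])
  have cf: "(\<lambda>s. indicator {0<..<t} s *\<^sub>R F2_integrand v r t s) = (\<lambda>s. indicator {0<..<t} s *\<^sub>R ((g s * kexp (t - s)) * (- (1 / r))))"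
    by (rule ext) (auto simp: F2_integrand_eq v indicator_def)
  have cs: "(\<lambda>s. indicator {0<..<t} s *\<^sub>R S2 (t - s) (dnu (\<lambda>\<rho>. v \<rho> s) 1) r) = (\<lambda>s. indicator {0<..<t} s *\<^sub>R ((g s * kexp (t - s)) * (1 / r)))"
    by (rule ext) (auto simp: S2_eq v indicator_def)
  show "set_integrable lebesgue {0<..<t} (F2_integrand v r t)"
    unfolding set_integrable_def cf using i unfolding set_integrable_def .
  show "set_integrable lebesgue {0<..<t} (\<lambda>s. S2 (t - s) (dnu (\<lambda>\<rho>. v \<rho> s) 1) r)"
    unfolding set_integrable_def cs using i unfolding set_integrable_def .
  have "(LINT s:{0<..<t}|lebesgue. F2_integrand v r t s) = (LINT s:{0<..<t}|lebesgue. (g s * kexp (t - s)) * (- (1 / r)))"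
    unfolding set_lebesgue_integral_def cf ..
  also have "\<dots> = conv kexp g t * (- (1 / r))" unfolding conv_def by (rule set_integral_mult_left)
  finally show F2: "F2 v r t = (- g t + conv kexp g t) / r"
    unfolding F2_def using v[OF t] by (simp add: S2_def diff_divide_distrib)
  have "(LINT s:{0<..<t}|lebesgue. S2 (t - s) (dnu (\<lambda>\<rho>. v \<rho> s) 1) r) = (LINT s:{0<..<t}|lebesgue. (g s * kexp (t - s)) * (1 / r))"
    unfolding set_lebesgue_integral_def cs ..
  also have "\<dots> = conv kexp g t * (1 / r)" unfolding conv_def by (rule set_integral_mult_left)
  finally show "(LINT s:{0<..<t}|lebesgue. S2 (t - s) (dnu (\<lambda>\<rho>. v \<rho> s) 1) r) = conv kexp g t / r" by simp
  show "dtw \<phi>b v r t = source \<phi>b g t / r"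
    unfolding dtw_def F1_eq F2 source_def by (simp add: add_divide_distrib diff_divide_distrib)
qed

section \<open>Solutions in terms of their boundary flux\<close>

text \<open>The Duhamel integral in the equation for v, multiplied by r; \<open>volQ1\<close> is its
  radial derivative.\<close>

definition volQ :: "real \<Rightarrow> (real \<Rightarrow> real) \<Rightarrow> real \<Rightarrow> real \<Rightarrow> real" where
  "volQ \<epsilon> h t r = conv (\<lambda>u. erfk (u / \<epsilon>) r) h t"
definition volQ1 :: "real \<Rightarrow> (real \<Rightarrow> real) \<Rightarrow> real \<Rightarrow> real \<Rightarrow> real" where
  "volQ1 \<epsilon> h t r = conv (\<lambda>u. 2 * heatk (u / \<epsilon>) (r - 1)) h t"

lemma sqrt_time_rescale: "0 < \<epsilon> \<Longrightarrow> 0 < u \<Longrightarrow> 1 / sqrt (pi * (u / \<epsilon>)) = sqrt (\<epsilon> / pi) / sqrt u"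
  by (simp add: real_sqrt_mult real_sqrt_divide)

text \<open>In the time variable of the problem the kernel is of order sqrt \<epsilon> / sqrt u near
  the boundary. This is one source of the factors sqrt \<epsilon>.\<close>

lemma erfk_time_bound:
  assumes "0 < \<epsilon>" "0 < u" shows "\<bar>erfk (u / \<epsilon>) r\<bar> \<le> \<bar>r - 1\<bar> * sqrt (\<epsilon> / pi) / sqrt u"
proof -
  have "\<bar>erfk (u / \<epsilon>) r\<bar> \<le> \<bar>r - 1\<bar> * (1 / sqrt (pi * (u / \<epsilon>)))"
    using erfk_lipschitz[of "u / \<epsilon>" r] assms by simp
  then show ?thesis unfolding sqrt_time_rescale[OF assms] by simp
qed

lemma heatk_time_bound:
  assumes "0 < \<epsilon>" "0 < u" shows "\<bar>2 * heatk (u / \<epsilon>) z\<bar> \<le> sqrt (\<epsilon> / pi) / sqrt u"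
proof -
  have "2 * heatk (u / \<epsilon>) z \<le> 2 * (1 / sqrt (4 * pi * (u / \<epsilon>)))"
    using assms by (intro mult_left_mono heatk_le) auto
  also have "\<dots> = 1 / sqrt (pi * (u / \<epsilon>))"
  proof -
    have "sqrt (4 * pi * (u / \<epsilon>)) = sqrt 4 * sqrt (pi * (u / \<epsilon>))" by (simp only: real_sqrt_mult mult.assoc)
    then show ?thesis by simp
  qed
  also have "\<dots> = sqrt (\<epsilon> / pi) / sqrt u" by (rule sqrt_time_rescale[OF assms])
  finally show ?thesis using heatk_nonneg[of "u / \<epsilon>" z] assms by simp
qed

text \<open>At the boundary the Gaussian factor is 1, so the flux kernel is exactly a multiple of 1
  / sqrt u: the kernel of the Volterra equation.\<close>

lemma heatk_time_0:
  assumes "0 < \<epsilon>" "0 < u" shows "2 * heatk (u / \<epsilon>) 0 = sqrt (\<epsilon> / pi) * ksqrt u"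
proof -
  have "sqrt (4 * pi * (u / \<epsilon>)) = sqrt 4 * sqrt (pi * (u / \<epsilon>))" by (simp only: real_sqrt_mult mult.assoc)
  then have "2 * heatk (u / \<epsilon>) 0 = 1 / sqrt (pi * (u / \<epsilon>))" by (simp add: heatk_def)
  then show ?thesis unfolding sqrt_time_rescale[OF assms] by (simp add: ksqrt_def)
qed

lemma time_kernel_continuous:
  assumes "continuous_on ({0<..} \<times> UNIV) (\<lambda>(\<tau>::real, r::real). k \<tau> r)" and e: "0 < \<epsilon>"
  shows "continuous_on (UNIV \<times> {0<..}) (\<lambda>(r, u). k (u / \<epsilon>) r :: real)" "continuous_on {0<..} (\<lambda>u. k (u / \<epsilon>) r)"
    "continuous_on ({1..} \<times> {0<..}) (\<lambda>(r, u). k (u / \<epsilon>) r)"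
proof -
  have "continuous_on (UNIV \<times> {0<..}) (\<lambda>p. (\<lambda>(\<tau>, r). k \<tau> r) (snd p / \<epsilon>, fst p))"
    using e by (intro continuous_intros continuous_on_compose2[OF assms(1)]) auto
  then show 1: "continuous_on (UNIV \<times> {0<..}) (\<lambda>(r, u). k (u / \<epsilon>) r)" by (simp add: case_prod_beta')
  then show "continuous_on ({1..} \<times> {0<..}) (\<lambda>(r, u). k (u / \<epsilon>) r)" by (rule continuous_on_subset) auto
  have "continuous_on {0<..} (\<lambda>u. (\<lambda>(\<tau>, r). k \<tau> r) (u / \<epsilon>, r))"
    using e by (intro continuous_intros continuous_on_compose2[OF assms(1)]) auto
  then show "continuous_on {0<..} (\<lambda>u. k (u / \<epsilon>) r)" by simp
qed

lemma double_heatk_continuous: "continuous_on ({0<..} \<times> UNIV) (\<lambda>(\<tau>, r). 2 * heatk \<tau> (r - 1))"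
  using shifted_kernel_continuous[OF heatk_continuous(1)] by (auto simp: case_prod_beta' intro!: continuous_intros)

lemmas erfk_time_continuous = time_kernel_continuous[OF erfk_continuous]
lemmas heatk_time_continuous = time_kernel_continuous[OF double_heatk_continuous]

lemma volQ_continuous:
  assumes h: "sqrt_sing h" and e: "0 < \<epsilon>"
  shows "continuous_on (UNIV \<times> {0<..}) (\<lambda>(r, t). volQ \<epsilon> h t r)" "continuous_on (UNIV \<times> {0<..}) (\<lambda>(r, t). volQ1 \<epsilon> h t r)"
proof -
  show "continuous_on (UNIV \<times> {0<..}) (\<lambda>(r, t). volQ \<epsilon> h t r)"
    unfolding volQ_def
    by (rule conv_continuous[OF h erfk_time_continuous(1)[OF e] _ erfk_time_bound[OF e]]) (auto intro!: continuous_intros)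
  show "continuous_on (UNIV \<times> {0<..}) (\<lambda>(r, t). volQ1 \<epsilon> h t r)"
    unfolding volQ1_def
    by (rule conv_continuous[OF h heatk_time_continuous(1)[OF e] _ heatk_time_bound[OF e]]) (auto intro!: continuous_intros)
qed

lemma erfk_conv_integrable:
  assumes "sqrt_sing h" "0 < \<epsilon>"
  shows "set_integrable lebesgue {0<..<t} (\<lambda>s. h s * erfk ((t - s) / \<epsilon>) r)"
  by (rule conv_integrable[OF assms(1) erfk_time_continuous(2)[OF assms(2)] erfk_time_bound[OF assms(2)]])

text \<open>The differentiated kernel is bounded by a multiple of 1 / sqrt (t - s) uniformly in r,
  so differentiation under the integral is possible at r = 1 as well.\<close>

lemma volQ_deriv:
  assumes h: "sqrt_sing h" and e: "0 < \<epsilon>" and t: "0 < t"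
  shows "(volQ \<epsilon> h t has_real_derivative volQ1 \<epsilon> h t r) (at r)"
proof -
  let ?a = "sqrt (\<epsilon> / pi)"
  obtain H where H: "0 \<le> H" "\<And>s. 0 < s \<Longrightarrow> s < t \<Longrightarrow> \<bar>h s\<bar> \<le> H / sqrt s" using sqrt_singD[OF h t] by metis
  let ?D = "\<lambda>s. indicator {0<..<t} s *\<^sub>R ((H * ?a) * (1 / (sqrt s * sqrt (t - s))))"
  show ?thesis
    unfolding volQ_def[abs_def] volQ1_def conv_def set_lebesgue_integral_def
  proof (rule has_real_derivative_integral_dominated[where a="r - 1" and b="r + 1" and D="?D"
        and f'="\<lambda>r s. indicator {0<..<t} s *\<^sub>R (h s * (2 * heatk ((t - s) / \<epsilon>) (r - 1)))"])
    show "integrable lebesgue ?D"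
      using set_integrable_mult_right[where a="H * ?a", OF set_integrable_beta_half[OF t]] unfolding set_integrable_def .
    show "integrable lebesgue (\<lambda>s. indicator {0<..<t} s *\<^sub>R (h s * erfk ((t - s) / \<epsilon>) x))" for x
      using erfk_conv_integrable[OF h e] unfolding set_integrable_def .
    show "(\<lambda>s. indicator {0<..<t} s *\<^sub>R (h s * (2 * heatk ((t - s) / \<epsilon>) (r - 1)))) \<in> borel_measurable lebesgue"
      using conv_integrable[OF h heatk_time_continuous(2)[OF e] heatk_time_bound[OF e], of t]
      unfolding set_integrable_def by (rule borel_measurable_integrable)
    show "((\<lambda>r. indicator {0<..<t} s *\<^sub>R (h s * erfk ((t - s) / \<epsilon>) r)) has_real_derivative
        indicator {0<..<t} s *\<^sub>R (h s * (2 * heatk ((t - s) / \<epsilon>) (x - 1)))) (at x)" for x s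
    proof (cases "s \<in> {0<..<t}")
      case True
      then have "0 < (t - s) / \<epsilon>" using e by simp
      from DERIV_cmult[OF erfk_derivs(1)[OF this], of "h s"] show ?thesis using True by simp
    qed simp
    show "\<bar>indicator {0<..<t} s *\<^sub>R (h s * (2 * heatk ((t - s) / \<epsilon>) (x - 1)))\<bar> \<le> ?D s" for x s
    proof (cases "s \<in> {0<..<t}")
      case True
      then have "\<bar>h s\<bar> * \<bar>2 * heatk ((t - s) / \<epsilon>) (x - 1)\<bar> \<le> (H / sqrt s) * (?a / sqrt (t - s))"
        using H e by (intro mult_mono heatk_time_bound) auto
      then show ?thesis using True by (simp add: abs_mult)
    qed simp
  qed auto
qed

lemma volQ_at_1 [simp]: "volQ \<epsilon> h t 1 = 0"
  by (simp add: volQ_def conv_def)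

lemma volQ1_at_1: 
  assumes e: "0 < \<epsilon>" shows "volQ1 \<epsilon> h t 1 = sqrt (\<epsilon> / pi) * conv ksqrt h t"
proof -
  have "volQ1 \<epsilon> h t 1 = (LINT s:{0<..<t}|lebesgue. sqrt (\<epsilon> / pi) * (h s * ksqrt (t - s)))"
    unfolding volQ1_def conv_def
    by (intro set_lebesgue_integral_cong) (auto simp: heatk_time_0[OF e])
  also have "\<dots> = sqrt (\<epsilon> / pi) * conv ksqrt h t" unfolding conv_def by (rule set_integral_mult_right)
  finally show ?thesis .
qed

text \<open>The pair \<open>(v, w)\<close> expressed through its boundary flux \<open>g = \<partial>\<^sub>\<nu> v\<close>.\<close>

definition sol_v :: "real \<Rightarrow> (real \<Rightarrow> real) \<Rightarrow> real \<Rightarrow> (real \<Rightarrow> real) \<Rightarrow> real \<Rightarrow> real \<Rightarrow> real" where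
  "sol_v \<epsilon> F \<phi>b g r t = (dirP F (t / \<epsilon>) r - volQ \<epsilon> (source \<phi>b g) t r) / r"
definition sol_v1 :: "real \<Rightarrow> (real \<Rightarrow> real) \<Rightarrow> real \<Rightarrow> (real \<Rightarrow> real) \<Rightarrow> real \<Rightarrow> real \<Rightarrow> real" where
  "sol_v1 \<epsilon> F \<phi>b g r t = (dirP1 F (t / \<epsilon>) r - volQ1 \<epsilon> (source \<phi>b g) t r) / r - sol_v \<epsilon> F \<phi>b g r t / r"
definition sol_w :: "real \<Rightarrow> (real \<Rightarrow> real) \<Rightarrow> real \<Rightarrow> real \<Rightarrow> real" where
  "sol_w \<phi>b g r t = bdW \<phi>b g t / r"
definition flux0 :: "real \<Rightarrow> (real \<Rightarrow> real) \<Rightarrow> real \<Rightarrow> real" where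
  "flux0 \<epsilon> F t = - dirP1 F (t / \<epsilon>) 1"

lemma sol_v_deriv:
  assumes F: "lin_growth F A B" and g: "sqrt_sing g" and e: "0 < \<epsilon>" and t: "0 < t" and r: "1 \<le> r"
  shows "((\<lambda>r. sol_v \<epsilon> F \<phi>b g r t) has_real_derivative sol_v1 \<epsilon> F \<phi>b g r t) (at r)"
proof -
  have te: "0 < t / \<epsilon>" using e t by simp
  have "((\<lambda>r. (dirP F (t / \<epsilon>) r - volQ \<epsilon> (source \<phi>b g) t r) / r) has_real_derivative
    ((dirP1 F (t / \<epsilon>) r - volQ1 \<epsilon> (source \<phi>b g) t r) * r - (dirP F (t / \<epsilon>) r - volQ \<epsilon> (source \<phi>b g) t r) * 1) / (r * r)) (at r)"
    by (intro DERIV_divide DERIV_diff dirP_derivs(1)[OF F te] volQ_deriv[OF sqrt_sing_source[OF g] e t] DERIV_ident) (use r in auto)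
  moreover have "((p1 * r - p * 1) / (r * r)) = p1 / r - p / r / r" for p p1 :: real using r by (simp add: diff_divide_distrib)
  ultimately show ?thesis unfolding sol_v_def[abs_def] sol_v1_def by metis
qed

text \<open>At r = 1 the function v vanishes, so the quotient rule leaves only the derivatives of
  the numerator; the result is the right-hand side of the Volterra equation.\<close>

lemma sol_v1_at_1:
  assumes "0 < \<epsilon>" 
  shows "- sol_v1 \<epsilon> F \<phi>b g 1 t = flux0 \<epsilon> F t + sqrt (\<epsilon> / pi) * conv ksqrt (source \<phi>b g) t"
  by (simp add: sol_v1_def sol_v_def flux0_def volQ1_at_1[OF assms])

lemma at_within_Ici_ne_bot: assumes "1 \<le> (r::real)" shows "at r within {1..} \<noteq> bot"
proof (cases "r = 1")
  case True
  then show ?thesis by (simp add: at_within_Ici_at_right)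
next
  case False
  then have "at r within {1..} = at r" using assms by (intro at_within_interior) auto
  then show ?thesis by simp
qed

text \<open>The explicit formulas are differentiable on both sides of r = 1, while a given solution
  agrees with them only for r >= 1; this transfers the derivative.\<close>

lemma dnu_eq:
  assumes f: "(f has_real_derivative D) (at r)" and r: "1 \<le> r" and eq: "\<And>x. 1 \<le> x \<Longrightarrow> f' x = f x"
  shows "dnu f' r = - D" "f' differentiable (at r within {1..})"
proof -
  have d: "(f' has_real_derivative D) (at r within {1..})"
    by (rule has_field_derivative_transform_within[OF has_field_derivative_at_within[OF f] zero_less_one]) (use r eq in auto)
  then show "dnu f' r = - D"
    unfolding dnu_def
    by (simp add: vector_derivative_within[OF at_within_Ici_ne_bot[OF r]] has_real_derivative_iff_has_vector_derivative)
  show "f' differentiable (at r within {1..})" using d by (auto simp: real_differentiable_def)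
qed

lemma norm_Omega: "x \<in> Omega \<longleftrightarrow> 1 \<le> norm x"
  by (auto simp: Omega_def)

lemma closure_Omega: "closure Omega = Omega"
  unfolding Omega_def by (intro closure_closed) auto

lemma cont_radial_infinity: "cont_radial \<infinity> f \<longleftrightarrow> continuous_on ({1..} \<times> {0<..}) (\<lambda>(r, t). f r t)"
proof -
  have T: "{t. 0 < t \<and> ereal t < \<infinity>} = {0<..}" by auto
  show ?thesis
  proof
    assume c: "cont_radial \<infinity> f"
    \<comment> \<open>The profile is recovered by restricting to the ray through the first unit
      vector.\<close>
    have "continuous_on ({1..} \<times> {0<..}) (\<lambda>p. (\<lambda>(x, t). f (norm x) t) (fst p *\<^sub>R (axis 1 1 :: real^3), snd p))"
      by (rule continuous_on_compose2[OF c[unfolded cont_radial_def closure_Omega T]])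
        (auto intro!: continuous_intros simp: norm_Omega norm_axis_1)
    then show "continuous_on ({1..} \<times> {0<..}) (\<lambda>(r, t). f r t)"
      by (rule continuous_on_eq) (auto simp: norm_axis_1)
  next
    assume c: "continuous_on ({1..} \<times> {0<..}) (\<lambda>(r, t). f r t)"
    have "continuous_on (Omega \<times> {0<..}) (\<lambda>p. (\<lambda>(r, t). f r t) (norm (fst p), snd p))"
      by (rule continuous_on_compose2[OF c]) (auto intro!: continuous_intros simp: norm_Omega)
    then show "cont_radial \<infinity> f" unfolding cont_radial_def closure_Omega T by (simp add: case_prod_beta')
  qed
qed

lemma all_Omega: "(\<forall>x\<in>Omega. P (norm x)) \<longleftrightarrow> (\<forall>r\<ge>1. P r)"
proof
  assume a: "\<forall>x\<in>Omega. P (norm x)"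
  show "\<forall>r\<ge>1. P r"
  proof (intro allI impI)
    fix r :: real assume "1 \<le> r"
    then show "P r" using a[rule_format, of "r *\<^sub>R axis 1 1"] by (simp add: norm_Omega norm_axis_1)
  qed
qed (auto simp: norm_Omega)

lemma sol_continuous:
  assumes F: "lin_growth F A B" and g: "sqrt_sing g" and e: "0 < \<epsilon>"
  shows "continuous_on ({1..} \<times> {0<..}) (\<lambda>(r, t). sol_v \<epsilon> F \<phi>b g r t)"
    "continuous_on ({1..} \<times> {0<..}) (\<lambda>(r, t). sol_v1 \<epsilon> F \<phi>b g r t)"
    "continuous_on ({1..} \<times> {0<..}) (\<lambda>(r, t). sol_w \<phi>b g r t)"
proof -
  note h = sqrt_sing_source[OF g, of \<phi>b]
  have q: "continuous_on ({1..} \<times> {0<..}) (\<lambda>(r, t). volQ \<epsilon> (source \<phi>b g) t r)"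
    "continuous_on ({1..} \<times> {0<..}) (\<lambda>(r, t). volQ1 \<epsilon> (source \<phi>b g) t r)"
    by (rule continuous_on_subset[OF volQ_continuous(1)[OF h e]] continuous_on_subset[OF volQ_continuous(2)[OF h e]]; auto)+
  note p = time_kernel_continuous(3)[OF dirP_continuous(1)[OF F] e] time_kernel_continuous(3)[OF dirP_continuous(2)[OF F] e]
  have cv: "continuous_on ({1..} \<times> {0<..}) (\<lambda>p. sol_v \<epsilon> F \<phi>b g (fst p) (snd p))"
    unfolding sol_v_def using q(1) p(1) by (intro continuous_intros) (auto simp: case_prod_beta')
  then show "continuous_on ({1..} \<times> {0<..}) (\<lambda>(r, t). sol_v \<epsilon> F \<phi>b g r t)" by (simp add: case_prod_beta')
  have "continuous_on ({1..} \<times> {0<..}) (\<lambda>p. sol_v1 \<epsilon> F \<phi>b g (fst p) (snd p))"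
    unfolding sol_v1_def using q(2) p(2) cv by (intro continuous_intros) (auto simp: case_prod_beta')
  then show "continuous_on ({1..} \<times> {0<..}) (\<lambda>(r, t). sol_v1 \<epsilon> F \<phi>b g r t)" by (simp add: case_prod_beta')
  have "continuous_on {0<..} (bdW \<phi>b g)"
    unfolding bdW_def
    by (intro continuous_intros sqrt_sing_cont[OF conv_sqrt_sing[OF g continuous_kexp kexp_bound]]) auto
  then have "continuous_on ({1..} \<times> {0<..}) (\<lambda>p::real \<times> real. bdW \<phi>b g (snd p))"
    by (rule continuous_on_compose2) (auto intro!: continuous_intros)
  then have "continuous_on ({1..} \<times> {0<..}) (\<lambda>p. sol_w \<phi>b g (fst p) (snd p))"
    unfolding sol_w_def by (intro continuous_intros) auto
  then show "continuous_on ({1..} \<times> {0<..}) (\<lambda>(r, t). sol_w \<phi>b g r t)" by (simp add: case_prod_beta')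
qed

text \<open>\<open>F\<close> is a version of \<open>\<rho> * \<Phi> \<rho>\<close> on \<open>(1, \<infinity>)\<close> for which the growth bound holds everywhere.\<close>

definition data :: "(real \<Rightarrow> real) \<Rightarrow> real \<Rightarrow> (real \<Rightarrow> real) \<Rightarrow> real \<Rightarrow> real \<Rightarrow> bool" where
  "data \<phi> \<phi>b F A B \<longleftrightarrow> lin_growth F A B \<and>
     (AE \<rho> in lebesgue. indicator {1<..} \<rho> * (\<rho> * (\<phi> \<rho> - S2 0 \<phi>b \<rho>)) = F \<rho>)"

lemma duhamel:
  assumes g: "sqrt_sing g" and v: "\<And>s. 0 < s \<Longrightarrow> dnu (\<lambda>\<rho>. v \<rho> s) 1 = g s" and e: "0 < \<epsilon>" and t: "0 < t"
  shows "0 < s \<Longrightarrow> s < t \<Longrightarrow> set_integrable lebesgue {1<..} (S1_integrand ((t - s) / \<epsilon>) (\<lambda>\<rho>. dtw \<phi>b v \<rho> s) r)"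
    "set_integrable lebesgue {0<..<t} (\<lambda>s. S1 ((t - s) / \<epsilon>) (\<lambda>\<rho>. dtw \<phi>b v \<rho> s) r)"
    "(LINT s:{0<..<t}|lebesgue. S1 ((t - s) / \<epsilon>) (\<lambda>\<rho>. dtw \<phi>b v \<rho> s) r) = volQ \<epsilon> (source \<phi>b g) t r / r"
proof -
  let ?h = "source \<phi>b g"
  have a: "set_integrable lebesgue {1<..} (S1_integrand ((t - s) / \<epsilon>) (\<lambda>\<rho>. dtw \<phi>b v \<rho> s) r)"
    "S1 ((t - s) / \<epsilon>) (\<lambda>\<rho>. dtw \<phi>b v \<rho> s) r = ?h s * erfk ((t - s) / \<epsilon>) r / r" if s: "0 < s" "s < t" for s
  proof -
    have f: "dtw \<phi>b v \<rho> s = ?h s / \<rho>" for \<rho> by (rule F2_eq(5)[OF g v s(1)])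
    have "0 < (t - s) / \<epsilon>" using e s by simp
    from S1_inverse[OF this f] show "set_integrable lebesgue {1<..} (S1_integrand ((t - s) / \<epsilon>) (\<lambda>\<rho>. dtw \<phi>b v \<rho> s) r)"
      "S1 ((t - s) / \<epsilon>) (\<lambda>\<rho>. dtw \<phi>b v \<rho> s) r = ?h s * erfk ((t - s) / \<epsilon>) r / r" by auto
  qed
  then show "0 < s \<Longrightarrow> s < t \<Longrightarrow> set_integrable lebesgue {1<..} (S1_integrand ((t - s) / \<epsilon>) (\<lambda>\<rho>. dtw \<phi>b v \<rho> s) r)" by simp
  have eq: "(\<lambda>s. indicator {0<..<t} s *\<^sub>R S1 ((t - s) / \<epsilon>) (\<lambda>\<rho>. dtw \<phi>b v \<rho> s) r)
      = (\<lambda>s. indicator {0<..<t} s *\<^sub>R ((?h s * erfk ((t - s) / \<epsilon>) r) * (1 / r)))"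
    by (rule ext) (auto simp: a indicator_def)
  have "set_integrable lebesgue {0<..<t} (\<lambda>s. (?h s * erfk ((t - s) / \<epsilon>) r) * (1 / r))"
    by (intro set_integrable_mult_left erfk_conv_integrable[OF sqrt_sing_source[OF g] e])
  then show "set_integrable lebesgue {0<..<t} (\<lambda>s. S1 ((t - s) / \<epsilon>) (\<lambda>\<rho>. dtw \<phi>b v \<rho> s) r)"
    unfolding set_integrable_def eq .
  have "(LINT s:{0<..<t}|lebesgue. S1 ((t - s) / \<epsilon>) (\<lambda>\<rho>. dtw \<phi>b v \<rho> s) r)
      = (LINT s:{0<..<t}|lebesgue. (?h s * erfk ((t - s) / \<epsilon>) r) * (1 / r))"
    unfolding set_lebesgue_integral_def eq ..
  also have "\<dots> = volQ \<epsilon> ?h t r * (1 / r)" unfolding volQ_def conv_def by (rule set_integral_mult_left)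
  finally show "(LINT s:{0<..<t}|lebesgue. S1 ((t - s) / \<epsilon>) (\<lambda>\<rho>. dtw \<phi>b v \<rho> s) r) = volQ \<epsilon> ?h t r / r" by simp
qed

text \<open>The formulas for v and w solve the integral equations with \<open>g\<close> in place of
  the flux; the Volterra equation says that \<open>g\<close> is indeed the flux of this v, which
  closes the loop.\<close>

lemma sol_is_solution:
  assumes d: "data \<phi> \<phi>b F A B" and g: "volterra (sqrt (\<epsilon> / pi)) \<phi>b (flux0 \<epsilon> F) g" and e: "0 < \<epsilon>"
  shows "is_solution \<epsilon> \<infinity> \<phi> \<phi>b (sol_v \<epsilon> F \<phi>b g) (sol_w \<phi>b g)"
proof -
  let ?v = "sol_v \<epsilon> F \<phi>b g" and ?w = "sol_w \<phi>b g"
  have F: "lin_growth F A B" and ae: "AE \<rho> in lebesgue. indicator {1<..} \<rho> * (\<rho> * (\<phi> \<rho> - S2 0 \<phi>b \<rho>)) = F \<rho>"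
    using d by (auto simp: data_def)
  have gs: "sqrt_sing g" using g by (simp add: volterra_def)
  have dv: "dnu (\<lambda>\<rho>. ?v \<rho> t) r = - sol_v1 \<epsilon> F \<phi>b g r t" if "1 \<le> r" "0 < t" for r t
    by (rule dnu_eq(1)[OF sol_v_deriv[OF F gs e that(2,1)] that(1) refl])
  have diff: "(\<lambda>\<rho>. ?v \<rho> t) differentiable (at r within {1..})" if "1 \<le> r" "0 < t" for r t
    by (rule dnu_eq(2)[OF sol_v_deriv[OF F gs e that(2,1)] that(1) refl])
  have v1: "dnu (\<lambda>\<rho>. ?v \<rho> s) 1 = g s" if "0 < s" for s
    using dv[of 1 s] sol_v1_at_1[OF e, of F \<phi>b g s] g that by (simp add: volterra_def)
  have cd: "continuous_on ({1..} \<times> {0<..}) (\<lambda>(r, t). dnu (\<lambda>\<rho>. ?v \<rho> t) r)"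
    by (rule continuous_on_eq[OF continuous_on_minus[OF sol_continuous(2)[OF F gs e, of \<phi>b]]])
      (auto simp: dv)
  have main: "set_integrable lebesgue {0<..<t} (\<lambda>s. S2 (t - s) (dnu (\<lambda>\<rho>. ?v \<rho> s) 1) r) \<and>
        ?w r t = S2 t \<phi>b r - (LINT s:{0<..<t}|lebesgue. S2 (t - s) (dnu (\<lambda>\<rho>. ?v \<rho> s) 1) r) \<and>
        set_integrable lebesgue {0<..<t} (F2_integrand ?v r t) \<and>
        set_integrable lebesgue {1<..} (S1_integrand (t / \<epsilon>) (\<lambda>\<rho>. \<phi> \<rho> - S2 0 \<phi>b \<rho>) r) \<and>
        (\<forall>s. 0 < s \<and> s < t \<longrightarrow>
           set_integrable lebesgue {1<..} (S1_integrand ((t - s) / \<epsilon>) (\<lambda>\<rho>. dtw \<phi>b ?v \<rho> s) r)) \<and>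
        set_integrable lebesgue {0<..<t} (\<lambda>s. S1 ((t - s) / \<epsilon>) (\<lambda>\<rho>. dtw \<phi>b ?v \<rho> s) r) \<and>
        ?v r t = S1 (t / \<epsilon>) (\<lambda>\<rho>. \<phi> \<rho> - S2 0 \<phi>b \<rho>) r
                - (LINT s:{0<..<t}|lebesgue. S1 ((t - s) / \<epsilon>) (\<lambda>\<rho>. dtw \<phi>b ?v \<rho> s) r)"
    if r: "1 \<le> r" and t: "0 < t" for r t
  proof -
    have te: "0 < t / \<epsilon>" using e t by simp
    note f = F2_eq[of g ?v, OF gs v1 t, where r=r] and u = duhamel[of g ?v, OF gs v1 e t, where r=r and \<phi>b=\<phi>b]
      and p = S1_eq[OF F te ae, where r=r]
    have "?w r t = S2 t \<phi>b r - (LINT s:{0<..<t}|lebesgue. S2 (t - s) (dnu (\<lambda>\<rho>. ?v \<rho> s) 1) r)"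
    proof -
      have "(LINT s:{0<..<t}|lebesgue. S2 (t - s) (dnu (\<lambda>\<rho>. ?v \<rho> s) 1) r) = conv kexp g t / r"
        by (rule f(4))
      then show ?thesis by (simp only: sol_w_def bdW_def S2_exp diff_divide_distrib)
    qed
    moreover have "?v r t = S1 (t / \<epsilon>) (\<lambda>\<rho>. \<phi> \<rho> - S2 0 \<phi>b \<rho>) r
                - (LINT s:{0<..<t}|lebesgue. S1 ((t - s) / \<epsilon>) (\<lambda>\<rho>. dtw \<phi>b ?v \<rho> s) r)"
    proof -
      have q: "(LINT s:{0<..<t}|lebesgue. S1 ((t - s) / \<epsilon>) (\<lambda>\<rho>. dtw \<phi>b ?v \<rho> s) r) = volQ \<epsilon> (source \<phi>b g) t r / r"
        by (rule u(3))
      show ?thesis unfolding q p(2) by (simp only: sol_v_def diff_divide_distrib)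
    qed
    ultimately show ?thesis using f(1,3) u(1,2) p(1) by blast
  qed
  note m = all_Omega[where P="\<lambda>r. \<forall>t. 0 < t \<and> ereal t < \<infinity> \<longrightarrow> (set_integrable lebesgue {0<..<t} (\<lambda>s. S2 (t - s) (dnu (\<lambda>\<rho>. ?v \<rho> s) 1) r) \<and>
        ?w r t = S2 t \<phi>b r - (LINT s:{0<..<t}|lebesgue. S2 (t - s) (dnu (\<lambda>\<rho>. ?v \<rho> s) 1) r) \<and>
        set_integrable lebesgue {0<..<t} (F2_integrand ?v r t) \<and>
        set_integrable lebesgue {1<..} (S1_integrand (t / \<epsilon>) (\<lambda>\<rho>. \<phi> \<rho> - S2 0 \<phi>b \<rho>) r) \<and>
        (\<forall>s. 0 < s \<and> s < t \<longrightarrow>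
           set_integrable lebesgue {1<..} (S1_integrand ((t - s) / \<epsilon>) (\<lambda>\<rho>. dtw \<phi>b ?v \<rho> s) r)) \<and>
        set_integrable lebesgue {0<..<t} (\<lambda>s. S1 ((t - s) / \<epsilon>) (\<lambda>\<rho>. dtw \<phi>b ?v \<rho> s) r) \<and>
        ?v r t = S1 (t / \<epsilon>) (\<lambda>\<rho>. \<phi> \<rho> - S2 0 \<phi>b \<rho>) r
                - (LINT s:{0<..<t}|lebesgue. S1 ((t - s) / \<epsilon>) (\<lambda>\<rho>. dtw \<phi>b ?v \<rho> s) r))"]
  show ?thesis
    unfolding is_solution_def Let_def m cont_radial_infinity
  proof (intro conjI)
    show "\<forall>r\<ge>1. \<forall>t. 0 < t \<and> ereal t < \<infinity> \<longrightarrow> (\<lambda>\<rho>. ?v \<rho> t) differentiable (at r within {1..})"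
      by (intro allI impI diff) auto
  qed (use sol_continuous[OF F gs e, of \<phi>b] cd in \<open>simp_all add: main\<close>)
qed

text \<open>The converse of \<open>sol_is_solution\<close>. The integral equations express v and w
  through their own flux, and the normal derivative of that expression at r = 1 is the Volterra
  equation.\<close>

lemma solution_representation:
  assumes d: "data \<phi> \<phi>b F A B" and e: "0 < \<epsilon>" and s: "is_solution \<epsilon> \<infinity> \<phi> \<phi>b v w"
    and g: "sqrt_sing (\<lambda>t. dnu (\<lambda>\<rho>. v \<rho> t) 1)"
  defines "g \<equiv> \<lambda>t. dnu (\<lambda>\<rho>. v \<rho> t) 1"
  shows "volterra (sqrt (\<epsilon> / pi)) \<phi>b (flux0 \<epsilon> F) g"
    "1 \<le> r \<Longrightarrow> 0 < t \<Longrightarrow> v r t = sol_v \<epsilon> F \<phi>b g r t" "1 \<le> r \<Longrightarrow> 0 < t \<Longrightarrow> w r t = sol_w \<phi>b g r t"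
proof -
  have F: "lin_growth F A B" and ae: "AE \<rho> in lebesgue. indicator {1<..} \<rho> * (\<rho> * (\<phi> \<rho> - S2 0 \<phi>b \<rho>)) = F \<rho>"
    using d by (auto simp: data_def)
  have gs: "sqrt_sing g" using g by (simp add: g_def)
  have v1: "dnu (\<lambda>\<rho>. v \<rho> s) 1 = g s" for s by (simp add: g_def)
  have m: "w r t = S2 t \<phi>b r - (LINT s:{0<..<t}|lebesgue. S2 (t - s) (dnu (\<lambda>\<rho>. v \<rho> s) 1) r)"
    "v r t = S1 (t / \<epsilon>) (\<lambda>\<rho>. \<phi> \<rho> - S2 0 \<phi>b \<rho>) r
                - (LINT s:{0<..<t}|lebesgue. S1 ((t - s) / \<epsilon>) (\<lambda>\<rho>. dtw \<phi>b v \<rho> s) r)"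
    if r: "1 \<le> r" and t: "0 < t" for r t
  proof -
    have x: "r *\<^sub>R (axis 1 1 :: real^3) \<in> Omega" "norm (r *\<^sub>R (axis 1 1 :: real^3)) = r" using r by (auto simp: norm_Omega norm_axis_1)
    have t': "0 < t \<and> ereal t < \<infinity>" using t by simp
    from s have "\<forall>x\<in>Omega. \<forall>t. 0 < t \<and> ereal t < \<infinity> \<longrightarrow> 
        w (norm x) t = S2 t \<phi>b (norm x) - (LINT s:{0<..<t}|lebesgue. S2 (t - s) (dnu (\<lambda>\<rho>. v \<rho> s) 1) (norm x)) \<and>
        v (norm x) t = S1 (t / \<epsilon>) (\<lambda>\<rho>. \<phi> \<rho> - S2 0 \<phi>b \<rho>) (norm x)
                - (LINT s:{0<..<t}|lebesgue. S1 ((t - s) / \<epsilon>) (\<lambda>\<rho>. dtw \<phi>b v \<rho> s) (norm x))"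
      unfolding is_solution_def Let_def by simp
    from bspec[OF this x(1)] t' show "w r t = S2 t \<phi>b r - (LINT s:{0<..<t}|lebesgue. S2 (t - s) (dnu (\<lambda>\<rho>. v \<rho> s) 1) r)"
      "v r t = S1 (t / \<epsilon>) (\<lambda>\<rho>. \<phi> \<rho> - S2 0 \<phi>b \<rho>) r
                - (LINT s:{0<..<t}|lebesgue. S1 ((t - s) / \<epsilon>) (\<lambda>\<rho>. dtw \<phi>b v \<rho> s) r)"
      unfolding x(2) by blast+
  qed
  have w: "w r t = sol_w \<phi>b g r t" if "1 \<le> r" "0 < t" for r t
    unfolding m(1)[OF that] F2_eq(4)[of g v, OF gs v1 that(2)]
    by (simp add: sol_w_def bdW_def S2_exp diff_divide_distrib)
  have v: "v r t = sol_v \<epsilon> F \<phi>b g r t" if "1 \<le> r" "0 < t" for r t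
  proof -
    have te: "0 < t / \<epsilon>" using e that by simp
    show ?thesis
      unfolding m(2)[OF that] duhamel(3)[of g v, OF gs v1 e that(2)] S1_eq(2)[OF F te ae]
      by (simp add: sol_v_def diff_divide_distrib)
  qed
  show "1 \<le> r \<Longrightarrow> 0 < t \<Longrightarrow> v r t = sol_v \<epsilon> F \<phi>b g r t" "1 \<le> r \<Longrightarrow> 0 < t \<Longrightarrow> w r t = sol_w \<phi>b g r t"
    using v w by auto
  show "volterra (sqrt (\<epsilon> / pi)) \<phi>b (flux0 \<epsilon> F) g"
    unfolding volterra_def
  proof (intro conjI gs allI impI)
    fix t :: real assume t: "0 < t"
    have "g t = - sol_v1 \<epsilon> F \<phi>b g 1 t"
      unfolding g_def by (rule dnu_eq(1)[OF sol_v_deriv[OF F gs[unfolded g_def] e t]]) (use v t in \<open>auto simp: g_def\<close>)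
    then show "g t = flux0 \<epsilon> F t + sqrt (\<epsilon> / pi) * conv ksqrt (source \<phi>b g) t" using sol_v1_at_1[OF e] by simp
  qed
qed

section \<open>Classical regularity\<close>

lemma interior_Omega: "interior Omega = {x. 1 < norm x}"
  unfolding Omega_def by (auto simp: interior_complement)

lemma frontier_Omega: "frontier Omega = {x. norm x = 1}"
  unfolding Omega_def by (auto simp: frontier_complement frontier_ball)

lemma open_exterior: "open {x :: real^3. 1 < norm x}"
  by (intro open_Collect_less continuous_intros)

lemma dir_deriv_eq:
  assumes "(U has_derivative U') (at x)" shows "dir_deriv b U x = U' b"
proof -
  have l: "linear U'" using assms has_derivative_linear by blast
  have 1: "((\<lambda>s::real. x + s *\<^sub>R b) has_derivative (\<lambda>s. s *\<^sub>R b)) (at 0)"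
    by (auto intro!: derivative_eq_intros)
  have "(U has_derivative U') (at (x + 0 *\<^sub>R b))" using assms by simp
  from has_derivative_compose[OF 1 this]
  have "((\<lambda>s. U (x + s *\<^sub>R b)) has_derivative (\<lambda>s. U' (s *\<^sub>R b))) (at 0)" by simp
  moreover have "(\<lambda>s. U' (s *\<^sub>R b)) = (*) (U' b)" using linear_scale[OF l] by (auto simp: mult.commute)
  ultimately have "((\<lambda>s. U (x + s *\<^sub>R b)) has_real_derivative U' b) (at 0)"
    by (simp add: has_field_derivative_def)
  then show ?thesis unfolding dir_deriv_def by (rule DERIV_imp_deriv)
qed

lemma rad_has_derivative:
  assumes f: "(f has_real_derivative D) (at (norm x))" and x: "x \<noteq> 0"
  shows "(rad f has_derivative (\<lambda>h. D * ((x \<bullet> h) / norm x))) (at x)"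
proof -
  have "(norm has_derivative (\<lambda>h. (x \<bullet> h) / norm x)) (at x)"
    using has_derivative_norm[OF x] by (simp add: sgn_div_norm divide_inverse mult.commute inner_commute)
  from has_derivative_compose[OF this f[unfolded has_field_derivative_def]]
  show ?thesis by (simp add: rad_def[abs_def])
qed

definition rad_dir :: "(real \<Rightarrow> real) \<Rightarrow> real^3 \<Rightarrow> real^3 \<Rightarrow> real" where
  "rad_dir f1 b x = f1 (norm x) * ((x \<bullet> b) / norm x)"

lemma rad_dir_has_derivative:
  assumes f: "(f1 has_real_derivative D) (at (norm x))" and x: "x \<noteq> 0"
  shows "(rad_dir f1 b has_derivative (\<lambda>h. D * ((x \<bullet> h) / norm x) * ((x \<bullet> b) / norm x)
      + f1 (norm x) * ((h \<bullet> b) / norm x - (x \<bullet> b) * (x \<bullet> h) / norm x ^ 3))) (at x)"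
proof -
  have n: "(norm has_derivative (\<lambda>h. (x \<bullet> h) / norm x)) (at x)"
    using has_derivative_norm[OF x] by (simp add: sgn_div_norm divide_inverse mult.commute inner_commute)
  have i: "((\<lambda>y. y \<bullet> b) has_derivative (\<lambda>h. h \<bullet> b)) (at x)" by (auto intro!: derivative_eq_intros)
  have "((\<lambda>y. (y \<bullet> b) / norm y) has_derivative (\<lambda>h. ((h \<bullet> b) * norm x - (x \<bullet> b) * ((x \<bullet> h) / norm x)) / (norm x * norm x))) (at x)"
    using x by (intro has_derivative_divide'[OF i n]) auto
  moreover have "((h \<bullet> b) * norm x - (x \<bullet> b) * ((x \<bullet> h) / norm x)) / (norm x * norm x)
     = (h \<bullet> b) / norm x - (x \<bullet> b) * (x \<bullet> h) / norm x ^ 3" for h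
    using x by (simp add: field_simps power3_eq_cube)
  ultimately have q: "((\<lambda>y. (y \<bullet> b) / norm y) has_derivative (\<lambda>h. (h \<bullet> b) / norm x - (x \<bullet> b) * (x \<bullet> h) / norm x ^ 3)) (at x)"
    by simp
  from has_derivative_mult[OF rad_has_derivative[OF f x] q]
  show ?thesis unfolding rad_dir_def[abs_def] rad_def by (simp add: add.commute)
qed

lemma dir_deriv_rad:
  assumes "\<And>r. 1 < r \<Longrightarrow> (f has_real_derivative f1 r) (at r)" and x: "1 < norm x"
  shows "dir_deriv b (rad f) x = rad_dir f1 b x"
proof -
  have "x \<noteq> 0" using x by auto
  from dir_deriv_eq[OF rad_has_derivative[OF assms(1)[OF x] this]] show ?thesis by (simp add: rad_dir_def)
qed

lemma dir_deriv_rad_has_derivative: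
  assumes f: "\<And>r. 1 < r \<Longrightarrow> (f has_real_derivative f1 r) (at r)" and f1: "(f1 has_real_derivative D) (at (norm x))"
    and x: "1 < norm x"
  shows "(dir_deriv b (rad f) has_derivative (\<lambda>h. D * ((x \<bullet> h) / norm x) * ((x \<bullet> b) / norm x)
      + f1 (norm x) * ((h \<bullet> b) / norm x - (x \<bullet> b) * (x \<bullet> h) / norm x ^ 3))) (at x)"
proof (rule has_derivative_transform_within_open[OF rad_dir_has_derivative[OF f1]])
  show "open {x :: real^3. 1 < norm x}" by (rule open_exterior)
qed (use x dir_deriv_rad[OF f] in auto)

definition rad_dir2 :: "(real \<Rightarrow> real) \<Rightarrow> (real \<Rightarrow> real) \<Rightarrow> real^3 \<Rightarrow> real^3 \<Rightarrow> real^3 \<Rightarrow> real" where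
  "rad_dir2 f1 f2 b c x = f2 (norm x) * ((x \<bullet> c) / norm x) * ((x \<bullet> b) / norm x)
      + f1 (norm x) * ((c \<bullet> b) / norm x - (x \<bullet> b) * (x \<bullet> c) / norm x ^ 3)"

lemma dir_deriv2_rad:
  assumes f: "\<And>r. 1 < r \<Longrightarrow> (f has_real_derivative f1 r) (at r)" and f1: "\<And>r. 1 < r \<Longrightarrow> (f1 has_real_derivative f2 r) (at r)"
    and x: "1 < norm x"
  shows "dir_deriv c (dir_deriv b (rad f)) x = rad_dir2 f1 f2 b c x"
  using dir_deriv_eq[OF dir_deriv_rad_has_derivative[OF f f1[OF x] x]] by (simp add: rad_dir2_def)

text \<open>The trace of the Hessian: the coordinates of the unit radial vector have squares summing
  to 1, and the term f' / r survives with multiplicity 3 - 1 = 2.\<close>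

lemma laplacian_rad:
  assumes f: "\<And>r. 1 < r \<Longrightarrow> (f has_real_derivative f1 r) (at r)" and f1: "\<And>r. 1 < r \<Longrightarrow> (f1 has_real_derivative f2 r) (at r)"
    and x: "1 < norm x"
  shows "laplacian (rad f) x = f2 (norm x) + 2 * f1 (norm x) / norm x"
proof -
  let ?n = "norm x"
  have n: "?n \<noteq> 0" using x by auto
  have s: "(\<Sum>b\<in>Basis. (x \<bullet> b) * (x \<bullet> b)) = ?n\<^sup>2"
    using euclidean_inner[of x x] by (simp add: power2_norm_eq_inner)
  have "laplacian (rad f) x = (\<Sum>b\<in>Basis. rad_dir2 f1 f2 b b x)"
    unfolding laplacian_def by (intro sum.cong refl dir_deriv2_rad f f1 x)
  also have "\<dots> = (\<Sum>b\<in>Basis. (f2 ?n / ?n\<^sup>2 - f1 ?n / ?n ^ 3) * ((x \<bullet> b) * (x \<bullet> b)) + f1 ?n / ?n)"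
    by (intro sum.cong refl)
      (use n in \<open>simp add: rad_dir2_def inner_Basis field_simps power2_eq_square power3_eq_cube\<close>)
  also have "\<dots> = (f2 ?n / ?n\<^sup>2 - f1 ?n / ?n ^ 3) * ?n\<^sup>2 + 3 * (f1 ?n / ?n)"
    unfolding sum.distrib sum_distrib_left[symmetric] s by simp
  also have "\<dots> = f2 ?n + 2 * f1 ?n / ?n"
    using n by (simp add: field_simps power2_eq_square power3_eq_cube)
  finally show ?thesis .
qed

lemma exterior_continuous:
  assumes "continuous_on ({1<..} \<times> {0<..}) (\<lambda>(r, t). u r t)"
  shows "continuous_on ({x :: real^3. 1 < norm x} \<times> {0<..}) (\<lambda>p. u (norm (fst p)) (snd p) :: real)"
proof -
  have "continuous_on ({x :: real^3. 1 < norm x} \<times> {0<..}) (\<lambda>p. (\<lambda>(r, t). u r t) (norm (fst p), snd p))"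
    by (rule continuous_on_compose2[OF assms]) (auto intro!: continuous_intros)
  then show ?thesis by simp
qed

lemma C21_rad:
  fixes u u1 u2 ut :: "real \<Rightarrow> real \<Rightarrow> real"
  assumes d1: "\<And>r t. 1 < r \<Longrightarrow> 0 < t \<Longrightarrow> ((\<lambda>r. u r t) has_real_derivative u1 r t) (at r)"
    and d2: "\<And>r t. 1 < r \<Longrightarrow> 0 < t \<Longrightarrow> ((\<lambda>r. u1 r t) has_real_derivative u2 r t) (at r)"
    and dt: "\<And>r t. 1 < r \<Longrightarrow> 0 < t \<Longrightarrow> ((\<lambda>t. u r t) has_real_derivative ut r t) (at t)"
    and c0: "continuous_on ({1..} \<times> {0<..}) (\<lambda>(r, t). u r t)"
    and c1: "continuous_on ({1<..} \<times> {0<..}) (\<lambda>(r, t). u1 r t)"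
    and c2: "continuous_on ({1<..} \<times> {0<..}) (\<lambda>(r, t). u2 r t)"
    and ct: "continuous_on ({1<..} \<times> {0<..}) (\<lambda>(r, t). ut r t)"
  shows "C21 (\<lambda>x t. rad (\<lambda>r. u r t) x)"
proof -
  let ?E = "{x :: real^3. 1 < norm x}"
  have A: "continuous_on (closure Omega \<times> {0<..}) (\<lambda>(x, t). rad (\<lambda>r. u r t) x)"
  proof -
    have "continuous_on (Omega \<times> {0<..}) (\<lambda>p. (\<lambda>(r, t). u r t) (norm (fst p), snd p))"
      by (rule continuous_on_compose2[OF c0]) (auto intro!: continuous_intros simp: norm_Omega)
    then show ?thesis by (simp add: closure_Omega rad_def case_prod_beta')
  qed
  have B: "(\<lambda>t. rad (\<lambda>r. u r t) x) differentiable (at t) \<and> rad (\<lambda>r. u r t) differentiable (at x) \<and>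
        (\<forall>b\<in>Basis. dir_deriv b (rad (\<lambda>r. u r t)) differentiable (at x))" if x: "1 < norm x" and t: "0 < t" for x t
  proof (intro conjI ballI)
    have x0: "x \<noteq> 0" using x by auto
    show "(\<lambda>t. rad (\<lambda>r. u r t) x) differentiable (at t)"
      unfolding rad_def using dt[OF x t] real_differentiable_def by blast
    show "rad (\<lambda>r. u r t) differentiable (at x)"
      using rad_has_derivative[OF d1[OF x t] x0] unfolding differentiable_def by blast
    show "dir_deriv b (rad (\<lambda>r. u r t)) differentiable (at x)" for b
      using dir_deriv_rad_has_derivative[OF d1[OF _ t] d2[OF x t] x, of b] unfolding differentiable_def by blast
  qed
  have C: "continuous_on (?E \<times> {0<..}) (\<lambda>(x, t). deriv (\<lambda>t. rad (\<lambda>r. u r t) x) t)"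
    by (rule continuous_on_eq[OF exterior_continuous[OF ct]]) (auto simp: rad_def DERIV_imp_deriv[OF dt])
  have D: "continuous_on (?E \<times> {0<..}) (\<lambda>(x, t). dir_deriv b (rad (\<lambda>r. u r t)) x)" for b
  proof (rule continuous_on_eq)
    show "continuous_on (?E \<times> {0<..}) (\<lambda>p. u1 (norm (fst p)) (snd p) * ((fst p \<bullet> b) / norm (fst p)))"
      by (intro continuous_intros exterior_continuous[OF c1]) auto
  qed (auto simp: dir_deriv_rad[OF d1] rad_dir_def)
  have E: "continuous_on (?E \<times> {0<..}) (\<lambda>(x, t). dir_deriv c (dir_deriv b (rad (\<lambda>r. u r t))) x)" for b c
  proof (rule continuous_on_eq)
    show "continuous_on (?E \<times> {0<..}) (\<lambda>p. u2 (norm (fst p)) (snd p) * ((fst p \<bullet> c) / norm (fst p)) * ((fst p \<bullet> b) / norm (fst p))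
      + u1 (norm (fst p)) (snd p) * ((c \<bullet> b) / norm (fst p) - (fst p \<bullet> b) * (fst p \<bullet> c) / norm (fst p) ^ 3))"
      by (intro continuous_intros exterior_continuous[OF c1] exterior_continuous[OF c2]) auto
  qed (auto simp: dir_deriv2_rad[OF d1 d2] rad_dir2_def)
  show ?thesis
    unfolding C21_def interior_Omega
  proof (intro conjI ballI allI impI)
    fix x :: "real^3" and t :: real assume "x \<in> ?E" "0 < t"
    then have xt: "1 < norm x" "0 < t" by auto
    note b = B[OF xt]
    show "(\<lambda>t. rad (\<lambda>r. u r t) x) differentiable (at t)" by (rule conjunct1[OF b])
    show "rad (\<lambda>r. u r t) differentiable (at x)" by (rule conjunct1[OF conjunct2[OF b]])
    show "dir_deriv c (rad (\<lambda>r. u r t)) differentiable (at x)" if "c \<in> Basis" for c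
      by (rule bspec[OF conjunct2[OF conjunct2[OF b]] that])
  qed (rule A C D E)+
qed

text \<open>
  Since \<open>bdW\<close> is an antiderivative of the source, adding \<open>w\<close> replaces the error kernel in the
  Duhamel term by the complementary one, which is smooth up to \<open>\<tau> = 0\<close> away from the boundary.
\<close>

lemma sol_sum_eq:
  assumes g: "sqrt_sing g" and e: "0 < \<epsilon>" and r: "1 \<le> r" and t: "0 < t"
  shows "sol_v \<epsilon> F \<phi>b g r t + sol_w \<phi>b g r t
    = (dirP F (t / \<epsilon>) r + \<phi>b + zconv \<epsilon> ec0 (source \<phi>b g) t r) / r"
proof -
  let ?h = "source \<phi>b g"
  have "zconv \<epsilon> ec0 ?h t r = (LINT s:{0<..<t}|lebesgue. ?h s - ?h s * erfk ((t - s) / \<epsilon>) r)"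
    unfolding zconv_def conv_def using e
    by (intro set_lebesgue_integral_cong) (auto simp: ec0_def algebra_simps divide_le_0_iff)
  also have "\<dots> = (LINT s:{0<..<t}|lebesgue. ?h s) - volQ \<epsilon> ?h t r"
    unfolding volQ_def conv_def
    by (intro set_integral_diff(2) sqrt_sing_integrable[OF sqrt_sing_source[OF g]] erfk_conv_integrable[OF sqrt_sing_source[OF g] e])
  also have "(LINT s:{0<..<t}|lebesgue. ?h s) = bdW \<phi>b g t - \<phi>b"
    using bdW_eq_integral[OF g t, of \<phi>b] by simp
  finally show ?thesis by (simp add: sol_v_def sol_w_def add_divide_distrib diff_divide_distrib)
qed

text \<open>\<open>U\<close> is r times u and satisfies eps * U_t = U_rr on the half-line, since
  both of its parts do; division by r turns this into the equation with the three-dimensional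
  Laplacian.\<close>

lemma sol_classical:
  assumes F: "lin_growth F A B" and v: "volterra (sqrt (\<epsilon> / pi)) \<phi>b (flux0 \<epsilon> F) g" and e: "0 < \<epsilon>"
  shows "classical_solution \<epsilon> (\<lambda>r t. sol_v \<epsilon> F \<phi>b g r t + sol_w \<phi>b g r t)"
proof -
  let ?u = "\<lambda>r t. sol_v \<epsilon> F \<phi>b g r t + sol_w \<phi>b g r t" and ?h = "source \<phi>b g"
  have g: "sqrt_sing g" using v by (simp add: volterra_def)
  note h = sqrt_sing_source[OF g, of \<phi>b]
  define U where "U r t = dirP F (t / \<epsilon>) r + \<phi>b + zconv \<epsilon> ec0 ?h t r" for r t
  define U1 where "U1 r t = dirP1 F (t / \<epsilon>) r + zconv \<epsilon> ec1 ?h t r" for r t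
  define U2 where "U2 r t = dirP2 F (t / \<epsilon>) r + zconv \<epsilon> ec2 ?h t r" for r t
  have uU: "?u r t = U r t / r" if "1 \<le> r" "0 < t" for r t
    using sol_sum_eq[OF g e that, of F \<phi>b] by (simp add: U_def)
  have te: "0 < t / \<epsilon>" if "0 < t" for t using that e by simp
  have dU: "((\<lambda>r. U r t) has_real_derivative U1 r t) (at r)" if "1 < r" "0 < t" for r t
    using DERIV_add[OF DERIV_add[OF dirP_derivs(1)[OF F te[OF that(2)]] DERIV_const] zconv_deriv[OF ext_kernel_ec(1,2) h e that(2,1) ec_derivs(1)]]
    unfolding U_def U1_def by simp
  have dU1: "((\<lambda>r. U1 r t) has_real_derivative U2 r t) (at r)" if "1 < r" "0 < t" for r t
    using DERIV_add[OF dirP_derivs(2)[OF F te[OF that(2)]] zconv_deriv[OF ext_kernel_ec(2,3) h e that(2,1) ec_derivs(2)]]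
    unfolding U1_def U2_def .
  have dUt: "((\<lambda>t. U r t) has_real_derivative U2 r t / \<epsilon>) (at t)" if "1 < r" "0 < t" for r t
  proof -
    have "((\<lambda>t. t / \<epsilon>) has_real_derivative 1 / \<epsilon>) (at t)" using e by (auto intro!: derivative_eq_intros)
    from DERIV_add[OF DERIV_add[OF DERIV_chain2[OF dirP_derivs(3)[OF F te[OF that(2)]] this] DERIV_const]
        zconv_deriv_time[OF ext_kernel_ec(1,3) h e that(2,1) ec_derivs(3)[OF that(1)]]]
    show ?thesis unfolding U_def U2_def by (simp add: add_divide_distrib)
  qed
  define u1 where "u1 r t = U1 r t / r - U r t / r\<^sup>2" for r t
  define u2 where "u2 r t = U2 r t / r - 2 * U1 r t / r\<^sup>2 + 2 * U r t / r ^ 3" for r t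
  define ut where "ut r t = U2 r t / \<epsilon> / r" for r t
  have d1: "((\<lambda>r. ?u r t) has_real_derivative u1 r t) (at r)" if "1 < r" "0 < t" for r t
  proof -
    have "((\<lambda>r. U r t / r) has_real_derivative (U1 r t * r - U r t * 1) / (r * r)) (at r)"
      by (intro DERIV_divide dU DERIV_ident) (use that in auto)
    moreover have "(U1 r t * r - U r t * 1) / (r * r) = u1 r t"
      using that by (simp add: u1_def diff_divide_distrib power2_eq_square)
    ultimately have "((\<lambda>r. U r t / r) has_real_derivative u1 r t) (at r)" by simp
    then show ?thesis
      by (rule has_field_derivative_transform_within_open[where S="{1<..}"]) (use that uU in auto)
  qed
  have d2: "((\<lambda>r. u1 r t) has_real_derivative u2 r t) (at r)" if "1 < r" "0 < t" for r t
  proof -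
    have "((\<lambda>r. r\<^sup>2) has_real_derivative 2 * r) (at r)" by (auto intro!: derivative_eq_intros)
    then have "((\<lambda>r. U1 r t / r - U r t / r\<^sup>2) has_real_derivative
       (U2 r t * r - U1 r t * 1) / (r * r) - (U1 r t * r\<^sup>2 - U r t * (2 * r)) / (r\<^sup>2 * r\<^sup>2)) (at r)"
      by (intro DERIV_diff DERIV_divide dU dU1 DERIV_ident) (use that in auto)
    moreover have "(U2 r t * r - U1 r t * 1) / (r * r) - (U1 r t * r\<^sup>2 - U r t * (2 * r)) / (r\<^sup>2 * r\<^sup>2) = u2 r t"
      using that by (simp add: u2_def diff_divide_distrib power2_eq_square power3_eq_cube mult_ac)
    ultimately show ?thesis unfolding u1_def by metis
  qed
  have dt: "((\<lambda>t. ?u r t) has_real_derivative ut r t) (at t)" if "1 < r" "0 < t" for r t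
  proof -
    have "((\<lambda>t. U r t / r) has_real_derivative ut r t) (at t)" unfolding ut_def by (intro DERIV_cdivide dUt that)
    then show ?thesis
      by (rule has_field_derivative_transform_within_open[where S="{0<..}"]) (use that uU in auto)
  qed
  have sw: "continuous_on ({1<..} \<times> {0<..}) (\<lambda>p. k (snd p) (fst p))"
    if "continuous_on ({0<..} \<times> {1<..}) (\<lambda>(t, r). k t r)" for k :: "real \<Rightarrow> real \<Rightarrow> real"
  proof -
    have "continuous_on ({1<..} \<times> {0<..}) (\<lambda>p. (\<lambda>(t, r). k t r) (snd p, fst p))"
      by (rule continuous_on_compose2[OF that]) (auto intro!: continuous_intros)
    then show ?thesis by simp
  qed
  have sp: "continuous_on ({1<..} \<times> {0<..}) (\<lambda>p. k (snd p / \<epsilon>) (fst p))"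
    if "continuous_on ({0<..} \<times> UNIV) (\<lambda>(\<tau>, r). k \<tau> r)" for k :: "real \<Rightarrow> real \<Rightarrow> real"
    using continuous_on_subset[OF time_kernel_continuous(1)[OF that e], of "{1<..} \<times> {0<..}"] by (auto simp: case_prod_beta')
  have cU: "continuous_on ({1<..} \<times> {0<..}) (\<lambda>p. U (fst p) (snd p))"
    "continuous_on ({1<..} \<times> {0<..}) (\<lambda>p. U1 (fst p) (snd p))"
    "continuous_on ({1<..} \<times> {0<..}) (\<lambda>p. U2 (fst p) (snd p))"
    unfolding U_def U1_def U2_def
    using sp[OF dirP_continuous(1)[OF F]] sp[OF dirP_continuous(2)[OF F]] sp[OF dirP_continuous(3)[OF F]]
      sw[OF zconv_continuous[OF ext_kernel_ec(1) h e]] sw[OF zconv_continuous[OF ext_kernel_ec(2) h e]] sw[OF zconv_continuous[OF ext_kernel_ec(3) h e]]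
    by (simp_all add: continuous_on_add)
  have c0: "continuous_on ({1..} \<times> {0<..}) (\<lambda>(r, t). ?u r t)"
    using continuous_on_add[OF sol_continuous(1)[OF F g e, of \<phi>b] sol_continuous(3)[OF F g e, of \<phi>b]]
    by (simp add: case_prod_beta')
  have c1: "continuous_on ({1<..} \<times> {0<..}) (\<lambda>(r, t). u1 r t)"
    unfolding u1_def case_prod_beta' by (intro continuous_intros cU) auto
  have c2: "continuous_on ({1<..} \<times> {0<..}) (\<lambda>(r, t). u2 r t)"
    unfolding u2_def case_prod_beta' by (intro continuous_intros cU) auto
  have ct: "continuous_on ({1<..} \<times> {0<..}) (\<lambda>(r, t). ut r t)"
    unfolding ut_def case_prod_beta' using e by (intro continuous_intros cU) auto
  have C: "C21 (\<lambda>x t. rad (\<lambda>r. ?u r t) x)"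
    by (rule C21_rad[of ?u u1 u2 ut, OF d1 d2 dt c0 c1 c2 ct])
  have PDE: "\<epsilon> * deriv (\<lambda>s. rad (\<lambda>r. ?u r s) x) t - laplacian (rad (\<lambda>r. ?u r t)) x = 0"
    if x: "1 < norm x" and t: "0 < t" for x :: "real^3" and t
  proof -
    have "deriv (\<lambda>s. rad (\<lambda>r. ?u r s) x) t = ut (norm x) t"
      unfolding rad_def by (rule DERIV_imp_deriv[OF dt[OF x t]])
    moreover have "laplacian (rad (\<lambda>r. ?u r t)) x = u2 (norm x) t + 2 * u1 (norm x) t / norm x"
      by (rule laplacian_rad[OF d1[OF _ t] d2[OF _ t] x])
    moreover have "\<epsilon> * ut r t = u2 r t + 2 * u1 r t / r" if "1 < r" for r
      using that e by (simp add: ut_def u2_def u1_def field_simps power2_eq_square power3_eq_cube)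
    ultimately show ?thesis using x by simp
  qed
  have BC: "?u 1 differentiable (at t) \<and> (\<lambda>\<rho>. ?u \<rho> t) differentiable (at 1 within {1..}) \<and>
      deriv (?u 1) t + dnu (\<lambda>\<rho>. ?u \<rho> t) 1 = 0" if t: "0 < t" for t
  proof -
    \<comment> \<open>On the boundary v vanishes and u is the boundary value of w, with time
      derivative - W - g; the normal derivative of u is g from v plus W from W / r.\<close>
    have u1t: "?u 1 = bdW \<phi>b g" by (rule ext) (simp add: sol_v_def sol_w_def)
    have dW: "(?u 1 has_real_derivative source \<phi>b g t) (at t)" unfolding u1t by (rule bdW_deriv[OF g t])
    have "((\<lambda>r. bdW \<phi>b g t / r) has_real_derivative - bdW \<phi>b g t) (at 1)"
      by (auto intro!: derivative_eq_intros)
    from DERIV_add[OF sol_v_deriv[OF F g e t order_refl, of \<phi>b] this]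
    have dr: "((\<lambda>\<rho>. ?u \<rho> t) has_real_derivative sol_v1 \<epsilon> F \<phi>b g 1 t + - bdW \<phi>b g t) (at 1)"
      unfolding sol_w_def .
    note n = dnu_eq[OF dr order_refl refl]
    have "- sol_v1 \<epsilon> F \<phi>b g 1 t = g t" using sol_v1_at_1[OF e, of F \<phi>b g t] v t by (simp add: volterra_def)
    then have "deriv (?u 1) t + dnu (\<lambda>\<rho>. ?u \<rho> t) 1 = 0"
      unfolding n(1) DERIV_imp_deriv[OF dW] by (simp add: source_def bdW_def)
    moreover have "?u 1 differentiable (at t)" using dW real_differentiable_def by blast
    ultimately show ?thesis using n(2) by blast
  qed
  show ?thesis
    unfolding classical_solution_def interior_Omega frontier_Omega
  proof (intro conjI ballI allI impI)
    show "C21 (\<lambda>x t. rad (\<lambda>r. ?u r t) x)" by (rule C)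
  qed (use PDE BC in auto)
qed

section \<open>Radial profiles of measurable functions\<close>

lemma AE_lebesgue_negligible: "(AE x in lebesgue. P x) \<longleftrightarrow> negligible {x. \<not> P x}" for P :: "'a::euclidean_space \<Rightarrow> bool"
  by (metis Collect_mono eventually_ae_filter_negligible negligible_subset)

text \<open>Fubini: for almost every x the slice of the product is null, whereas a point of
  \<open>N\<close> has the non-null slice \<open>D\<close>.\<close>

lemma negligible_Times_box:
  fixes N :: "'a::euclidean_space set" and D :: "'b::euclidean_space set"
  assumes "negligible (N \<times> D)" "\<not> negligible D" shows "negligible N"
proof -
  have "AE p in lebesgue. p \<notin> N \<times> D" using assms(1) unfolding AE_lebesgue_negligible by simp
  then have "AE p in (lborel \<Otimes>\<^sub>M lborel). p \<notin> N \<times> D" by (simp only: AE_completion_iff lborel_prod)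
  then have "AE x in lborel. AE y in lborel. (x, y) \<notin> N \<times> D" by (rule lborel_pair.AE_pair)
  then have "AE x in lborel. x \<notin> N"
  proof eventually_elim
    case (elim x)
    show ?case
    proof
      assume "x \<in> N"
      with elim have "AE y in lborel. y \<notin> D" by simp
      then have "AE y in lebesgue. y \<notin> D" by (simp add: AE_completion_iff)
      then show False using assms(2) unfolding AE_lebesgue_negligible by simp
    qed
  qed
  then have "AE x in lebesgue. x \<notin> N" by (simp add: AE_completion_iff)
  then show ?thesis unfolding AE_lebesgue_negligible by simp
qed

text \<open>
  The map \<open>x \<mapsto> (norm x, x\<^sub>2, x\<^sub>3)\<close> is differentiable away from the origin, so it carries the null set
  of points with radius in \<open>N\<close> to a null set, and the latter contains \<open>N \<times> box\<close>.
\<close>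

lemma negligible_radii:
  fixes N :: "real set"
  assumes N: "N \<subseteq> {1<..}" and neg: "negligible {x :: real^3. norm x \<in> N}"
  shows "negligible N"
proof -
  let ?S = "{x :: real^3. norm x \<in> N}"
  let ?f = "\<lambda>x :: real^3. (norm x, x $ 2, x $ 3)"
  let ?D = "cbox (0, 0) (1/2, 1/2) :: (real \<times> real) set"
  have "?f differentiable_on ?S"
    unfolding differentiable_on_def
  proof
    fix x assume "x \<in> ?S"
    then have x: "x \<noteq> 0" using N by force
    have "(?f has_derivative (\<lambda>h. (sgn x \<bullet> h, h $ 2, h $ 3))) (at x)"
      by (intro has_derivative_Pair bounded_linear.has_derivative[OF bounded_linear_vec_nth] has_derivative_ident)
        (use has_derivative_norm[OF x] in \<open>simp add: inner_commute\<close>)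
    then show "?f differentiable (at x within ?S)"
      unfolding differentiable_def using has_derivative_at_withinI by blast
  qed
  then have "negligible (?f ` ?S)"
    by (intro negligible_differentiable_image_negligible neg) auto
  moreover have "N \<times> ?D \<subseteq> ?f ` ?S"
  proof (clarsimp simp: cbox_Pair_eq)
    fix r y z :: real assume r: "r \<in> N" and yz: "0 \<le> y" "y * 2 \<le> 1" "0 \<le> z" "z * 2 \<le> 1"
    have r1: "1 < r" using r N by auto
    have "y\<^sup>2 \<le> (1/2)\<^sup>2" "z\<^sup>2 \<le> (1/2)\<^sup>2" using yz by (intro power_mono; simp)+
    moreover have "1 \<le> r\<^sup>2" using r1 by (simp add: one_le_power)
    ultimately have p: "0 \<le> r\<^sup>2 - y\<^sup>2 - z\<^sup>2" by (simp add: power2_eq_square)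
    let ?x = "vector [sqrt (r\<^sup>2 - y\<^sup>2 - z\<^sup>2), y, z] :: real^3"
    have "norm ?x = r"
      using p r1 by (simp add: norm_vec_def L2_set_def sum_3)
    then show "(r, y, z) \<in> ?f ` ?S"
      using r by (intro image_eqI[of _ _ ?x]) auto
  qed
  ultimately have "negligible (N \<times> ?D)" by (rule negligible_subset)
  moreover have "\<not> negligible ?D" by (auto simp: negligible_interval box_eq_empty Basis_prod_def)
  ultimately show ?thesis by (rule negligible_Times_box)
qed

text \<open>A measurable set is a countable union of compacts up to a null set. The radii of the
  compact part form a countable union of compact sets; any further radius has its whole sphere
  inside the null part, so such radii are null by \<open>negligible_radii\<close>.\<close>

lemma lebesgue_radii:
  fixes A :: "real set"
  assumes A: "A \<subseteq> {1<..}" and m: "{x :: real^3. norm x \<in> A} \<in> sets lebesgue"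
  shows "A \<in> sets lebesgue"
proof -
  obtain C T where CT: "fsigma C" "T \<in> null_sets lebesgue" "C \<union> T = {x :: real^3. norm x \<in> A}" "disjnt C T"
    using lebesgue_set_almost_fsigma[OF m] .
  obtain K :: "nat \<Rightarrow> (real^3) set" where K: "range K \<subseteq> Collect compact" "C = \<Union> (range K)"
    using CT(1) unfolding fsigma_Union_compact by blast
  let ?B = "norm ` C"
  have BA: "?B \<subseteq> A" using CT(3) by auto
  have "compact (norm ` K i)" for i
    using K(1) by (intro compact_continuous_image continuous_intros) auto
  then have "norm ` K i \<in> sets lebesgue" for i by (rule fmeasurableD[OF lmeasurable_compact])
  then have "(\<Union>i. norm ` K i) \<in> sets lebesgue"
    by (intro sets.countable_UN) auto
  then have B: "?B \<in> sets lebesgue" unfolding K(2) by (simp add: image_UN)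
  have "{x :: real^3. norm x \<in> A - ?B} \<subseteq> T" using CT(3) by blast
  then have "negligible {x :: real^3. norm x \<in> A - ?B}"
    using CT(2) negligible_iff_null_sets negligible_subset by blast
  then have "negligible (A - ?B)" using A by (intro negligible_radii) auto
  then have "A - ?B \<in> sets lebesgue" by (rule negligible_imp_sets)
  then have "?B \<union> (A - ?B) \<in> sets lebesgue" using B by (intro sets.Un)
  then show ?thesis using BA by (simp add: Un_absorb1)
qed

lemma Omega_lebesgue: "Omega \<in> sets lebesgue"
  unfolding Omega_def by (auto intro: closed_Compl)

lemma AE_radial:
  assumes "AE x in lebesgue_on Omega. P (norm x)"
  shows "AE r in lebesgue. 1 < r \<longrightarrow> P r"
proof -
  have "AE x::real^3 in lebesgue. x \<in> Omega \<longrightarrow> P (norm x)"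
    using assms Omega_lebesgue by (simp add: AE_restrict_space_iff)
  then have "negligible {x::real^3. \<not> (x \<in> Omega \<longrightarrow> P (norm x))}" by (simp add: AE_lebesgue_negligible)
  then have "negligible {x::real^3. norm x \<in> {r. 1 < r \<and> \<not> P r}}"
    by (rule negligible_subset) (auto simp: norm_Omega)
  then have "negligible {r. 1 < r \<and> \<not> P r}" by (rule negligible_radii[rotated]) auto
  then show ?thesis by (simp add: AE_lebesgue_negligible)
qed

lemma Linf_norm_AE: "AE r in lebesgue. 1 < r \<longrightarrow> ereal \<bar>f r\<bar> \<le> Linf_norm f"
  unfolding Linf_norm_def using esssup_AE[where M="lebesgue_on Omega" and f="\<lambda>x. ereal \<bar>rad f x\<bar>"]
  by (intro AE_radial) (simp add: rad_def)

lemma AE_radius_witness: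
  assumes "AE r in lebesgue. (1::real) < r \<longrightarrow> P r" and S: "open S" "S \<noteq> {}" "S \<subseteq> {1<..}"
  obtains r where "r \<in> S" "P r"
proof -
  have "\<not> S \<subseteq> {r. \<not> (1 < r \<longrightarrow> P r)}"
    using assms(1) open_not_negligible[OF S(1,2)] negligible_subset unfolding AE_lebesgue_negligible by blast
  then show ?thesis using S(3) that by auto
qed

text \<open>Pointwise nonnegativity alone does not suffice, since an essential supremum over a null
  space would be minus infinity; a radius that satisfies the almost everywhere bound settles
  it.\<close>

lemma Linf_norm_nonneg: "0 \<le> Linf_norm f"
proof -
  have "(2::real) \<in> {1<..}" by simp
  then have "{1::real<..} \<noteq> {}" by blast
  then obtain r where "ereal \<bar>f r\<bar> \<le> Linf_norm f"
    using AE_radius_witness[OF Linf_norm_AE[of f] open_greaterThan _ order_refl] by blast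
  then show ?thesis by (meson abs_ge_zero ereal_less_eq(5) order_trans)
qed

lemma Linf_norm_real:
  assumes "Linf_norm f < \<infinity>"
  obtains m where "0 \<le> m" "Linf_norm f = ereal m" "AE r in lebesgue. 1 < r \<longrightarrow> \<bar>f r\<bar> \<le> m"
proof -
  obtain m where m: "Linf_norm f = ereal m" using assms Linf_norm_nonneg[of f] by (cases "Linf_norm f") auto
  show thesis
    using that[of m] Linf_norm_nonneg[of f] Linf_norm_AE[of f] by (simp add: m)
qed

lemma Linf_norm_le:
  assumes c: "continuous_on {1..} f" and b: "\<And>r. 1 \<le> r \<Longrightarrow> \<bar>f r\<bar> \<le> m"
  shows "Linf_norm f \<le> ereal m"
  unfolding Linf_norm_def
proof (rule esssup_I)
  have "continuous_on Omega (rad f)"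
    unfolding rad_def[abs_def] by (rule continuous_on_compose2[OF c]) (auto intro!: continuous_intros simp: norm_Omega)
  from continuous_imp_measurable_on_sets_lebesgue[OF this Omega_lebesgue]
  show "(\<lambda>x. ereal \<bar>rad f x\<bar>) \<in> borel_measurable (lebesgue_on Omega)" by measurable
  show "AE x in lebesgue_on Omega. ereal \<bar>rad f x\<bar> \<le> ereal m"
    by (intro AE_I2) (use b in \<open>auto simp: rad_def norm_Omega\<close>)
qed

text \<open>An open set where the bound fails would have positive measure, so it holds for r > 1,
  and then at r = 1 as a limit. It makes the flux at the boundary, a null set, accessible from the
  L^infinity norm.\<close>

lemma Linf_norm_pointwise:
  assumes c: "continuous_on {1..} f" and m: "Linf_norm f \<le> ereal m" and r: "1 \<le> r"
  shows "\<bar>f r\<bar> \<le> m"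
proof -
  have ae: "AE r in lebesgue. 1 < r \<longrightarrow> \<bar>f r\<bar> \<le> m"
    using Linf_norm_AE[of f] by (rule eventually_mono) (use m order_trans in fastforce)
  have c': "continuous_on {1<..} (\<lambda>r. \<bar>f r\<bar>)"
    by (intro continuous_intros continuous_on_subset[OF c]) auto
  have gt: "\<bar>f r\<bar> \<le> m" if r: "1 < r" for r
  proof (rule ccontr)
    assume n: "\<not> \<bar>f r\<bar> \<le> m"
    have "open ((\<lambda>r. \<bar>f r\<bar>) -` {m<..} \<inter> {1<..})"
      using c' by (subst (asm) continuous_on_open_vimage) (auto simp: Int_commute)
    moreover have "r \<in> (\<lambda>r. \<bar>f r\<bar>) -` {m<..} \<inter> {1<..}" using n r by auto
    ultimately obtain q where "q \<in> (\<lambda>r. \<bar>f r\<bar>) -` {m<..} \<inter> {1<..}" "\<bar>f q\<bar> \<le> m"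
      using AE_radius_witness[OF ae] by blast
    then show False by auto
  qed
  show ?thesis
  proof (cases "r = 1")
    case True
    have "((\<lambda>r. \<bar>f r\<bar>) \<longlongrightarrow> \<bar>f 1\<bar>) (at 1 within {1..})"
      using c by (intro tendsto_intros) (auto simp: continuous_on_def)
    then have "((\<lambda>r. \<bar>f r\<bar>) \<longlongrightarrow> \<bar>f 1\<bar>) (at_right 1)" by (simp add: at_within_Ici_at_right)
    then have "\<bar>f 1\<bar> \<le> m"
      by (rule tendsto_upperbound) (use gt eventually_at_right_less[of 1] in \<open>auto elim!: eventually_mono\<close>)
    then show ?thesis using True by simp
  qed (use gt r in auto)
qed

text \<open>Measurability of the function on R^3 passes to its profile through the superlevel sets,
  by \<open>lebesgue_radii\<close>.\<close>

lemma radial_measurable: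
  assumes "rad f \<in> borel_measurable (lebesgue_on Omega)"
  shows "(\<lambda>r. indicator {1<..} r * f r) \<in> borel_measurable lebesgue"
proof -
  have "{r. 1 < r \<and> a < f r} \<in> sets lebesgue" for a
  proof (rule lebesgue_radii)
    have "{x \<in> Omega. a < rad f x} \<in> sets (lebesgue_on Omega)"
      using assms unfolding borel_measurable_iff_greater by (simp add: space_restrict_space)
    then have "{x \<in> Omega. a < rad f x} \<in> sets lebesgue"
      using Omega_lebesgue by (auto simp: sets_restrict_space_iff)
    moreover have "{x :: real^3. 1 < norm x} \<in> sets lebesgue"
      using open_exterior by (intro sets_completionI_sets) (simp add: borel_open)
    ultimately have "{x \<in> Omega. a < rad f x} \<inter> {x. 1 < norm x} \<in> sets lebesgue" by (rule sets.Int)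
    moreover have "{x \<in> Omega. a < rad f x} \<inter> {x. 1 < norm x} = {x. norm x \<in> {r. 1 < r \<and> a < f r}}"
      by (auto simp: norm_Omega rad_def)
    ultimately show "{x :: real^3. norm x \<in> {r. 1 < r \<and> a < f r}} \<in> sets lebesgue" by simp
  qed auto
  then have "f \<in> borel_measurable (lebesgue_on {1<..})"
    unfolding borel_measurable_iff_greater by (auto simp: space_restrict_space sets_restrict_space_iff)
  then have "(\<lambda>r. indicator {1<..} r *\<^sub>R f r) \<in> borel_measurable lebesgue"
    by (subst (asm) borel_measurable_restrict_space_iff) auto
  then show ?thesis by simp
qed

text \<open>The representative is obtained by clamping the profile of r * \<Phi> between plus and
  minus the growth bound; this changes it only on a null set.\<close>

lemma data_exists_gen:
  assumes f: "in_Linf \<phi>" and AB: "0 \<le> A" "0 \<le> B"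
    and b: "AE \<rho> in lebesgue. 1 < \<rho> \<longrightarrow> \<bar>\<rho> * \<phi> \<rho> - \<phi>b\<bar> \<le> A + B * \<bar>\<rho>\<bar>"
  obtains F where "data \<phi> \<phi>b F A B"
proof -
  let ?F0 = "\<lambda>\<rho>. \<rho> * (indicator {1<..} \<rho> * \<phi> \<rho>) - indicator {1<..} \<rho> * \<phi>b"
  let ?l = "\<lambda>\<rho>::real. A + B * \<bar>\<rho>\<bar>"
  let ?F = "\<lambda>\<rho>. max (- ?l \<rho>) (min (?l \<rho>) (?F0 \<rho>))"
  have i: "(\<lambda>\<rho>. indicator {1<..} \<rho> * \<phi> \<rho>) \<in> borel_measurable lebesgue"
    using f by (intro radial_measurable) (simp add: in_Linf_def)
  have x: "(\<lambda>\<rho>::real. \<rho>) \<in> borel_measurable lebesgue"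
    by (intro continuous_lebesgue_measurable continuous_on_id)
  have c: "(\<lambda>\<rho>::real. indicator {1<..} \<rho> * \<phi>b) \<in> borel_measurable lebesgue"
    by (intro borel_measurable_times borel_measurable_indicator borel_measurable_const) auto
  have l: "?l \<in> borel_measurable lebesgue" "(\<lambda>\<rho>. - ?l \<rho>) \<in> borel_measurable lebesgue"
    by (intro continuous_lebesgue_measurable continuous_intros)+
  have "?F \<in> borel_measurable lebesgue"
    by (intro borel_measurable_max borel_measurable_min l borel_measurable_diff[OF borel_measurable_times[OF x i] c])
  then have F: "lin_growth ?F A B" unfolding lin_growth_def
    using AB mult_nonneg_nonneg[OF AB(2) abs_ge_zero] by (auto simp: abs_le_iff min_def max_def)
  have "AE \<rho> in lebesgue. indicator {1<..} \<rho> * (\<rho> * (\<phi> \<rho> - S2 0 \<phi>b \<rho>)) = ?F \<rho>"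
    using b
  proof eventually_elim
    case (elim \<rho>)
    show ?case
    proof (cases "1 < \<rho>")
      case True
      then have "\<rho> * (\<phi> \<rho> - S2 0 \<phi>b \<rho>) = \<rho> * \<phi> \<rho> - \<phi>b" by (simp add: S2_def right_diff_distrib)
      moreover have "max (- a) (min a y) = y" if "\<bar>y\<bar> \<le> a" for a y :: real using that by auto
      ultimately show ?thesis using elim True by simp
    next
      case False
      have "max (- a) (min a 0) = 0" if "0 \<le> a" for a :: real using that by simp
      from this[OF add_nonneg_nonneg[OF AB(1) mult_nonneg_nonneg[OF AB(2) abs_ge_zero[of \<rho>]]]]
      show ?thesis using False by simp
    qed
  qed
  then show thesis using F that unfolding data_def by blast
qed

text \<open>For bounded data the growth rate \<open>m\<close> is the L^infinity norm of the
  datum.\<close>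

lemma data_exists:
  assumes f: "in_Linf \<phi>" obtains F m where "data \<phi> \<phi>b F \<bar>\<phi>b\<bar> m"
proof -
  obtain m where m: "0 \<le> m" "AE r in lebesgue. 1 < r \<longrightarrow> \<bar>\<phi> r\<bar> \<le> m"
    using f Linf_norm_real[of \<phi>] unfolding in_Linf_def by metis
  have "AE \<rho> in lebesgue. 1 < \<rho> \<longrightarrow> \<bar>\<rho> * \<phi> \<rho> - \<phi>b\<bar> \<le> \<bar>\<phi>b\<bar> + m * \<bar>\<rho>\<bar>"
    using m(2)
  proof eventually_elim
    case (elim \<rho>)
    show ?case
    proof
      assume r: "1 < \<rho>"
      have "\<bar>\<rho> * \<phi> \<rho>\<bar> \<le> \<bar>\<rho>\<bar> * m" unfolding abs_mult using elim r by (intro mult_left_mono) auto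
      then show "\<bar>\<rho> * \<phi> \<rho> - \<phi>b\<bar> \<le> \<bar>\<phi>b\<bar> + m * \<bar>\<rho>\<bar>"
        using abs_triangle_ineq4[of "\<rho> * \<phi> \<rho>" \<phi>b] by (simp add: mult.commute)
    qed
  qed
  from data_exists_gen[OF f abs_ge_zero m(1) this] show thesis using that by blast
qed

text \<open>Boundedness of \<rho> * \<phi> allows growth rate 0, the case in which all later bounds
  are uniform in eps.\<close>

lemma data_exists_decay:
  assumes f: "in_Linf \<phi>" and d: "Linf_norm (\<lambda>\<rho>. \<rho> * \<phi> \<rho>) = ereal M"
  obtains F where "data \<phi> \<phi>b F (M + \<bar>\<phi>b\<bar>) 0"
proof -
  have M: "0 \<le> M" using Linf_norm_nonneg[of "\<lambda>\<rho>. \<rho> * \<phi> \<rho>"] d by simp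
  have "AE \<rho> in lebesgue. 1 < \<rho> \<longrightarrow> \<bar>\<rho> * \<phi> \<rho> - \<phi>b\<bar> \<le> M + \<bar>\<phi>b\<bar> + 0 * \<bar>\<rho>\<bar>"
    using Linf_norm_AE[of "\<lambda>\<rho>. \<rho> * \<phi> \<rho>"] unfolding d
    by eventually_elim (auto intro: order_trans[OF abs_triangle_ineq4])
  from data_exists_gen[OF f add_nonneg_nonneg[OF M abs_ge_zero] order_refl this] show thesis using that by blast
qed

section \<open>Estimates and the main theorem\<close>

lemma sqrt_eps_div_pi_le: "0 < \<epsilon> \<Longrightarrow> sqrt (\<epsilon> / pi) \<le> sqrt \<epsilon>"
  using pi_gt3 by (simp add: divide_le_eq)

text \<open>In the flux of the free evolution the A part carries 1 / sqrt (t / \<epsilon>) and hence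
  sqrt \<epsilon>. In the B part also a growth sqrt (t / \<epsilon>) occurs and cancels it, leaving
  24 * B. The fixed point multiplies both by 4.\<close>

lemma volterra_solution_exists:
  assumes F: "lin_growth F A B" and e: "0 < \<epsilon>" "\<epsilon> \<le> 1"
  obtains g where "volterra (sqrt (\<epsilon> / pi)) \<phi>b (flux0 \<epsilon> F) g"
    "\<And>t. 0 < t \<Longrightarrow> \<bar>g t\<bar> \<le> (16 * sqrt \<epsilon> * (A + B + \<bar>\<phi>b\<bar>) + 96 * B) * weight t"
proof -
  have AB: "0 \<le> A" "0 \<le> B" using F by (auto simp: lin_growth_def)
  let ?G = "4 * sqrt \<epsilon> * (A + B) + 24 * B"
  have G: "0 \<le> ?G" using AB e by simp
  have c: "continuous_on {0<..} (flux0 \<epsilon> F)"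
    unfolding flux0_def using time_kernel_continuous(2)[OF dirP_continuous(2)[OF F] e(1)] by (intro continuous_on_minus)
  have b: "\<bar>flux0 \<epsilon> F t\<bar> \<le> ?G * weight t" if t: "0 < t" for t
  proof -
    have te: "0 < t / \<epsilon>" using e t by simp
    have "\<bar>flux0 \<epsilon> F t\<bar> \<le> (4 / sqrt (t / \<epsilon>)) * (A + B * 1 + 6 * B * sqrt (t / \<epsilon>))"
      using dirP_bounds(2)[OF F te order_refl] by (simp add: flux0_def)
    also have "\<dots> = 4 * (A + B) / sqrt (t / \<epsilon>) + 24 * B"
    proof -
      have "(4 / s) * (A + B * 1 + 6 * B * s) = 4 * (A + B) / s + 24 * B" if "0 < s" for s
        using that by (simp add: field_simps)
      then show ?thesis using te by simp
    qed
    also have "\<dots> = 4 * sqrt \<epsilon> * (A + B) * (1 / sqrt t) + 24 * B * 1"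
      using e t by (simp add: real_sqrt_divide)
    also have "\<dots> \<le> 4 * sqrt \<epsilon> * (A + B) * weight t + 24 * B * weight t"
      using AB e t by (intro add_mono mult_left_mono inverse_sqrt_le_weight one_le_weight) auto
    finally show ?thesis by (simp add: algebra_simps)
  qed
  have a: "0 \<le> sqrt (\<epsilon> / pi)" "sqrt (\<epsilon> / pi) \<le> 1" using e pi_gt3 by auto
  obtain g where g: "volterra (sqrt (\<epsilon> / pi)) \<phi>b (flux0 \<epsilon> F) g"
    "\<And>t. 0 < t \<Longrightarrow> \<bar>g t\<bar> \<le> (4 * ?G + 2 * sqrt (\<epsilon> / pi) * \<bar>\<phi>b\<bar>) * weight t"
    using volterra_exists[OF c b G a] by metis
  show thesis
  proof (rule that[OF g(1)])
    fix t :: real assume t: "0 < t"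
    have "sqrt (\<epsilon> / pi) * \<bar>\<phi>b\<bar> \<le> sqrt \<epsilon> * \<bar>\<phi>b\<bar>" by (intro mult_right_mono sqrt_eps_div_pi_le e) auto
    moreover have "0 \<le> sqrt \<epsilon> * \<bar>\<phi>b\<bar>" using e by simp
    ultimately have "4 * ?G + 2 * sqrt (\<epsilon> / pi) * \<bar>\<phi>b\<bar> \<le> 16 * sqrt \<epsilon> * (A + B + \<bar>\<phi>b\<bar>) + 96 * B"
      by (simp add: algebra_simps)
    then show "\<bar>g t\<bar> \<le> (16 * sqrt \<epsilon> * (A + B + \<bar>\<phi>b\<bar>) + 96 * B) * weight t"
      using g(2)[OF t] weight_pos[OF t] by (meson mult_right_mono order_trans less_imp_le)
  qed
qed

text \<open>v and the convolution are each estimated twice. One bound stays finite as t tends to 0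
  and serves the sup norm; the weighted one blows up there but, when B = 0 and
  \<open>\<Gamma>\<close> is of order sqrt \<epsilon>, is itself of order sqrt \<epsilon> and serves
  the limit.\<close>

lemma sol_estimates:
  fixes \<phi>b :: real
  assumes F: "lin_growth F A B" and g: "sqrt_sing g" and gb': "\<forall>t>0. \<bar>g t\<bar> \<le> \<Gamma> * weight t" and G: "0 \<le> \<Gamma>"
    and e: "0 < \<epsilon>" and t: "0 < t" and r: "1 \<le> r"
  defines "H \<equiv> \<bar>\<phi>b\<bar> + 3 / 2 * \<Gamma>"
  shows "\<bar>sol_v \<epsilon> F \<phi>b g r t\<bar> \<le> 3 * (A + B + 6 * B * sqrt (t / \<epsilon>)) + 2 * (H * exp (lam * t)) * sqrt t"
    "\<bar>sol_v \<epsilon> F \<phi>b g r t\<bar> \<le> (4 / sqrt (t / \<epsilon>)) * (A + B * r + 6 * B * sqrt (t / \<epsilon>)) + sqrt \<epsilon> * H * weight t"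
    "sqrt (t / \<epsilon>) * \<bar>sol_v1 \<epsilon> F \<phi>b g r t\<bar> \<le> 8 * (A + B + 6 * B * sqrt (t / \<epsilon>)) + 2 * H * exp (lam * t)"
    "\<bar>conv kexp g t\<bar> \<le> 2 * (\<Gamma> * exp (lam * t)) * sqrt t"
    "\<bar>conv kexp g t\<bar> \<le> \<Gamma> * weight t"
proof -
  have gb: "\<bar>g t\<bar> \<le> \<Gamma> * weight t" if "0 < t" for t using gb' that by blast
  let ?h = "source \<phi>b g" let ?\<tau> = "t / \<epsilon>" let ?X = "A + B + 6 * B * sqrt ?\<tau>"
  have AB: "0 \<le> A" "0 \<le> B" using F by (auto simp: lin_growth_def)
  have te: "0 < ?\<tau>" using e t by simp
  have H: "0 \<le> H" using G by (simp add: H_def)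
  have W: "0 < weight t" by (rule weight_pos[OF t])
  note h = sqrt_sing_source[OF g, of \<phi>b]
  have hb: "\<bar>?h s\<bar> \<le> H * weight s" if "0 < s" for s
    unfolding H_def by (rule source_bound[OF g gb G that, of "s + 1"]) auto
  have loc: "C * weight s \<le> (C * exp (lam * t)) / sqrt s" if "0 < s" "s < t" "0 \<le> C" for C s
    using mult_left_mono[OF weight_le[of s t] that(3)] that by simp
  have "\<bar>volQ \<epsilon> ?h t r\<bar> \<le> 2 * (H * exp (lam * t)) * sqrt t"
    unfolding volQ_def conv_def
  proof (rule sqrt_sing_integral_bound[OF _ _ t])
    show "continuous_on {0<..<t} (\<lambda>s. ?h s * erfk ((t - s) / \<epsilon>) r)"
      by (intro continuous_intros sqrt_sing_cont[OF h] continuous_on_compose2[OF erfk_time_continuous(2)[OF e]]) auto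
    fix s assume s: "0 < s" "s < t"
    have "0 < (t - s) / \<epsilon>" using s e by simp
    from erfk_range(1,2)[OF this r] have "\<bar>?h s\<bar> * \<bar>erfk ((t - s) / \<epsilon>) r\<bar> \<le> \<bar>?h s\<bar> * 1"
      by (intro mult_left_mono) auto
    also have "\<dots> \<le> H * weight s" using hb[OF s(1)] by simp
    also have "\<dots> \<le> (H * exp (lam * t)) / sqrt s" by (rule loc[OF s H])
    finally show "\<bar>?h s * erfk ((t - s) / \<epsilon>) r\<bar> \<le> (H * exp (lam * t)) / sqrt s" by (simp add: abs_mult)
  qed
  then have Q1: "\<bar>volQ \<epsilon> ?h t r\<bar> \<le> 2 * (H * exp (lam * t)) * sqrt t" .
  have half: "H * (c * sqrt (\<epsilon> / pi)) * (weight t / 2) \<le> c * (sqrt \<epsilon> * H * weight t)" if "0 \<le> c" for c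
  proof -
    have "H * (c * sqrt (\<epsilon> / pi)) * (weight t / 2) \<le> H * (c * sqrt \<epsilon>) * weight t"
      using H W that e sqrt_eps_div_pi_le[OF e] by (intro mult_mono mult_nonneg_nonneg mult_left_mono) auto
    then show ?thesis by (simp add: mult_ac)
  qed
  have "\<bar>volQ \<epsilon> ?h t r\<bar> \<le> H * (\<bar>r - 1\<bar> * sqrt (\<epsilon> / pi)) * (weight t / 2)"
    unfolding volQ_def
    by (rule conv_bound[OF sqrt_sing_cont[OF h] hb erfk_time_continuous(2)[OF e] erfk_time_bound[OF e] H _ t]) (use e in auto)
  also have "\<dots> \<le> \<bar>r - 1\<bar> * (sqrt \<epsilon> * H * weight t)" by (rule half) simp
  also have "\<dots> \<le> r * (sqrt \<epsilon> * H * weight t)" using r H W e by (intro mult_right_mono) auto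
  finally have Q2: "\<bar>volQ \<epsilon> ?h t r\<bar> \<le> r * (sqrt \<epsilon> * H * weight t)" .
  have "\<bar>volQ1 \<epsilon> ?h t r\<bar> \<le> H * (1 * sqrt (\<epsilon> / pi)) * (weight t / 2)"
    unfolding volQ1_def
    by (rule conv_bound[OF sqrt_sing_cont[OF h] hb heatk_time_continuous(2)[OF e] _ H _ t])
      (use e heatk_time_bound[OF e] in auto)
  also have "\<dots> \<le> 1 * (sqrt \<epsilon> * H * weight t)" by (rule half) simp
  finally have Q3: "\<bar>volQ1 \<epsilon> ?h t r\<bar> \<le> sqrt \<epsilon> * H * weight t" by simp
  note P = dirP_bounds[OF F te r]
  have r_div: "x / r \<le> y" if "x \<le> r * y" for x y using that r by (simp add: divide_le_eq mult.commute)
  \<comment> \<open>Since r >= 1, the growth is at most linear in r, and division by r restores a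
    bound uniform in space.\<close>
  have Xr: "A + B * r + 6 * B * sqrt ?\<tau> \<le> r * ?X"
  proof -
    have "A \<le> r * A" "6 * B * sqrt ?\<tau> \<le> r * (6 * B * sqrt ?\<tau>)"
      using mult_right_mono[OF r AB(1)] mult_right_mono[OF r, of "6 * B * sqrt ?\<tau>"] AB te by auto
    then show ?thesis by (simp add: algebra_simps)
  qed
  have v: "\<bar>sol_v \<epsilon> F \<phi>b g r t\<bar> \<le> \<bar>dirP F ?\<tau> r\<bar> / r + \<bar>volQ \<epsilon> ?h t r\<bar> / r"
    using r abs_triangle_ineq4[of "dirP F ?\<tau> r" "volQ \<epsilon> ?h t r"]
    by (simp add: sol_v_def abs_divide add_divide_distrib[symmetric] divide_right_mono)
  show "\<bar>sol_v \<epsilon> F \<phi>b g r t\<bar> \<le> 3 * ?X + 2 * (H * exp (lam * t)) * sqrt t"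
  proof -
    have "3 * (A + B * r + 6 * B * sqrt ?\<tau>) \<le> 3 * (r * ?X)" by (rule mult_left_mono[OF Xr]) simp
    also have "\<dots> = r * (3 * ?X)" by (rule mult.left_commute)
    finally have "\<bar>dirP F ?\<tau> r\<bar> / r \<le> 3 * ?X" using P(1) by (intro r_div) (rule order_trans)
    moreover have "\<bar>volQ \<epsilon> ?h t r\<bar> / r \<le> \<bar>volQ \<epsilon> ?h t r\<bar>"
      using r mult_right_mono[OF r abs_ge_zero[of "volQ \<epsilon> ?h t r"]] by (intro r_div) simp
    ultimately show ?thesis using v Q1 by linarith
  qed
  show v2: "\<bar>sol_v \<epsilon> F \<phi>b g r t\<bar> \<le> (4 / sqrt ?\<tau>) * (A + B * r + 6 * B * sqrt ?\<tau>) + sqrt \<epsilon> * H * weight t"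
  proof -
    have "\<bar>dirP F ?\<tau> r\<bar> / r \<le> (4 / sqrt ?\<tau>) * (A + B * r + 6 * B * sqrt ?\<tau>)"
      by (rule r_div) (use P(3) in \<open>simp add: mult_ac\<close>)
    moreover have "\<bar>volQ \<epsilon> ?h t r\<bar> / r \<le> sqrt \<epsilon> * H * weight t" by (rule r_div[OF Q2])
    ultimately show ?thesis using v by linarith
  qed
  show "sqrt ?\<tau> * \<bar>sol_v1 \<epsilon> F \<phi>b g r t\<bar> \<le> 8 * ?X + 2 * H * exp (lam * t)"
  proof -
    \<comment> \<open>The factor in front of the normal derivative is tuned so that both eps and the
      singularity at t = 0 cancel.\<close>
    have s: "sqrt ?\<tau> * (sqrt \<epsilon> * H * weight t) = H * exp (lam * t)"
      using e t by (simp add: weight_def real_sqrt_divide)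
    have "\<bar>sol_v1 \<epsilon> F \<phi>b g r t\<bar> \<le> (\<bar>dirP1 F ?\<tau> r\<bar> + \<bar>volQ1 \<epsilon> ?h t r\<bar> + \<bar>sol_v \<epsilon> F \<phi>b g r t\<bar>) / r"
    proof -
      have "sol_v1 \<epsilon> F \<phi>b g r t = (dirP1 F ?\<tau> r - volQ1 \<epsilon> ?h t r - sol_v \<epsilon> F \<phi>b g r t) / r"
        by (simp add: sol_v1_def diff_divide_distrib)
      then have "\<bar>sol_v1 \<epsilon> F \<phi>b g r t\<bar> = \<bar>dirP1 F ?\<tau> r - volQ1 \<epsilon> ?h t r - sol_v \<epsilon> F \<phi>b g r t\<bar> / r" using r by (simp add: abs_divide)
      also have "\<dots> \<le> (\<bar>dirP1 F ?\<tau> r\<bar> + \<bar>volQ1 \<epsilon> ?h t r\<bar> + \<bar>sol_v \<epsilon> F \<phi>b g r t\<bar>) / r"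
        using r by (intro divide_right_mono) auto
      finally show ?thesis .
    qed
    also have "\<dots> \<le> ((8 / sqrt ?\<tau>) * (r * ?X) + 2 * (sqrt \<epsilon> * H * weight t)) / r"
    proof (intro divide_right_mono)
      have "(4 / sqrt ?\<tau>) * (A + B * r + 6 * B * sqrt ?\<tau>) \<le> (4 / sqrt ?\<tau>) * (r * ?X)"
        using te by (intro mult_left_mono Xr) auto
      moreover have "(8 / sqrt ?\<tau>) * (r * ?X) = (4 / sqrt ?\<tau>) * (r * ?X) + (4 / sqrt ?\<tau>) * (r * ?X)" by simp
      ultimately show "\<bar>dirP1 F ?\<tau> r\<bar> + \<bar>volQ1 \<epsilon> ?h t r\<bar> + \<bar>sol_v \<epsilon> F \<phi>b g r t\<bar> \<le> (8 / sqrt ?\<tau>) * (r * ?X) + 2 * (sqrt \<epsilon> * H * weight t)"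
        using P(2) Q3 v2 by linarith
    qed (use r in auto)
    also have "\<dots> = (8 / sqrt ?\<tau>) * ?X + 2 * (sqrt \<epsilon> * H * weight t) / r"
      using r by (simp add: add_divide_distrib)
    also have "\<dots> \<le> (8 / sqrt ?\<tau>) * ?X + 2 * (sqrt \<epsilon> * H * weight t)"
    proof -
      have "2 * (sqrt \<epsilon> * H * weight t) \<le> r * (2 * (sqrt \<epsilon> * H * weight t))"
        using mult_right_mono[OF r, of "2 * (sqrt \<epsilon> * H * weight t)"] H W e by simp
      from r_div[OF this] show ?thesis by simp
    qed
    finally have "sqrt ?\<tau> * \<bar>sol_v1 \<epsilon> F \<phi>b g r t\<bar> \<le> sqrt ?\<tau> * ((8 / sqrt ?\<tau>) * ?X + 2 * (sqrt \<epsilon> * H * weight t))"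
      using te by (intro mult_left_mono) auto
    also have "\<dots> = 8 * ?X + 2 * (sqrt ?\<tau> * (sqrt \<epsilon> * H * weight t))"
    proof -
      have "q * ((8 / q) * y + 2 * z) = 8 * y + 2 * (q * z)" if "q \<noteq> 0" for q y z :: real
        using that by (simp add: algebra_simps)
      moreover have "sqrt ?\<tau> \<noteq> 0" using t e by simp
      ultimately show ?thesis by blast
    qed
    finally show ?thesis unfolding s by simp
  qed
  show "\<bar>conv kexp g t\<bar> \<le> 2 * (\<Gamma> * exp (lam * t)) * sqrt t"
    unfolding conv_def
  proof (rule sqrt_sing_integral_bound[OF _ _ t])
    show "continuous_on {0<..<t} (\<lambda>s. g s * kexp (t - s))"
      by (intro continuous_intros sqrt_sing_cont[OF g] continuous_on_compose2[OF continuous_kexp]) auto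
    fix s assume s: "0 < s" "s < t"
    have "\<bar>g s\<bar> * \<bar>kexp (t - s)\<bar> \<le> \<bar>g s\<bar> * 1" using s by (intro mult_left_mono) (auto simp: kexp_def)
    also have "\<dots> \<le> \<Gamma> * weight s" using gb[OF s(1)] by simp
    also have "\<dots> \<le> (\<Gamma> * exp (lam * t)) / sqrt s" by (rule loc[OF s G])
    finally show "\<bar>g s * kexp (t - s)\<bar> \<le> (\<Gamma> * exp (lam * t)) / sqrt s" by (simp add: abs_mult)
  qed
  have "\<bar>conv kexp g t\<bar> \<le> \<Gamma> * 1 * (weight t / 2)"
    by (rule conv_bound[OF sqrt_sing_cont[OF g] gb continuous_kexp kexp_bound G _ t]) auto
  also have "\<dots> \<le> \<Gamma> * weight t" using G W by simp
  finally show "\<bar>conv kexp g t\<bar> \<le> \<Gamma> * weight t" .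
qed

text \<open>The constant 11 is 3 from v plus 8 from its derivative. Only the B term involves T /
  \<epsilon>, so for B = 0 the dependence on eps is confined to \<open>\<Gamma>\<close>.\<close>

lemma sup_norm_bound:
  assumes F: "lin_growth F A B" and g: "sqrt_sing g" and gb: "\<And>t. 0 < t \<Longrightarrow> \<bar>g t\<bar> \<le> \<Gamma> * weight t" and G: "0 \<le> \<Gamma>"
    and e: "0 < \<epsilon>"
    and v: "\<And>r t. 1 \<le> r \<Longrightarrow> 0 < t \<Longrightarrow> v r t = sol_v \<epsilon> F \<phi>b g r t"
    and w: "\<And>r t. 1 \<le> r \<Longrightarrow> 0 < t \<Longrightarrow> w r t = sol_w \<phi>b g r t"
  shows "sup_norm \<epsilon> T v w \<le> ereal (11 * (A + B + 6 * B * sqrt (T / \<epsilon>))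
      + 2 * (\<bar>\<phi>b\<bar> + 3 / 2 * \<Gamma>) * exp (lam * T) * (1 + sqrt T) + \<bar>\<phi>b\<bar> + 2 * \<Gamma> * exp (lam * T) * sqrt T)"
proof -
  let ?H = "\<bar>\<phi>b\<bar> + 3 / 2 * \<Gamma>"
  have AB: "0 \<le> A" "0 \<le> B" using F by (auto simp: lin_growth_def)
  have "Linf_norm (\<lambda>r. v r t) + ereal (sqrt (t / \<epsilon>)) * Linf_norm (dnu (\<lambda>\<rho>. v \<rho> t)) + Linf_norm (\<lambda>r. w r t)
     \<le> ereal (11 * (A + B + 6 * B * sqrt (T / \<epsilon>))
      + 2 * ?H * exp (lam * T) * (1 + sqrt T) + \<bar>\<phi>b\<bar> + 2 * \<Gamma> * exp (lam * T) * sqrt T)"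
    if tT: "t \<in> {0<..<T}" for t
  proof -
    have t: "0 < t" "t \<le> T" using tT by auto
    have gb': "\<forall>t>0. \<bar>g t\<bar> \<le> \<Gamma> * weight t" using gb by blast
    note E = sol_estimates[OF F g gb' G e t(1)]
    let ?X = "A + B + 6 * B * sqrt (t / \<epsilon>)" and ?Y = "A + B + 6 * B * sqrt (T / \<epsilon>)"
    have XY: "?X \<le> ?Y" using t e AB by (intro add_left_mono mult_left_mono) (auto simp: divide_right_mono)
    have et: "exp (lam * t) \<le> exp (lam * T)" "sqrt t \<le> sqrt T" using t lam_pos by auto
    have H: "0 \<le> ?H" using G by simp
    have eT: "C * exp (lam * t) \<le> C * exp (lam * T)" "2 * (C * exp (lam * t)) * sqrt t \<le> 2 * (C * exp (lam * T)) * sqrt T" if "0 \<le> C" for C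
      using that et t by (intro mult_mono; simp)+
    have slice: "continuous_on {1..} (\<lambda>r. k r t)" if "continuous_on ({1..} \<times> {0<..}) (\<lambda>(r, t). k r t)" for k :: "real \<Rightarrow> real \<Rightarrow> real"
    proof -
      have "continuous_on {1..} (\<lambda>r. (\<lambda>(r, t). k r t) (r, t))"
        by (rule continuous_on_compose2[OF that]) (use t in \<open>auto intro!: continuous_intros\<close>)
      then show ?thesis by simp
    qed
    note c = sol_continuous[OF F g e, of \<phi>b]
    have 1: "Linf_norm (\<lambda>r. v r t) \<le> ereal (3 * ?Y + 2 * (?H * exp (lam * T)) * sqrt T)"
    proof (rule Linf_norm_le)
      show "continuous_on {1..} (\<lambda>r. v r t)"
        by (rule continuous_on_eq[OF slice[OF c(1)]]) (use v t in auto)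
      show "\<bar>v r t\<bar> \<le> 3 * ?Y + 2 * (?H * exp (lam * T)) * sqrt T" if "1 \<le> r" for r
      proof -
        have "a \<le> 3 * y + q" if "a \<le> 3 * x + p" "x \<le> y" "p \<le> q" for a x y p q :: real using that by linarith
        from this[OF E(1)[OF that, of \<phi>b] XY eT(2)[OF H]] show ?thesis using v[OF that t(1)] by simp
      qed
    qed
    have d: "dnu (\<lambda>\<rho>. v \<rho> t) r = - sol_v1 \<epsilon> F \<phi>b g r t" if "1 \<le> r" for r
      by (rule dnu_eq(1)[OF sol_v_deriv[OF F g e t(1) that] that]) (use v t in auto)
    have s: "0 < sqrt (t / \<epsilon>)" using t e by simp
    have "Linf_norm (dnu (\<lambda>\<rho>. v \<rho> t)) \<le> ereal ((8 * ?Y + 2 * ?H * exp (lam * T)) / sqrt (t / \<epsilon>))"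
    proof (rule Linf_norm_le)
      show "continuous_on {1..} (dnu (\<lambda>\<rho>. v \<rho> t))"
        by (rule continuous_on_eq[OF continuous_on_minus[OF slice[OF c(2)]]]) (use d in auto)
      fix r :: real assume r: "1 \<le> r"
      have "sqrt (t / \<epsilon>) * \<bar>sol_v1 \<epsilon> F \<phi>b g r t\<bar> \<le> 8 * ?Y + 2 * ?H * exp (lam * T)"
      proof -
        have "a \<le> 8 * y + 2 * h * q" if "a \<le> 8 * x + 2 * h * p" "x \<le> y" "h * p \<le> h * q" for a x y p q h :: real using that by linarith
        from this[OF E(3)[OF r, of \<phi>b] XY eT(1)[OF H]] show ?thesis .
      qed
      then show "\<bar>dnu (\<lambda>\<rho>. v \<rho> t) r\<bar> \<le> (8 * ?Y + 2 * ?H * exp (lam * T)) / sqrt (t / \<epsilon>)"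
        unfolding d[OF r] using s by (simp add: pos_le_divide_eq mult.commute)
    qed
    then have "ereal (sqrt (t / \<epsilon>)) * Linf_norm (dnu (\<lambda>\<rho>. v \<rho> t)) \<le> ereal (sqrt (t / \<epsilon>)) * ereal ((8 * ?Y + 2 * ?H * exp (lam * T)) / sqrt (t / \<epsilon>))"
      using s by (intro ereal_mult_left_mono) auto
    also have "\<dots> = ereal (8 * ?Y + 2 * ?H * exp (lam * T))"
    proof -
      have "sqrt (t / \<epsilon>) * (x / sqrt (t / \<epsilon>)) = x" for x using t e by simp
      then show ?thesis by (simp only: times_ereal.simps)
    qed
    finally have 2: "ereal (sqrt (t / \<epsilon>)) * Linf_norm (dnu (\<lambda>\<rho>. v \<rho> t)) \<le> ereal (8 * ?Y + 2 * ?H * exp (lam * T))" .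
    have 3: "Linf_norm (\<lambda>r. w r t) \<le> ereal (\<bar>\<phi>b\<bar> + 2 * (\<Gamma> * exp (lam * T)) * sqrt T)"
    proof (rule Linf_norm_le)
      show "continuous_on {1..} (\<lambda>r. w r t)"
        by (rule continuous_on_eq[OF slice[OF c(3)]]) (use w t in auto)
      fix r :: real assume r: "1 \<le> r"
      have "\<bar>bdW \<phi>b g t\<bar> \<le> \<bar>\<phi>b\<bar> * 1 + \<bar>conv kexp g t\<bar>"
      proof -
        have "\<bar>\<phi>b * exp (- t)\<bar> \<le> \<bar>\<phi>b\<bar> * 1" unfolding abs_mult using t by (intro mult_left_mono) auto
        then show ?thesis unfolding bdW_def using abs_triangle_ineq4[of "\<phi>b * exp (- t)" "conv kexp g t"] by linarith
      qed
      also have "\<dots> \<le> \<bar>\<phi>b\<bar> + 2 * (\<Gamma> * exp (lam * T)) * sqrt T" using E(4)[OF r] eT(2)[OF G] by simp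
      finally have b: "\<bar>bdW \<phi>b g t\<bar> \<le> \<bar>\<phi>b\<bar> + 2 * (\<Gamma> * exp (lam * T)) * sqrt T" .
      have "\<bar>w r t\<bar> = \<bar>bdW \<phi>b g t\<bar> / r" using w[OF r t(1)] r by (simp add: sol_w_def abs_divide)
      also have "\<dots> \<le> \<bar>bdW \<phi>b g t\<bar>" using r mult_left_mono[OF r abs_ge_zero[of "bdW \<phi>b g t"]] by (simp add: divide_le_eq)
      finally show "\<bar>w r t\<bar> \<le> \<bar>\<phi>b\<bar> + 2 * (\<Gamma> * exp (lam * T)) * sqrt T" using b by linarith
    qed
    have "Linf_norm (\<lambda>r. v r t) + ereal (sqrt (t / \<epsilon>)) * Linf_norm (dnu (\<lambda>\<rho>. v \<rho> t)) + Linf_norm (\<lambda>r. w r t)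
      \<le> ereal (3 * ?Y + 2 * (?H * exp (lam * T)) * sqrt T) + ereal (8 * ?Y + 2 * ?H * exp (lam * T)) + ereal (\<bar>\<phi>b\<bar> + 2 * (\<Gamma> * exp (lam * T)) * sqrt T)"
      by (intro add_mono 1 2 3)
    also have "\<dots> = ereal (11 * ?Y + 2 * ?H * exp (lam * T) * (1 + sqrt T) + \<bar>\<phi>b\<bar> + 2 * \<Gamma> * exp (lam * T) * sqrt T)"
    proof -
      have "(3 * y + 2 * (h * E) * s) + (8 * y + 2 * h * E) + (p + 2 * (c * E) * s) = 11 * y + 2 * h * E * (1 + s) + p + 2 * c * E * s" for y h E s p c :: real
        by (simp add: algebra_simps)
      then show ?thesis unfolding plus_ereal.simps by (intro arg_cong[where f=ereal])
    qed
    finally show ?thesis .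
  qed
  then show ?thesis unfolding sup_norm_def by (rule SUP_least)
qed

lemma bounded_solution_flux:
  assumes s: "bounded_global_solution \<epsilon> \<phi> \<phi>b v w" and e: "0 < \<epsilon>"
  shows "sqrt_sing (\<lambda>t. dnu (\<lambda>\<rho>. v \<rho> t) 1)"
  unfolding sqrt_sing_def
proof (intro conjI allI impI)
  have c: "continuous_on ({1..} \<times> {0<..}) (\<lambda>(r, t). dnu (\<lambda>\<rho>. v \<rho> t) r)"
    using s unfolding bounded_global_solution_def is_solution_def cont_radial_infinity by blast
  have "continuous_on {0<..} (\<lambda>t. (\<lambda>(r, t). dnu (\<lambda>\<rho>. v \<rho> t) r) (1, t))"
    by (rule continuous_on_compose2[OF c]) (auto intro!: continuous_intros)
  then show "continuous_on {0<..} (\<lambda>t. dnu (\<lambda>\<rho>. v \<rho> t) 1)" by simp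
  fix T :: real assume T: "0 < T"
  then have fin: "sup_norm \<epsilon> T v w < \<infinity>" using s by (simp add: bounded_global_solution_def)
  define S where "S = real_of_ereal (sup_norm \<epsilon> T v w)"
  have "\<bar>dnu (\<lambda>\<rho>. v \<rho> t) 1\<bar> \<le> (S * sqrt \<epsilon>) / sqrt t" if tT: "t \<in> {0<..<T}" for t
  proof -
    let ?a = "Linf_norm (\<lambda>r. v r t)" and ?L = "Linf_norm (dnu (\<lambda>\<rho>. v \<rho> t))" and ?c = "Linf_norm (\<lambda>r. w r t)"
    let ?s = "sqrt (t / \<epsilon>)"
    have s0: "0 < ?s" using tT e by simp
    have nn: "0 \<le> ?a" "0 \<le> ?L" "0 \<le> ?c" by (rule Linf_norm_nonneg)+
    have "?a + ereal ?s * ?L + ?c \<le> sup_norm \<epsilon> T v w"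
      unfolding sup_norm_def by (rule SUP_upper[OF tT])
    moreover have "ereal ?s * ?L \<le> ?a + ereal ?s * ?L + ?c"
      using nn by (metis add.commute add_increasing2 order_refl)
    ultimately have le: "ereal ?s * ?L \<le> sup_norm \<epsilon> T v w" by (rule order_trans[rotated])
    have gen: "L \<noteq> \<infinity>" if "ereal q * L < \<infinity>" "0 < q" for q L using that by (cases L) auto
    have "?L \<noteq> \<infinity>" by (rule gen[OF le_less_trans[OF le fin] s0])
    then obtain l where l: "?L = ereal l" using nn(2) by (cases ?L) auto
    have "0 \<le> sup_norm \<epsilon> T v w" using le nn(2) s0 by (metis ereal_0_le_mult ereal_less_eq(5) less_imp_le order_trans)
    then have "sup_norm \<epsilon> T v w = ereal S" using fin unfolding S_def by (cases "sup_norm \<epsilon> T v w") auto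
    then have sl: "?s * l \<le> S" using le unfolding l by simp
    have "continuous_on {1..} (\<lambda>r. (\<lambda>(r, t). dnu (\<lambda>\<rho>. v \<rho> t) r) (r, t))"
      by (rule continuous_on_compose2[OF c]) (use tT in \<open>auto intro!: continuous_intros\<close>)
    then have "continuous_on {1..} (dnu (\<lambda>\<rho>. v \<rho> t))" by simp
    then have "\<bar>dnu (\<lambda>\<rho>. v \<rho> t) 1\<bar> \<le> l" by (rule Linf_norm_pointwise) (use l in auto)
    also have "l \<le> S / ?s" using sl s0 by (simp add: pos_le_divide_eq mult.commute)
    also have "\<dots> = (S * sqrt \<epsilon>) / sqrt t" by (simp add: real_sqrt_divide)
    finally show ?thesis .
  qed
  then show "\<exists>H. \<forall>t\<in>{0<..<T}. \<bar>dnu (\<lambda>\<rho>. v \<rho> t) 1\<bar> \<le> H / sqrt t" by blast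
qed

text \<open>The flux of a given solution is a priori O(1 / sqrt t) with an unknown constant.
  Uniqueness identifies it with the fixed point, whose bound is quantitative in the data and in
  eps.\<close>

lemma bounded_solution_structure:
  assumes d: "data \<phi> \<phi>b F A B" and e: "0 < \<epsilon>" "\<epsilon> \<le> 1" and s: "bounded_global_solution \<epsilon> \<phi> \<phi>b v w"
  obtains g where "volterra (sqrt (\<epsilon> / pi)) \<phi>b (flux0 \<epsilon> F) g"
    "\<And>t. 0 < t \<Longrightarrow> \<bar>g t\<bar> \<le> (16 * sqrt \<epsilon> * (A + B + \<bar>\<phi>b\<bar>) + 96 * B) * weight t"
    "\<And>r t. 1 \<le> r \<Longrightarrow> 0 < t \<Longrightarrow> v r t = sol_v \<epsilon> F \<phi>b g r t" "\<And>r t. 1 \<le> r \<Longrightarrow> 0 < t \<Longrightarrow> w r t = sol_w \<phi>b g r t"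
proof -
  have F: "lin_growth F A B" using d by (simp add: data_def)
  have sol: "is_solution \<epsilon> \<infinity> \<phi> \<phi>b v w" using s by (simp add: bounded_global_solution_def)
  let ?g = "\<lambda>t. dnu (\<lambda>\<rho>. v \<rho> t) 1"
  note R = solution_representation[OF d e(1) sol bounded_solution_flux[OF s e(1)]]
  obtain g where g: "volterra (sqrt (\<epsilon> / pi)) \<phi>b (flux0 \<epsilon> F) g"
    "\<And>t. 0 < t \<Longrightarrow> \<bar>g t\<bar> \<le> (16 * sqrt \<epsilon> * (A + B + \<bar>\<phi>b\<bar>) + 96 * B) * weight t"
    using volterra_solution_exists[OF F e] by metis
  have a: "0 \<le> sqrt (\<epsilon> / pi)" "sqrt (\<epsilon> / pi) \<le> 1" using e pi_gt3 by auto
  show thesis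
  proof (rule that[of ?g])
    show "\<bar>?g t\<bar> \<le> (16 * sqrt \<epsilon> * (A + B + \<bar>\<phi>b\<bar>) + 96 * B) * weight t" if "0 < t" for t
      using g(2)[OF that] volterra_unique[OF R(1) g(1) a that] by simp
  qed (use R in auto)
qed

lemma source_cong:
  assumes "\<And>s. 0 < s \<Longrightarrow> g s = g' s" "0 < t" shows "source \<phi>b g t = source \<phi>b g' t"
  unfolding source_def using assms conv_cong[of t g g' kexp] by simp

lemma sol_cong:
  assumes "\<And>s. 0 < s \<Longrightarrow> g s = g' s" "0 < t"
  shows "sol_v \<epsilon> F \<phi>b g r t = sol_v \<epsilon> F \<phi>b g' r t" "sol_w \<phi>b g r t = sol_w \<phi>b g' r t"
  unfolding sol_v_def sol_w_def volQ_def bdW_def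
  using conv_cong[of t "source \<phi>b g" "source \<phi>b g'", OF source_cong[OF assms(1)]] conv_cong[of t g g', OF assms(1)] by simp_all

lemma inverse_sqrt_pi_less_1: "1 / sqrt pi < 1"
  using pi_gt3 by simp

lemma well_posedness:
  assumes e: "0 < \<epsilon>" "\<epsilon> < 1 / sqrt pi" and f: "in_Linf \<phi>"
  shows "\<exists>v w. bounded_global_solution \<epsilon> \<phi> \<phi>b v w \<and>
          (\<forall>v' w'. bounded_global_solution \<epsilon> \<phi> \<phi>b v' w' \<longrightarrow>
             (\<forall>r\<ge>1. \<forall>t>0. v' r t = v r t \<and> w' r t = w r t)) \<and>
          classical_solution \<epsilon> (\<lambda>r t. v r t + w r t)"
proof -
  \<comment> \<open>The restriction on eps keeps the Volterra coefficient sqrt (eps / pi) at most 1,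
    as the contraction requires.\<close>
  have e1: "\<epsilon> \<le> 1" using e inverse_sqrt_pi_less_1 by linarith
  obtain F B where d: "data \<phi> \<phi>b F \<bar>\<phi>b\<bar> B" using data_exists[OF f] by metis
  have F: "lin_growth F \<bar>\<phi>b\<bar> B" using d by (simp add: data_def)
  obtain g where g: "volterra (sqrt (\<epsilon> / pi)) \<phi>b (flux0 \<epsilon> F) g"
    "\<And>t. 0 < t \<Longrightarrow> \<bar>g t\<bar> \<le> (16 * sqrt \<epsilon> * (\<bar>\<phi>b\<bar> + B + \<bar>\<phi>b\<bar>) + 96 * B) * weight t"
    using volterra_solution_exists[OF F e(1) e1] by metis
  have gs: "sqrt_sing g" using g by (simp add: volterra_def)
  have G: "0 \<le> 16 * sqrt \<epsilon> * (\<bar>\<phi>b\<bar> + B + \<bar>\<phi>b\<bar>) + 96 * B" using F e by (auto simp: lin_growth_def)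
  have a: "0 \<le> sqrt (\<epsilon> / pi)" "sqrt (\<epsilon> / pi) \<le> 1" using e1 e pi_gt3 by auto
  show ?thesis
  proof (intro exI conjI allI impI)
    have fin: "ereal x < \<infinity>" for x by simp
    have "sup_norm \<epsilon> T (sol_v \<epsilon> F \<phi>b g) (sol_w \<phi>b g) < \<infinity>" for T
      by (rule le_less_trans[OF sup_norm_bound[OF F gs g(2) G e(1) refl refl] fin])
    then show "bounded_global_solution \<epsilon> \<phi> \<phi>b (sol_v \<epsilon> F \<phi>b g) (sol_w \<phi>b g)"
      unfolding bounded_global_solution_def using sol_is_solution[OF d g(1) e(1)] by simp
    show "classical_solution \<epsilon> (\<lambda>r t. sol_v \<epsilon> F \<phi>b g r t + sol_w \<phi>b g r t)"
      by (rule sol_classical[OF F g(1) e(1)])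
    fix v' w' and r t :: real assume s: "bounded_global_solution \<epsilon> \<phi> \<phi>b v' w'" and r: "1 \<le> r" and t: "0 < t"
    obtain g' where g': "volterra (sqrt (\<epsilon> / pi)) \<phi>b (flux0 \<epsilon> F) g'"
      "\<And>r t. 1 \<le> r \<Longrightarrow> 0 < t \<Longrightarrow> v' r t = sol_v \<epsilon> F \<phi>b g' r t" "\<And>r t. 1 \<le> r \<Longrightarrow> 0 < t \<Longrightarrow> w' r t = sol_w \<phi>b g' r t"
      using bounded_solution_structure[OF d e(1) e1 s] by metis
    have eq: "g' s = g s" if "0 < s" for s by (rule volterra_unique[OF g'(1) g(1) a that])
    show "v' r t = sol_v \<epsilon> F \<phi>b g r t" using g'(2)[OF r t] sol_cong(1)[OF eq t] by simp
    show "w' r t = sol_w \<phi>b g r t" using g'(3)[OF r t] sol_cong(2)[OF eq t] by simp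
  qed
qed

text \<open>The difference u - S2 t \<phi>b equals v minus the memory term of w. With B = 0 both are
  O(sqrt \<epsilon>) times \<open>weight t\<close>, and the weight is bounded for times above
  \<open>\<tau>1\<close>; its blow-up at t = 0 is why the estimate stays away from the initial
  time.\<close>

lemma vanishing_limit:
  assumes f: "in_Linf \<phi>" and fin: "Linf_norm (\<lambda>\<rho>. \<rho> * \<phi> \<rho>) < \<infinity>" and tau: "0 < \<tau>1" "\<tau>1 < \<tau>2"
    and sol: "\<And>\<epsilon>. 0 < \<epsilon> \<Longrightarrow> \<epsilon> < 1 / sqrt pi \<Longrightarrow> bounded_global_solution \<epsilon> \<phi> \<phi>b (v \<epsilon>) (w \<epsilon>)"
  shows "((\<lambda>\<epsilon>. SUP t\<in>{\<tau>1<..<\<tau>2}. Linf_norm (\<lambda>r. v \<epsilon> r t + w \<epsilon> r t - S2 t \<phi>b r)) \<longlongrightarrow> 0) (at_right (0::real))"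
proof -
  obtain M where M: "0 \<le> M" "Linf_norm (\<lambda>\<rho>. \<rho> * \<phi> \<rho>) = ereal M" using Linf_norm_real[OF fin] by metis
  obtain F where d: "data \<phi> \<phi>b F (M + \<bar>\<phi>b\<bar>) 0" using data_exists_decay[OF f M(2)] by metis
  have F: "lin_growth F (M + \<bar>\<phi>b\<bar>) 0" using d by (simp add: data_def)
  let ?N = "M + \<bar>\<phi>b\<bar> + 0 + \<bar>\<phi>b\<bar>"
  let ?W = "exp (lam * \<tau>2) * (1 / sqrt \<tau>1)"
  let ?f = "\<lambda>\<epsilon>. SUP t\<in>{\<tau>1<..<\<tau>2}. Linf_norm (\<lambda>r. v \<epsilon> r t + w \<epsilon> r t - S2 t \<phi>b r)"
  have bound: "?f \<epsilon> \<le> ereal (45 * ?N * sqrt \<epsilon> * ?W)" if e: "0 < \<epsilon>" "\<epsilon> < 1 / sqrt pi" for \<epsilon>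
  proof (rule SUP_least)
    fix t assume t: "t \<in> {\<tau>1<..<\<tau>2}"
    have t0: "0 < t" using t tau by simp
    have e1: "\<epsilon> \<le> 1" using e inverse_sqrt_pi_less_1 by linarith
    let ?G = "16 * sqrt \<epsilon> * ?N + 96 * 0"
    obtain g where g: "volterra (sqrt (\<epsilon> / pi)) \<phi>b (flux0 \<epsilon> F) g"
      "\<And>t. 0 < t \<Longrightarrow> \<bar>g t\<bar> \<le> ?G * weight t"
      "\<And>r t. 1 \<le> r \<Longrightarrow> 0 < t \<Longrightarrow> v \<epsilon> r t = sol_v \<epsilon> F \<phi>b g r t" "\<And>r t. 1 \<le> r \<Longrightarrow> 0 < t \<Longrightarrow> w \<epsilon> r t = sol_w \<phi>b g r t"
      using bounded_solution_structure[OF d e(1) e1 sol[OF e]] by metis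
    have gs: "sqrt_sing g" using g by (simp add: volterra_def)
    have G: "0 \<le> ?G" using M e by simp
    have gb': "\<forall>t>0. \<bar>g t\<bar> \<le> ?G * weight t" using g(2) by blast
    note E = sol_estimates[OF F gs gb' G e(1) t0]
    have c: "continuous_on ({1..} \<times> {0<..}) (\<lambda>(r, t). sol_v \<epsilon> F \<phi>b g r t + sol_w \<phi>b g r t)"
      using continuous_on_add[OF sol_continuous(1)[OF F gs e(1), of \<phi>b] sol_continuous(3)[OF F gs e(1), of \<phi>b]]
      by (simp add: case_prod_beta')
    have "continuous_on {1..} (\<lambda>r. (\<lambda>(r, t). sol_v \<epsilon> F \<phi>b g r t + sol_w \<phi>b g r t) (r, t) - S2 t \<phi>b r)"
      unfolding S2_def
      by (intro continuous_on_diff continuous_on_compose2[OF c]) (use t0 in \<open>auto intro!: continuous_intros\<close>)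
    then have cc: "continuous_on {1..} (\<lambda>r. v \<epsilon> r t + w \<epsilon> r t - S2 t \<phi>b r)"
      by (rule continuous_on_eq) (use g t0 in auto)
    show "Linf_norm (\<lambda>r. v \<epsilon> r t + w \<epsilon> r t - S2 t \<phi>b r) \<le> ereal (45 * ?N * sqrt \<epsilon> * ?W)"
    proof (rule Linf_norm_le[OF cc])
      fix r :: real assume r: "1 \<le> r"
      have eq: "v \<epsilon> r t + w \<epsilon> r t - S2 t \<phi>b r = sol_v \<epsilon> F \<phi>b g r t - conv kexp g t / r"
        using g(3,4)[OF r t0] by (simp add: sol_w_def bdW_def S2_exp diff_divide_distrib)
      have s1: "sqrt \<epsilon> \<le> 1" using e1 by simp
      have W0: "0 \<le> weight t" using weight_pos[OF t0] by simp
      have N: "0 \<le> ?N" "\<bar>\<phi>b\<bar> \<le> ?N" "M + \<bar>\<phi>b\<bar> \<le> ?N" using M by auto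
      have "\<bar>sol_v \<epsilon> F \<phi>b g r t\<bar> \<le> (4 / sqrt (t / \<epsilon>)) * (M + \<bar>\<phi>b\<bar>) + sqrt \<epsilon> * (\<bar>\<phi>b\<bar> + 3 / 2 * ?G) * weight t"
        using E(2)[OF r, of \<phi>b] by simp
      \<comment> \<open>25 = 1 + 3/2 * 16, from the boundary datum and the flux bound; altogether 4
        + 25 = 29, and 16 more for the memory term give 45.\<close>
      also have "\<dots> \<le> 4 * (sqrt \<epsilon> * weight t) * ?N + sqrt \<epsilon> * (25 * ?N) * weight t"
      proof (intro add_mono mult_right_mono mult_left_mono mult_mono)
        have "1 / sqrt (t / \<epsilon>) = sqrt \<epsilon> * (1 / sqrt t)" by (simp add: real_sqrt_divide)
        also have "\<dots> \<le> sqrt \<epsilon> * weight t" using e by (intro mult_left_mono inverse_sqrt_le_weight t0) auto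
        finally show "4 / sqrt (t / \<epsilon>) \<le> 4 * (sqrt \<epsilon> * weight t)" by simp
        have "sqrt \<epsilon> * ?N \<le> 1 * ?N" using N s1 by (intro mult_right_mono)
        moreover have "b + 3 / 2 * (16 * s * n + 96 * 0) \<le> 25 * n" if "s * n \<le> 1 * n" "b \<le> n" for b s n :: real
          using that by (simp add: algebra_simps)
        ultimately show "\<bar>\<phi>b\<bar> + 3 / 2 * ?G \<le> 25 * ?N" using N(2) by blast
      qed (use N W0 e M in auto)
      also have "\<dots> = 29 * ?N * sqrt \<epsilon> * weight t" by (simp add: algebra_simps)
      finally have 1: "\<bar>sol_v \<epsilon> F \<phi>b g r t\<bar> \<le> 29 * ?N * sqrt \<epsilon> * weight t" .
      have "\<bar>conv kexp g t / r\<bar> \<le> \<bar>conv kexp g t\<bar>"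
        using r mult_left_mono[OF r abs_ge_zero[of "conv kexp g t"]] by (simp add: abs_divide divide_le_eq)
      also have "\<dots> \<le> ?G * weight t" by (rule E(5)[OF r])
      also have "\<dots> = 16 * ?N * sqrt \<epsilon> * weight t" by simp
      finally have 2: "\<bar>conv kexp g t / r\<bar> \<le> 16 * ?N * sqrt \<epsilon> * weight t" .
      have "\<bar>v \<epsilon> r t + w \<epsilon> r t - S2 t \<phi>b r\<bar> \<le> 29 * ?N * sqrt \<epsilon> * weight t + 16 * ?N * sqrt \<epsilon> * weight t"
        unfolding eq using 1 2 abs_triangle_ineq4[of "sol_v \<epsilon> F \<phi>b g r t" "conv kexp g t / r"] by linarith
      also have "\<dots> = 45 * ?N * sqrt \<epsilon> * weight t" by (simp add: algebra_simps)
      also have "\<dots> \<le> 45 * ?N * sqrt \<epsilon> * ?W"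
      proof (intro mult_left_mono)
        have "weight t \<le> exp (lam * \<tau>2) * (1 / sqrt t)" using t t0 by (intro weight_le) auto
        also have "\<dots> \<le> ?W" using t tau by (intro mult_left_mono divide_left_mono) auto
        finally show "weight t \<le> ?W" .
      qed (use N e in auto)
      finally show "\<bar>v \<epsilon> r t + w \<epsilon> r t - S2 t \<phi>b r\<bar> \<le> 45 * ?N * sqrt \<epsilon> * ?W" .
    qed
  qed
  have nn: "0 \<le> ?f \<epsilon>" for \<epsilon>
  proof -
    have "(\<tau>1 + \<tau>2) / 2 \<in> {\<tau>1<..<\<tau>2}" using tau by auto
    then show ?thesis by (rule SUP_upper2) (rule Linf_norm_nonneg)
  qed
  have "((\<lambda>\<epsilon>. 45 * ?N * sqrt \<epsilon> * ?W) \<longlongrightarrow> 45 * ?N * sqrt 0 * ?W) (at_right 0)"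
    by (intro tendsto_intros)
  then have "((\<lambda>\<epsilon>. ereal (45 * ?N * sqrt \<epsilon> * ?W)) \<longlongrightarrow> ereal 0) (at_right 0)"
    by (intro tendsto_ereal) simp
  then have lim: "((\<lambda>\<epsilon>. ereal (45 * ?N * sqrt \<epsilon> * ?W)) \<longlongrightarrow> 0) (at_right 0)" by (simp add: zero_ereal_def)
  have "0 < 1 / sqrt pi" by simp
  \<comment> \<open>Solutions are supplied only for eps below 1 / sqrt pi, which holds eventually as
    eps tends to 0.\<close>
  then have ev: "\<forall>\<^sub>F \<epsilon> in at_right 0. \<epsilon> \<in> {0<..<1 / sqrt pi}" by (rule eventually_at_right_real)
  show ?thesis
  proof (rule tendsto_sandwich[OF _ _ tendsto_const lim])
    show "\<forall>\<^sub>F \<epsilon> in at_right 0. 0 \<le> ?f \<epsilon>" by (intro always_eventually allI nn)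
    show "\<forall>\<^sub>F \<epsilon> in at_right 0. ?f \<epsilon> \<le> ereal (45 * ?N * sqrt \<epsilon> * ?W)"
      by (rule eventually_mono[OF ev], rule bound) auto
  qed
qed

text \<open>Decaying data have B = 0, so \<open>sup_norm_bound\<close> contains no T / \<epsilon>,
  and the flux constant is at most 16 * N because \<epsilon> <= 1. The constant therefore depends on
  T alone.\<close>

lemma uniform_bound:
  assumes "\<epsilon>0 < 1 / sqrt pi" and T: "0 < T"
  shows "\<exists>C>0. \<forall>\<epsilon> \<phi> \<phi>b v w.
          0 < \<epsilon> \<and> \<epsilon> < \<epsilon>0 \<and> in_Linf \<phi> \<and> Linf_norm (\<lambda>\<rho>. \<rho> * \<phi> \<rho>) < \<infinity> \<and>
          bounded_global_solution \<epsilon> \<phi> \<phi>b v w \<longrightarrow>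
          sup_norm \<epsilon> T v w
            \<le> ereal C * (Linf_norm \<phi> + ereal \<bar>\<phi>b\<bar> + Linf_norm (\<lambda>\<rho>. \<rho> * \<phi> \<rho>))"
proof -
  \<comment> \<open>12 = 11 + 1 collects the free terms and 82 = 2 * 25 + 2 * 16 those containing
    the flux; the outer 2 arises because \<open>?N\<close> counts the boundary datum twice.\<close>
  let ?e = "exp (lam * T)" and ?C = "2 * (12 + 82 * exp (lam * T) * (1 + sqrt T))"
  show ?thesis
  proof (intro exI[of _ ?C] conjI allI impI)
    show "0 < ?C" using T by (intro mult_pos_pos add_pos_nonneg mult_nonneg_nonneg) auto
    fix \<epsilon> \<phi> \<phi>b v w
    assume a: "0 < \<epsilon> \<and> \<epsilon> < \<epsilon>0 \<and> in_Linf \<phi> \<and> Linf_norm (\<lambda>\<rho>. \<rho> * \<phi> \<rho>) < \<infinity> \<and> bounded_global_solution \<epsilon> \<phi> \<phi>b v w"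
    then have "0 < \<epsilon>" "\<epsilon> < \<epsilon>0" and f: "in_Linf \<phi>" and s: "bounded_global_solution \<epsilon> \<phi> \<phi>b v w" by blast+
    then have e: "0 < \<epsilon>" "\<epsilon> \<le> 1" using assms(1) inverse_sqrt_pi_less_1 by linarith+
    obtain M where M: "0 \<le> M" "Linf_norm (\<lambda>\<rho>. \<rho> * \<phi> \<rho>) = ereal M" using a Linf_norm_real by metis
    obtain m where m: "0 \<le> m" "Linf_norm \<phi> = ereal m" using f Linf_norm_real unfolding in_Linf_def by metis
    obtain F where d: "data \<phi> \<phi>b F (M + \<bar>\<phi>b\<bar>) 0" using data_exists_decay[OF f M(2)] by metis
    have F: "lin_growth F (M + \<bar>\<phi>b\<bar>) 0" using d by (simp add: data_def)
    let ?N = "M + \<bar>\<phi>b\<bar> + 0 + \<bar>\<phi>b\<bar>"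
    let ?G = "16 * sqrt \<epsilon> * ?N + 96 * 0"
    obtain g where g: "volterra (sqrt (\<epsilon> / pi)) \<phi>b (flux0 \<epsilon> F) g"
      "\<And>t. 0 < t \<Longrightarrow> \<bar>g t\<bar> \<le> ?G * weight t"
      "\<And>r t. 1 \<le> r \<Longrightarrow> 0 < t \<Longrightarrow> v r t = sol_v \<epsilon> F \<phi>b g r t" "\<And>r t. 1 \<le> r \<Longrightarrow> 0 < t \<Longrightarrow> w r t = sol_w \<phi>b g r t"
      using bounded_solution_structure[OF d e s] by metis
    have gs: "sqrt_sing g" using g by (simp add: volterra_def)
    have N: "0 \<le> ?N" using M by simp
    have G: "0 \<le> ?G" using N e by simp
    have G16: "?G \<le> 16 * ?N" using mult_right_mono[of "sqrt \<epsilon>" 1 ?N] e N by simp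
    have "sup_norm \<epsilon> T v w \<le> ereal (11 * (M + \<bar>\<phi>b\<bar> + 0 + 6 * 0 * sqrt (T / \<epsilon>))
      + 2 * (\<bar>\<phi>b\<bar> + 3 / 2 * ?G) * ?e * (1 + sqrt T) + \<bar>\<phi>b\<bar> + 2 * ?G * ?e * sqrt T)"
      by (rule sup_norm_bound[OF F gs g(2) G e(1) g(3,4)])
    also have "\<dots> \<le> ereal (?C * (m + \<bar>\<phi>b\<bar> + M))"
    proof -
      have "2 * (\<bar>\<phi>b\<bar> + 3 / 2 * ?G) * ?e * (1 + sqrt T) \<le> 2 * (25 * ?N) * ?e * (1 + sqrt T)"
        using G16 M T by (intro mult_right_mono mult_left_mono) auto
      moreover have "2 * ?G * ?e * sqrt T \<le> 2 * (16 * ?N) * ?e * (1 + sqrt T)"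
        using G16 G T N by (intro mult_mono) auto
      moreover have "11 * (M + \<bar>\<phi>b\<bar> + 0 + 6 * 0 * sqrt (T / \<epsilon>)) + \<bar>\<phi>b\<bar> \<le> 12 * ?N" using M by simp
      moreover have "12 * ?N + 2 * (25 * ?N) * ?e * (1 + sqrt T) + 2 * (16 * ?N) * ?e * (1 + sqrt T) = (12 + 82 * ?e * (1 + sqrt T)) * ?N"
        by (simp add: algebra_simps)
      moreover have "(12 + 82 * ?e * (1 + sqrt T)) * ?N \<le> (12 + 82 * ?e * (1 + sqrt T)) * (2 * (m + \<bar>\<phi>b\<bar> + M))"
        using M m T by (intro mult_left_mono add_nonneg_nonneg mult_nonneg_nonneg) auto
      moreover have "(12 + 82 * ?e * (1 + sqrt T)) * (2 * (m + \<bar>\<phi>b\<bar> + M)) = ?C * (m + \<bar>\<phi>b\<bar> + M)" by (simp only: mult_ac)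
      ultimately show ?thesis unfolding ereal_less_eq(3) by linarith
    qed
    finally show "sup_norm \<epsilon> T v w \<le> ereal ?C * (Linf_norm \<phi> + ereal \<bar>\<phi>b\<bar> + Linf_norm (\<lambda>\<rho>. \<rho> * \<phi> \<rho>))"
      unfolding M(2) m(2) by simp
  qed
qed

theorem theorem3:
  shows
   "(\<forall>\<epsilon> \<phi> \<phi>b. 0 < \<epsilon> \<and> \<epsilon> < 1 / sqrt pi \<and> in_Linf \<phi> \<longrightarrow>
       (\<exists>v w. bounded_global_solution \<epsilon> \<phi> \<phi>b v w \<and>
          (\<forall>v' w'. bounded_global_solution \<epsilon> \<phi> \<phi>b v' w' \<longrightarrow>
             (\<forall>r\<ge>1. \<forall>t>0. v' r t = v r t \<and> w' r t = w r t)) \<and>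
          classical_solution \<epsilon> (\<lambda>r t. v r t + w r t)))
    \<and>
    (\<forall>\<phi> \<phi>b v w \<tau>1 \<tau>2.
       in_Linf \<phi> \<and> Linf_norm (\<lambda>\<rho>. \<rho> * \<phi> \<rho>) < \<infinity> \<and> 0 < \<tau>1 \<and> \<tau>1 < \<tau>2 \<and>
       (\<forall>\<epsilon>. 0 < \<epsilon> \<and> \<epsilon> < 1 / sqrt pi \<longrightarrow> bounded_global_solution \<epsilon> \<phi> \<phi>b (v \<epsilon>) (w \<epsilon>)) \<longrightarrow>
       ((\<lambda>\<epsilon>. SUP t\<in>{\<tau>1<..<\<tau>2}. Linf_norm (\<lambda>r. v \<epsilon> r t + w \<epsilon> r t - S2 t \<phi>b r)) \<longlongrightarrow> 0)
         (at_right (0::real)))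
    \<and>
    (\<forall>\<epsilon>0 T. 0 < \<epsilon>0 \<and> \<epsilon>0 < 1 / sqrt pi \<and> 0 < T \<longrightarrow>
       (\<exists>C>0. \<forall>\<epsilon> \<phi> \<phi>b v w.
          0 < \<epsilon> \<and> \<epsilon> < \<epsilon>0 \<and> in_Linf \<phi> \<and> Linf_norm (\<lambda>\<rho>. \<rho> * \<phi> \<rho>) < \<infinity> \<and>
          bounded_global_solution \<epsilon> \<phi> \<phi>b v w \<longrightarrow>
          sup_norm \<epsilon> T v w
            \<le> ereal C * (Linf_norm \<phi> + ereal \<bar>\<phi>b\<bar> + Linf_norm (\<lambda>\<rho>. \<rho> * \<phi> \<rho>))))"
  by (intro conjI allI impI; elim conjE; (rule well_posedness | rule vanishing_limit | rule uniform_bound); blast)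

end
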